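(* For $\omega\in[0,1)$ let $f_\omega:\widehat{\mathbb{C}}\to\widehat{\mathbb{C}}$ be the Blaschke product $$f_\omega(z)=e^{2\pi i\omega}z^2\left(\frac{z-3}{1-3z}\right).$$ Let $\omega\in[0,1)$ be such that the rotation number of $f_\omega|_{S^1}$ is irrational. Then the rational function $f_\omega$ admits a non-atomic invariant ergodic Borel probability measure $\mu$ whose support is contained in the Julia set $J_\omega$ of $f_\omega$ and such that $\chi(\mu)=0$. Moreover, $f_\omega$ does not satisfy the Collet-Eckmann condition.
   Context: $\widehat{\mathbb{C}}$ is the Riemann sphere and $S^1$ the unit circle. Each $f_\omega$ leaves $S^1$ invariant, and $f_\omega|_{S^1}$ is a real-analytic orientation preserving circle homeomorphism with a unique critical point at $1$, of cubic type, and critical value $e^{2\pi i\omega}$. For a rational map $f$ of degree at least two and an $f$-invariant ergodic Borel probability measure $\mu$ supported in the Julia set of $f$, the Lyapunov exponent is $\chi(\mu)=\int_{\widehat{\mathbb{C}}}\log|Df|\,d\mu$, where $Df$ denotes the derivative with respect to the spherical metric ($\log|Df|$ is $\mu$-integrable for all such $\mu$ by a theorem of Przytycki). The Collet-Eckmann condition for $f_\omega$ is the condition at its critical point $1$: there exist $C>0$ and $\lambda>1$ such that $|Df_\omega^n(f_\omega(1))|\geq C\lambda^n$ for all $n\in\mathbb{N}$. *)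

theory Defs
  imports "HOL-Complex_Analysis.Complex_Analysis" "HOL-Probability.Probability"
begin

datatype riemann_sphere = Fin complex | Infty

text \<open>
  Inverse stereographic projection onto the unit sphere of \<open>\<complex> \<times> \<real>\<close>, which carries the Euclidean
  metric. The distance it induces on the Riemann sphere is the chordal metric.
\<close>

fun to_unit_sphere :: "riemann_sphere \<Rightarrow> complex \<times> real" where
  "to_unit_sphere (Fin z) =
     (2 * z / of_real (1 + (norm z)\<^sup>2), ((norm z)\<^sup>2 - 1) / ((norm z)\<^sup>2 + 1))"
| "to_unit_sphere Infty = (0, 1)"

lemma to_unit_sphere_inject: "to_unit_sphere x = to_unit_sphere y \<longleftrightarrow> x = y"
proof
  assume eq: "to_unit_sphere x = to_unit_sphere y"
  have ne: "(1::real) + t\<^sup>2 \<noteq> 0" for t :: real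
    by (smt (verit) zero_le_power2)
  have inf: "((norm z)\<^sup>2 - 1) / ((norm z)\<^sup>2 + 1) \<noteq> 1" for z :: complex
    using ne[of "norm z"] by (simp add: divide_eq_eq)
  show "x = y"
  proof (cases x; cases y)
    fix z w assume xy: "x = Fin z" "y = Fin w"
    let ?a = "(norm z)\<^sup>2" and ?b = "(norm w)\<^sup>2"
    have "(?a - 1) / (?a + 1) = (?b - 1) / (?b + 1)"
      using eq xy by simp
    moreover have "?a + 1 \<noteq> 0" "?b + 1 \<noteq> 0"
      using ne[of "norm z"] ne[of "norm w"] by (simp_all add: add.commute)
    ultimately have ab: "?a = ?b"
      by (simp add: frac_eq_eq algebra_simps)
    have "2 * z / of_real (1 + ?a) = 2 * w / of_real (1 + ?b)"
      using eq xy by simp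
    moreover have "complex_of_real (1 + ?b) \<noteq> 0"
      using ne[of "norm w"] of_real_eq_0_iff by blast
    ultimately have "z = w"
      unfolding ab by simp
    then show ?thesis using xy by simp
  next
    fix z assume "x = Fin z" "y = Infty"
    then show ?thesis using eq inf[of z] by simp
  next
    fix z assume "x = Infty" "y = Fin z"
    then show ?thesis using eq inf[of z] by simp
  qed simp
qed simp

instantiation riemann_sphere :: metric_space
begin

definition dist_riemann_sphere :: "riemann_sphere \<Rightarrow> riemann_sphere \<Rightarrow> real" where
  "dist_riemann_sphere x y = dist (to_unit_sphere x) (to_unit_sphere y)"

definition uniformity_riemann_sphere :: "(riemann_sphere \<times> riemann_sphere) filter" where
  "uniformity_riemann_sphere = (INF e\<in>{0<..}. principal {(x, y). dist x y < e})"

definition open_riemann_sphere :: "riemann_sphere set \<Rightarrow> bool" where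
  "open_riemann_sphere U \<longleftrightarrow> (\<forall>x\<in>U. eventually (\<lambda>(x', y). x' = x \<longrightarrow> y \<in> U) uniformity)"

instance
proof
  fix x y z :: riemann_sphere
  show "(dist x y = 0) = (x = y)"
    by (simp add: dist_riemann_sphere_def to_unit_sphere_inject)
  show "dist x y \<le> dist x z + dist y z"
    unfolding dist_riemann_sphere_def by (rule dist_triangle2)
qed (simp_all add: uniformity_riemann_sphere_def open_riemann_sphere_def)

end

text \<open>
  \<open>chart x\<close> is a holomorphic coordinate around \<open>x\<close>: the identity if \<open>x\<close> is finite and \<open>1 / z\<close> if
  \<open>x = \<infinity>\<close>; \<open>chart_inv x\<close> is its inverse. The values \<open>chart (Fin z) Infty = 0\<close> and
  \<open>chart Infty (Fin 0) = 0\<close> lie outside the coordinate domain and are immaterial.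
  In both coordinates the spherical metric is \<open>2 |du| / (1 + |u|\<^sup>2)\<close>.
\<close>

fun chart :: "riemann_sphere \<Rightarrow> riemann_sphere \<Rightarrow> complex" where
  "chart (Fin _) (Fin w) = w"
| "chart (Fin _) Infty = 0"
| "chart Infty (Fin w) = inverse w"
| "chart Infty Infty = 0"

fun chart_inv :: "riemann_sphere \<Rightarrow> complex \<Rightarrow> riemann_sphere" where
  "chart_inv (Fin _) u = Fin u"
| "chart_inv Infty u = (if u = 0 then Infty else Fin (inverse u))"

definition spherical_density :: "complex \<Rightarrow> real" where
  "spherical_density u = 2 / (1 + (norm u)\<^sup>2)"

definition spherical_deriv :: "(riemann_sphere \<Rightarrow> riemann_sphere) \<Rightarrow> riemann_sphere \<Rightarrow> real" where
  "spherical_deriv f x =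
     norm (deriv (\<lambda>u. chart (f x) (f (chart_inv x u))) (chart x x))
       * spherical_density (chart (f x) (f x)) / spherical_density (chart x x)"

definition normal_family_on ::
    "(riemann_sphere \<Rightarrow> riemann_sphere) set \<Rightarrow> riemann_sphere set \<Rightarrow> bool" where
  "normal_family_on \<F> U \<longleftrightarrow>
     (\<forall>s :: nat \<Rightarrow> riemann_sphere \<Rightarrow> riemann_sphere. range s \<subseteq> \<F> \<longrightarrow>
        (\<exists>r g. strict_mono r \<and>
           (\<forall>K. compact K \<and> K \<subseteq> U \<longrightarrow> uniform_limit K (\<lambda>n. s (r n)) g sequentially)))"

definition fatou_set :: "(riemann_sphere \<Rightarrow> riemann_sphere) \<Rightarrow> riemann_sphere set" where
  "fatou_set f = {x. \<exists>U. open U \<and> x \<in> U \<and> normal_family_on (range (\<lambda>n. f ^^ n)) U}"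

definition julia_set :: "(riemann_sphere \<Rightarrow> riemann_sphere) \<Rightarrow> riemann_sphere set" where
  "julia_set f = - fatou_set f"

definition borel_probability :: "'a::topological_space measure \<Rightarrow> bool" where
  "borel_probability \<mu> \<longleftrightarrow> prob_space \<mu> \<and> sets \<mu> = sets borel"

definition invariant_measure :: "('a \<Rightarrow> 'a) \<Rightarrow> 'a measure \<Rightarrow> bool" where
  "invariant_measure f \<mu> \<longleftrightarrow> f \<in> measurable \<mu> \<mu> \<and> distr \<mu> \<mu> f = \<mu>"

definition ergodic_measure :: "('a \<Rightarrow> 'a) \<Rightarrow> 'a measure \<Rightarrow> bool" where
  "ergodic_measure f \<mu> \<longleftrightarrow>
     (\<forall>A\<in>sets \<mu>. f -` A \<inter> space \<mu> = A \<longrightarrow> emeasure \<mu> A = 0 \<or> emeasure \<mu> (space \<mu> - A) = 0)"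

definition non_atomic :: "'a measure \<Rightarrow> bool" where
  "non_atomic \<mu> \<longleftrightarrow>
     (\<forall>A\<in>sets \<mu>. 0 < emeasure \<mu> A \<longrightarrow>
        (\<exists>B\<in>sets \<mu>. B \<subseteq> A \<and> 0 < emeasure \<mu> B \<and> emeasure \<mu> B < emeasure \<mu> A))"

definition measure_support :: "'a::topological_space measure \<Rightarrow> 'a set" where
  "measure_support \<mu> = {x. \<forall>U. open U \<and> x \<in> U \<longrightarrow> 0 < emeasure \<mu> U}"

text \<open>
  Two conventions matter here. The Bochner integral of a non-integrable function is \<open>0\<close>, so
  integrability of \<open>log |Df|\<close> has to be stated alongside any claim about the exponent. Further,
  \<open>ln 0 = 0\<close> instead of \<open>-\<infinity>\<close>; this has no effect for measures that do not charge the
  (finitely many) critical points, in particular for non-atomic ones.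
\<close>

definition lyapunov_exponent ::
    "(riemann_sphere \<Rightarrow> riemann_sphere) \<Rightarrow> riemann_sphere measure \<Rightarrow> real" where
  "lyapunov_exponent f \<mu> = (\<integral>x. ln (spherical_deriv f x) \<partial>\<mu>)"

definition circle_point :: "real \<Rightarrow> riemann_sphere" where
  "circle_point t = Fin (cis (2 * pi * t))"

definition circle_lift :: "(riemann_sphere \<Rightarrow> riemann_sphere) \<Rightarrow> (real \<Rightarrow> real) \<Rightarrow> bool" where
  "circle_lift f F \<longleftrightarrow>
     continuous_on UNIV F \<and> (\<forall>t. f (circle_point t) = circle_point (F t))"

text \<open>
  For a map preserving the unit circle and acting on it as an orientation preserving homeomorphism,
  the limit exists, is independent of \<open>t\<close>, and depends on the lift only up to an integer.
  The rotation number is taken in \<open>[0, 1)\<close>.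
\<close>

definition rotation_number :: "(riemann_sphere \<Rightarrow> riemann_sphere) \<Rightarrow> real" where
  "rotation_number f =
     (THE \<rho>. \<exists>F L. circle_lift f F
        \<and> (\<forall>t. (\<lambda>n. ((F ^^ n) t - t) / real n) \<longlonglongrightarrow> L) \<and> \<rho> = frac L)"

definition collet_eckmann_at ::
    "(riemann_sphere \<Rightarrow> riemann_sphere) \<Rightarrow> riemann_sphere \<Rightarrow> bool" where
  "collet_eckmann_at f c \<longleftrightarrow>
     (\<exists>C>0. \<exists>l>1. \<forall>n. C * l ^ n \<le> spherical_deriv (f ^^ n) (f c))"

fun blaschke :: "real \<Rightarrow> riemann_sphere \<Rightarrow> riemann_sphere" where
  "blaschke \<omega> (Fin z) =
     (if 1 - 3 * z = 0 then Infty
      else Fin (exp (2 * of_real pi * \<i> * of_real \<omega>) * z\<^sup>2 * ((z - 3) / (1 - 3 * z))))"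
| "blaschke \<omega> Infty = Infty"

end

theory Submission
  imports Defs
begin

text \<open>
  On the unit circle the Blaschke product lifts to an explicit homeomorphism \<open>F\<close> of the line with
  derivative \<open>F' t = 6 s\<^sup>2 / (1 + 3 s\<^sup>2)\<close>, \<open>s = sin (\<pi> t)\<close>, and spherical derivatives at points of the
  circle are derivatives of \<open>F\<close>. Everything about expansion rests on one distortion inequality
  (\<open>slope_product_le\<close>): for \<open>x < y \<le> x + 1\<close>,
  \<open>F' x * F' y * (y - x)\<^sup>2 \<le> K * (F y - F x)\<^sup>2\<close>,
  where \<open>K\<close> is an absolute constant, and \<open>K = 1\<close> if no critical point lies strictly between \<open>x\<close> and \<open>y\<close>.
  The constant is \<open>1\<close> because \<open>1 / sqrt F'\<close> is convex between consecutive critical points (that is, \<open>F\<close> has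
  negative Schwarzian derivative), and it stays bounded across a critical point because \<open>F\<close> is cubic
  there.

  The measure. If the rotation number is irrational, there is a monotone continuous \<open>H\<close> with
  \<open>H (F x) = H x + \<alpha>\<close>. Its leftmost right inverse \<open>G\<close> satisfies \<open>F (G u) = G (u + \<alpha>)\<close>, so \<open>G\<close> transports
  Lebesgue measure of the circle to an invariant measure \<open>\<mu>\<close>, which inherits invariance, ergodicity
  and the absence of atoms from the rotation by \<open>\<alpha>\<close>.

  The exponent. Let \<open>I u\<close> be the interval from \<open>G (u - d)\<close> to \<open>G u\<close>. Then \<open>F\<close> maps \<open>I u\<close> onto \<open>I (u + \<alpha>)\<close>,
  and the lengths of these intervals are bounded away from zero, so the logarithm of the ratio of the
  lengths of \<open>F (I u)\<close> and \<open>I u\<close> has integral zero. As \<open>d\<close> tends to \<open>0\<close>, this ratio tends to \<open>F' (G u)\<close>,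
  and Fatou's lemma shows that \<open>ln F'\<close> is integrable with nonnegative integral. Conversely, the
  distortion inequality at the two endpoints of \<open>I u\<close> bounds the sum of \<open>ln F'\<close> at \<open>G u\<close> and at
  \<open>G (u - d)\<close> by twice the logarithm of the ratio, plus \<open>ln K\<close> when \<open>I u\<close> contains a critical point, which
  happens with probability at most \<open>d\<close>. Integration gives \<open>2 \<chi> \<le> d ln K\<close> for every \<open>d\<close>, hence \<open>\<chi> = 0\<close>.

  Collet-Eckmann. Multiply the distortion inequality along the orbit of the critical value \<open>x\<close> and of
  a close return \<open>F\<^sup>q x - p\<close>. The interval between the two meets a critical point at most once in
  every \<open>N\<close> steps, where \<open>N\<close> is large if the return is close. So the product of the derivatives of
  \<open>F\<^sup>n\<close> and \<open>F\<^bsup>n+q\<^esup>\<close> at \<open>x\<close> is at most a constant times \<open>K\<^bsup>n/N\<^esup>\<close>. Since \<open>N\<close> is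
  arbitrary, this rules out exponential growth.

  The Julia set. Near a support point in the Fatou set, a subsequence of the iterates would converge
  to a holomorphic map. The preimages of the critical point in this neighbourhood are zeros of
  its derivative and accumulate inside it, so the limit would be constant. But an arc of positive measure
  keeps its measure under iteration and cannot shrink to a point.
\<close>

section \<open>Monotone circle maps with irrational translation number\<close>

lemma funpow_degree_one:
  fixes F :: "real \<Rightarrow> real"
  assumes "\<And>t. F (t + 1) = F t + 1"
  shows "(F ^^ n) (t + of_int m) = (F ^^ n) t + of_int m"
proof -
  have nat: "F (t + real k) = F t + real k" for t k
    by (induction k) (simp_all add: assms add.assoc[symmetric] add.commute[of 1])
  have "F (t + of_int m) = F t + of_int m" for t m
  proof (cases "0 \<le> m")
    case True
    then show ?thesis using nat[of t "nat m"] by simp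
  next
    case False
    then show ?thesis using nat[of "t + of_int m" "nat (- m)"] by simp
  qed
  then show ?thesis by (induction n) simp_all
qed

text \<open>
  The displacements \<open>a n = F\<^sup>n 0\<close> are additive up to an error \<open>1\<close>, so \<open>a n - 1\<close> is superadditive and
  \<open>a n + 1\<close> is subadditive. Every \<open>(a n - 1) / n\<close> therefore lies below every \<open>(a m + 1) / m\<close>, and any
  number in between does the job.
\<close>

lemma translation_number_exists:
  fixes F :: "real \<Rightarrow> real"
  assumes mono: "mono F" and deg: "\<And>t. F (t + 1) = F t + 1"
  obtains \<alpha> where "\<And>n t. \<bar>(F ^^ n) t - t - real n * \<alpha>\<bar> \<le> 2"
proof -
  define a where "a n = (F ^^ n) 0" for n
  have monon: "mono (F ^^ n)" for n by (intro monoI funpow_mono mono)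
  have dev: "\<bar>(F ^^ n) t - t - a n\<bar> \<le> 1" for n t
  proof -
    have "(F ^^ n) t = (F ^^ n) (frac t) + of_int \<lfloor>t\<rfloor>"
      using funpow_degree_one[of F n "frac t" "\<lfloor>t\<rfloor>", OF deg] by (simp add: frac_def)
    moreover have "a n \<le> (F ^^ n) (frac t)"
      unfolding a_def by (rule monoD[OF monon]) simp
    moreover have "(F ^^ n) (frac t) \<le> (F ^^ n) (0 + of_int 1)"
      by (rule monoD[OF monon]) (simp add: frac_lt_1 less_imp_le)
    then have "(F ^^ n) (frac t) \<le> a n + 1"
      unfolding a_def funpow_degree_one[of F n 0 1, OF deg] by simp
    ultimately show ?thesis using frac_lt_1[of t] frac_ge_0[of t] by (simp add: frac_def abs_le_iff) linarith
  qed
  have quasi: "\<bar>a (n + m) - a n - a m\<bar> \<le> 1" for n m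
    using dev[of n "a m"] by (simp add: a_def funpow_add abs_le_iff)
  have sup: "real k * (a n - 1) \<le> a (k * n) - 1" and sub: "a (k * n) + 1 \<le> real k * (a n + 1)" if "0 < k" for k n
    using that
  proof (induction k rule: nat_induct_non_zero)
    case (Suc k)
    { case 1 show ?case using Suc(2) quasi[of n "k * n"] by (simp add: algebra_simps abs_le_iff) }
    { case 2 show ?case using Suc(3) quasi[of n "k * n"] by (simp add: algebra_simps abs_le_iff) }
  qed auto
  have key: "(a n - 1) / real n \<le> (a m + 1) / real m" if "0 < n" "0 < m" for n m
  proof -
    have "real m * (a n - 1) \<le> real n * (a m + 1)"
      using sup[OF that(2), of n] sub[OF that(1), of m] by (simp add: mult.commute)
    then show ?thesis using that by (simp add: field_simps)
  qed
  \<comment> \<open>Any number between the two families would serve; take the least one.\<close>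
  define \<alpha> where "\<alpha> = (SUP n\<in>{0<..}. (a n - 1) / real n)"
  have lo: "(a n - 1) / real n \<le> \<alpha>" if "0 < n" for n
    unfolding \<alpha>_def using that key[of _ 1] by (intro cSUP_upper bdd_aboveI2) auto
  have hi: "\<alpha> \<le> (a n + 1) / real n" if "0 < n" for n
    unfolding \<alpha>_def using that key by (intro cSUP_least) auto
  have a: "\<bar>a n - real n * \<alpha>\<bar> \<le> 1" for n
    using lo[of n] hi[of n] by (cases "n = 0") (auto simp: a_def field_simps abs_le_iff)
  have "\<bar>(F ^^ n) t - t - real n * \<alpha>\<bar> \<le> 2" for n t
    using dev[of n t] a[of n] by linarith
  then show ?thesis by (rule that)
qed

lemma cInf_translate:
  fixes S S' :: "real set"
  assumes "S \<noteq> {}" "bdd_below S" "\<And>c. c \<in> S' \<longleftrightarrow> c - d \<in> S"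
  shows "Inf S' = Inf S + d"
proof (rule antisym)
  obtain s where "s \<in> S" using assms(1) by auto
  have ne: "S' \<noteq> {}" using \<open>s \<in> S\<close> assms(3)[of "s + d"] by auto
  obtain b where b: "\<And>s. s \<in> S \<Longrightarrow> b \<le> s" using assms(2) by (auto simp: bdd_below_def)
  have bd: "bdd_below S'" using b assms(3) by (intro bdd_belowI[of _ "b + d"]) force
  have "Inf S' - d \<le> Inf S"
  proof (rule cInf_greatest[OF assms(1)])
    fix c assume "c \<in> S"
    then have "Inf S' \<le> c + d" using assms(3)[of "c + d"] by (intro cInf_lower bd) auto
    then show "Inf S' - d \<le> c" by simp
  qed
  then show "Inf S' \<le> Inf S + d" by simp
  show "Inf S + d \<le> Inf S'"
  proof (rule cInf_greatest[OF ne])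
    fix c assume "c \<in> S'"
    then have "Inf S \<le> c - d" using assms by (intro cInf_lower) auto
    then show "Inf S + d \<le> c" by simp
  qed
qed

lemma irrational_orbit_dense:
  fixes \<alpha> :: real
  assumes "\<alpha> \<notin> \<rat>" "a < b"
  obtains n :: nat and m :: int where "a < real n * \<alpha> + of_int m" "real n * \<alpha> + of_int m < b"
proof -
  obtain h k where hk: "k > 0" "\<bar>of_int k * \<alpha> - of_int h - (a + b) / 2\<bar> < (b - a) / 2"
    using assms(2) by (rule_tac sequence_of_fractional_parts_is_dense[OF assms(1), of "(b - a) / 2" "(a + b) / 2"]) auto
  then have "a < real (nat k) * \<alpha> + of_int (- h)" "real (nat k) * \<alpha> + of_int (- h) < b"
    unfolding abs_less_iff by (simp_all add: field_simps)
  then show ?thesis using that[of "nat k" "- h"] hk(1) by simp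
qed

lemma multiple_away_from_int:
  fixes \<alpha> :: real
  assumes irr: "\<alpha> \<notin> \<rat>" and "0 < k"
  obtains \<eta> where "0 < \<eta>" "\<And>m :: int. \<eta> < \<bar>real k * \<alpha> - of_int m\<bar>"
proof -
  define r where "r = frac (real k * \<alpha>)"
  have "real k * \<alpha> \<notin> \<int>"
  proof
    assume "real k * \<alpha> \<in> \<int>"
    then obtain m :: int where "real k * \<alpha> = of_int m" by (elim Ints_cases)
    then have "\<alpha> = of_int m / real k" using assms by (simp add: field_simps)
    then show False using irr by simp
  qed
  then have r: "0 < r" "r < 1" by (simp_all add: r_def frac_gt_0_iff frac_lt_1)
  have "min r (1 - r) / 2 < \<bar>real k * \<alpha> - of_int m\<bar>" for m
  proof -
    define j where "j = \<lfloor>real k * \<alpha>\<rfloor> - m"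
    have e: "real k * \<alpha> - of_int m = r + of_int j" by (simp add: r_def frac_def j_def)
    show ?thesis
    proof (cases "0 \<le> j")
      case True
      then show ?thesis unfolding e using r by (simp add: min_def)
    next
      case False
      then have "of_int j \<le> (-1 :: real)" by simp
      then show ?thesis unfolding e using r by (simp add: min_def)
    qed
  qed
  then show ?thesis using that[of "min r (1 - r) / 2"] r by simp
qed

text \<open>
  This fixes a scale below which the rotation by \<open>\<alpha>\<close> has no close return before time \<open>N\<close>.
\<close>

lemma multiples_away_from_int:
  fixes \<alpha> :: real
  assumes irr: "\<alpha> \<notin> \<rat>"
  shows "\<exists>\<eta>>0. \<forall>k. 0 < k \<and> k < N \<longrightarrow> (\<forall>m :: int. \<eta> < \<bar>real k * \<alpha> - of_int m\<bar>)"
proof (induction N)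
  case 0
  show ?case by (intro exI[of _ 1]) simp
next
  case (Suc N)
  then obtain \<eta> where \<eta>: "0 < \<eta>" "\<forall>k. 0 < k \<and> k < N \<longrightarrow> (\<forall>m :: int. \<eta> < \<bar>real k * \<alpha> - of_int m\<bar>)" by blast
  show ?case
  proof (cases "N = 0")
    case True
    then show ?thesis by (intro exI[of _ 1]) simp
  next
    case False
    then obtain \<eta>' where \<eta>': "0 < \<eta>'" "\<And>m :: int. \<eta>' < \<bar>real N * \<alpha> - of_int m\<bar>"
      using multiple_away_from_int[OF irr, of N] by auto
    show ?thesis
    proof (intro exI[of _ "min \<eta> \<eta>'"] conjI allI impI)
      fix k m assume "0 < k \<and> k < Suc N"
      then show "min \<eta> \<eta>' < \<bar>real k * \<alpha> - of_int m\<bar>"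
        using \<eta> \<eta>' by (cases "k = N") (auto simp: min_less_iff_disj)
    qed (use \<eta> \<eta>' in simp)
  qed
qed

text \<open>
  The abstract setting for Poincare's theorem: \<open>F\<close> lifts an orientation preserving circle
  homeomorphism, and \<open>\<alpha>\<close> is its translation number.
\<close>

locale irrational_circle_map =
  fixes F :: "real \<Rightarrow> real" and \<alpha> :: real
  assumes strict_mono_F: "strict_mono F"
    and continuous_F: "continuous_on UNIV F"
    and degree_one: "\<And>t. F (t + 1) = F t + 1"
    and bounded_deviation: "\<And>n t. \<bar>(F ^^ n) t - t - real n * \<alpha>\<bar> \<le> 2"
    and irrational: "\<alpha> \<notin> \<rat>"
begin

lemma F_plus_int: "F (t + of_int m) = F t + of_int m"
  using funpow_degree_one[of F 1 t m, OF degree_one] by simp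

lemma F_less_iff: "F x < F y \<longleftrightarrow> x < y" and F_le_iff: "F x \<le> F y \<longleftrightarrow> x \<le> y"
  using strict_mono_F by (simp_all add: strict_mono_less strict_mono_less_eq)

lemma surj_F: "\<exists>y. F y = x"
proof -
  define m where "m = \<lfloor>x - F 0\<rfloor>"
  have "F (of_int m) = F 0 + of_int m" "F (of_int (m + 1)) = F 0 + of_int m + 1"
    using F_plus_int[of 0 m] F_plus_int[of 0 "m + 1"] by simp_all
  then have "F (of_int m) \<le> x" "x \<le> F (of_int (m + 1))"
    unfolding m_def by linarith+
  then show ?thesis
    using IVT'[of F "of_int m" x "of_int (m + 1)"] continuous_on_subset[OF continuous_F] by auto
qed

text \<open>
  The infimum of this set is the limit superior of \<open>F\<^sup>n x - n \<alpha>\<close>. Taking the limit superior, rather than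
  the supremum, makes the semiconjugacy equation hold with equality.
\<close>

definition eventual_bounds :: "real \<Rightarrow> real set" where
  "eventual_bounds x = {c. \<forall>\<^sub>F n in sequentially. (F ^^ n) x - real n * \<alpha> \<le> c}"

lemma eventual_bounds_nonempty: "eventual_bounds x \<noteq> {}"
proof -
  have "x + 2 \<in> eventual_bounds x"
    unfolding eventual_bounds_def
    using bounded_deviation[of _ x] by (auto simp: abs_le_iff algebra_simps intro!: always_eventually)
  then show ?thesis by blast
qed

lemma eventual_bounds_bdd: "bdd_below (eventual_bounds x)"
proof (rule bdd_belowI[of _ "x - 2"])
  fix c assume "c \<in> eventual_bounds x"
  then obtain n where "(F ^^ n) x - real n * \<alpha> \<le> c"
    unfolding eventual_bounds_def eventually_sequentially by auto
  then show "x - 2 \<le> c" using bounded_deviation[of n x] by (simp add: abs_le_iff)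
qed

lemma mono_Inf_eventual_bounds: 
  assumes "x \<le> y" shows "Inf (eventual_bounds x) \<le> Inf (eventual_bounds y)"
proof (rule cInf_superset_mono[OF eventual_bounds_nonempty eventual_bounds_bdd])
  have le: "(F ^^ n) x \<le> (F ^^ n) y" for n
    using assms by (induction n) (simp_all add: F_le_iff)
  show "eventual_bounds y \<subseteq> eventual_bounds x"
    unfolding eventual_bounds_def
    by (auto elim!: eventually_mono intro: order.trans[OF diff_right_mono[OF le]])
qed

definition semiconj :: "real \<Rightarrow> real" where
  "semiconj x = Inf (eventual_bounds x) - Inf (eventual_bounds 0)"

lemma semiconj_0 [simp]: "semiconj 0 = 0"
  by (simp add: semiconj_def)

lemma semiconj_mono: "x \<le> y \<Longrightarrow> semiconj x \<le> semiconj y"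
  using mono_Inf_eventual_bounds by (simp add: semiconj_def)

lemma semiconj_plus_int: "semiconj (x + of_int m) = semiconj x + of_int m"
proof -
  have "Inf (eventual_bounds (x + of_int m)) = Inf (eventual_bounds x) + of_int m"
    by (rule cInf_translate[OF eventual_bounds_nonempty eventual_bounds_bdd])
       (simp add: eventual_bounds_def funpow_degree_one[of F, OF degree_one] algebra_simps)
  then show ?thesis by (simp add: semiconj_def)
qed

lemma semiconj_of_int [simp]: "semiconj (of_int m) = of_int m"
  using semiconj_plus_int[of 0 m] by simp

lemma semiconj_F: "semiconj (F x) = semiconj x + \<alpha>"
proof -
  have "Inf (eventual_bounds (F x)) = Inf (eventual_bounds x) + \<alpha>"
  proof (rule cInf_translate[OF eventual_bounds_nonempty eventual_bounds_bdd])
    fix c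
    have "(\<forall>\<^sub>F n in sequentially. (F ^^ n) x - real n * \<alpha> \<le> c - \<alpha>)
        \<longleftrightarrow> (\<forall>\<^sub>F n in sequentially. (F ^^ Suc n) x - real (Suc n) * \<alpha> \<le> c - \<alpha>)"
      by (rule eventually_sequentially_Suc[symmetric])
    then show "c \<in> eventual_bounds (F x) \<longleftrightarrow> c - \<alpha> \<in> eventual_bounds x"
      by (simp add: eventual_bounds_def funpow_Suc_right algebra_simps del: funpow.simps)
  qed
  then show ?thesis by (simp add: semiconj_def)
qed

lemma semiconj_funpow: "semiconj ((F ^^ n) x) = semiconj x + real n * \<alpha>"
  by (induction n) (simp_all add: semiconj_F algebra_simps)

lemma semiconj_dense_range:
  assumes "a < b" obtains y where "a < semiconj y" "semiconj y < b"
proof -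
  obtain n m where "a < real n * \<alpha> + of_int m" "real n * \<alpha> + of_int m < b"
    using irrational_orbit_dense[OF irrational assms] by metis
  then show ?thesis
    using that[of "(F ^^ n) 0 + of_int m"] by (simp add: semiconj_plus_int semiconj_funpow)
qed

text \<open>
  A monotone function with dense range has no jumps. The range is dense because it is invariant under
  translation by \<open>\<alpha>\<close> and by \<open>1\<close>.
\<close>

lemma continuous_semiconj: "continuous_on A semiconj"
proof (rule continuous_at_imp_continuous_on, rule ballI)
  fix x
  show "isCont semiconj x"
    unfolding continuous_at_eps_delta
  proof (intro allI impI)
    fix e :: real assume "0 < e"
    obtain y where y: "semiconj x - e < semiconj y" "semiconj y < semiconj x"
      using semiconj_dense_range[of "semiconj x - e" "semiconj x"] \<open>0 < e\<close> by auto
    obtain y' where y': "semiconj x < semiconj y'" "semiconj y' < semiconj x + e"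
      using semiconj_dense_range[of "semiconj x" "semiconj x + e"] \<open>0 < e\<close> by auto
    have lt: "y < x" "x < y'"
      using semiconj_mono y y' by (meson not_le)+
    show "\<exists>d>0. \<forall>x'. dist x' x < d \<longrightarrow> dist (semiconj x') (semiconj x) < e"
    proof (intro exI[of _ "min (x - y) (y' - x)"] conjI allI impI)
      fix x' assume "dist x' x < min (x - y) (y' - x)"
      then have "y \<le> x'" "x' \<le> y'" by (auto simp: dist_real_def)
      then show "dist (semiconj x') (semiconj x) < e"
        using semiconj_mono[of y x'] semiconj_mono[of x' y'] y y' by (simp add: dist_real_def)
    qed (use lt in auto)
  qed
qed

lemma uniformly_continuous_semiconj: 
  assumes "0 < e" obtains d where "0 < d" "\<And>x y. \<bar>x - y\<bar> < d \<Longrightarrow> \<bar>semiconj x - semiconj y\<bar> < e"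
proof -
  have "uniformly_continuous_on {-1..2} semiconj"
    by (rule compact_uniformly_continuous[OF continuous_semiconj]) auto
  then obtain d where d: "0 < d" "\<And>x y. x \<in> {-1..2} \<Longrightarrow> y \<in> {-1..2} \<Longrightarrow> dist x y < d \<Longrightarrow> dist (semiconj x) (semiconj y) < e"
    using assms unfolding uniformly_continuous_on_def by metis
  show ?thesis
  proof (rule that[of "min d 1"])
    fix x y assume xy: "\<bar>x - y\<bar> < min d 1"
    have "x - \<lfloor>x\<rfloor> \<in> {-1..2}" "y - \<lfloor>x\<rfloor> \<in> {-1..2}"
      using xy by (auto; linarith)+
    then have "dist (semiconj (x + of_int (- \<lfloor>x\<rfloor>))) (semiconj (y + of_int (- \<lfloor>x\<rfloor>))) < e"
      using xy by (intro d(2)) (auto simp: dist_real_def)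
    then show "\<bar>semiconj x - semiconj y\<bar> < e"
      unfolding semiconj_plus_int by (simp add: dist_real_def)
  qed (use d in simp)
qed

lemma semiconj_surj: "\<exists>x. semiconj x = u"
proof -
  have "semiconj (of_int \<lfloor>u\<rfloor>) \<le> u" "u \<le> semiconj (of_int (\<lfloor>u\<rfloor> + 1))"
    unfolding semiconj_of_int by linarith+
  then show ?thesis
    using IVT'[of semiconj "of_int \<lfloor>u\<rfloor>" u "of_int (\<lfloor>u\<rfloor> + 1)"] continuous_semiconj by auto
qed

text \<open>
  The leftmost point of the fibre of \<open>semiconj\<close> over \<open>u\<close>. Together the two maps form a Galois
  connection, from which the commutation with \<open>F\<close> and with integer translations follows.
\<close>

definition section_pt :: "real \<Rightarrow> real" where
  "section_pt u = Inf {x. u \<le> semiconj x}"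

lemma section_pt_le_iff: "section_pt u \<le> x \<longleftrightarrow> u \<le> semiconj x"
proof -
  let ?S = "{x. u \<le> semiconj x}"
  have ne: "?S \<noteq> {}" using semiconj_surj[of u] by force
  have bd: "bdd_below ?S"
  proof (rule bdd_belowI[of _ "of_int (\<lfloor>u\<rfloor> - 1)"])
    fix x assume "x \<in> ?S"
    then have "semiconj (of_int (\<lfloor>u\<rfloor> - 1)) < semiconj x"
      unfolding semiconj_of_int by simp linarith
    then show "of_int (\<lfloor>u\<rfloor> - 1) \<le> x" using semiconj_mono by (meson linorder_not_le nle_le)
  qed
  have cl: "closed ?S"
    by (intro closed_Collect_le continuous_intros continuous_semiconj)
  have "section_pt u \<in> ?S" unfolding section_pt_def by (rule closed_contains_Inf[OF ne bd cl])
  then show ?thesis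
    using semiconj_mono[of "section_pt u" x] cInf_lower[OF _ bd, of x] by (auto simp: section_pt_def)
qed

lemma less_section_pt_iff: "x < section_pt u \<longleftrightarrow> semiconj x < u"
  using section_pt_le_iff[of u x] by linarith

lemma semiconj_section_pt [simp]: "semiconj (section_pt u) = u"
proof (rule antisym)
  obtain y where "semiconj y = u" using semiconj_surj by blast
  then show "semiconj (section_pt u) \<le> u"
    using section_pt_le_iff[of u y] semiconj_mono[of "section_pt u" y] by simp
  show "u \<le> semiconj (section_pt u)"
    using section_pt_le_iff[of u "section_pt u"] by simp
qed

lemma section_pt_less_iff: "section_pt u < section_pt v \<longleftrightarrow> u < v"
  using section_pt_le_iff[of v "section_pt u"] by (simp add: not_le[symmetric])

lemma section_pt_plus_int: "section_pt (u + of_int m) = section_pt u + of_int m"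
proof -
  have "section_pt (u + of_int m) \<le> x \<longleftrightarrow> section_pt u + of_int m \<le> x" for x
  proof -
    have "u + of_int m \<le> semiconj x \<longleftrightarrow> u \<le> semiconj (x + of_int (- m))"
      unfolding semiconj_plus_int by auto
    then show ?thesis unfolding section_pt_le_iff using section_pt_le_iff[of u "x + of_int (- m)"] by auto
  qed
  then show ?thesis by (meson order.antisym order.refl)
qed

lemma section_pt_rotate: "section_pt (u + \<alpha>) = F (section_pt u)"
proof -
  have "section_pt (u + \<alpha>) \<le> x \<longleftrightarrow> F (section_pt u) \<le> x" for x
  proof -
    obtain y where y: "F y = x" using surj_F by blast
    have "section_pt (u + \<alpha>) \<le> x \<longleftrightarrow> section_pt u \<le> y"
      unfolding section_pt_le_iff using semiconj_F[of y] y by auto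
    then show ?thesis using F_le_iff[of "section_pt u" y] y by simp
  qed
  then show ?thesis by (meson order.antisym order.refl)
qed

lemma section_pt_pos: "0 < u \<Longrightarrow> 0 < section_pt u"
  by (simp add: less_section_pt_iff)

lemma section_pt_le_one: "u \<le> 1 \<Longrightarrow> section_pt u \<le> 1"
  using semiconj_of_int[of 1] by (simp add: section_pt_le_iff del: semiconj_of_int)

lemma mono_section_pt: "mono section_pt"
  using section_pt_less_iff by (auto intro!: monoI simp: not_less[symmetric])

lemma section_pt_int_iff: "section_pt u = of_int m \<Longrightarrow> u = of_int m"
  using semiconj_section_pt[of u] by simp

lemma section_pt_left_continuous:
  assumes d: "d \<longlonglongrightarrow> 0" "\<And>n. 0 < d n"
  shows "(\<lambda>n. section_pt (u - d n)) \<longlonglongrightarrow> section_pt u"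
proof (rule order_tendstoI)
  fix a assume "a < section_pt u"
  then have "0 < u - semiconj a" by (simp add: less_section_pt_iff)
  then have "\<forall>\<^sub>F n in sequentially. d n < u - semiconj a" using order_tendstoD(2)[OF d(1)] by blast
  then show "\<forall>\<^sub>F n in sequentially. a < section_pt (u - d n)"
    by (auto elim!: eventually_mono simp: less_section_pt_iff)
next
  fix a assume a: "section_pt u < a"
  have "section_pt (u - d n) < section_pt u" for n using d(2) by (simp add: section_pt_less_iff)
  then show "\<forall>\<^sub>F n in sequentially. section_pt (u - d n) < a"
    using a by (intro always_eventually) (meson order.strict_trans)
qed

text \<open>
  This is uniform continuity of \<open>semiconj\<close>, read backwards: arcs of a given measure cannot be
  arbitrarily short.
\<close>

lemma section_pt_gap:
  assumes "0 < d" obtains c where "0 < c" "\<And>u. c \<le> section_pt u - section_pt (u - d)"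
proof -
  obtain c where c: "0 < c" "\<And>x y. \<bar>x - y\<bar> < c \<Longrightarrow> \<bar>semiconj x - semiconj y\<bar> < d"
    using uniformly_continuous_semiconj[OF assms] by metis
  have "c \<le> section_pt u - section_pt (u - d)" for u
  proof (rule ccontr)
    assume "\<not> c \<le> section_pt u - section_pt (u - d)"
    moreover have "section_pt (u - d) < section_pt u" using assms by (simp add: section_pt_less_iff)
    ultimately have "\<bar>section_pt u - section_pt (u - d)\<bar> < c" by simp
    from c(2)[OF this] assms show False by simp
  qed
  then show ?thesis using that c by blast
qed

text \<open>
  Two points whose images under \<open>semiconj\<close> differ by \<open>\<eta>\<close> stay apart on the circle, hence so do
  their images under all iterates.
\<close>

lemma separation_mod_one:
  assumes "0 < \<eta>" "\<eta> < 1"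
  obtains c where "0 < c" "\<And>s t m. semiconj s - semiconj t = \<eta> \<Longrightarrow> c \<le> \<bar>s - t - of_int m\<bar>"
proof -
  obtain c where c: "0 < c" "\<And>x y. \<bar>x - y\<bar> < c \<Longrightarrow> \<bar>semiconj x - semiconj y\<bar> < min \<eta> (1 - \<eta>)"
    using uniformly_continuous_semiconj[of "min \<eta> (1 - \<eta>)"] assms by auto
  have "c \<le> \<bar>s - t - of_int m\<bar>" if st: "semiconj s - semiconj t = \<eta>" for s t m
  proof (rule ccontr)
    assume "\<not> c \<le> \<bar>s - t - of_int m\<bar>"
    then have "\<bar>semiconj s - semiconj (t + of_int m)\<bar> < min \<eta> (1 - \<eta>)"
      by (intro c(2)) (simp add: algebra_simps)
    then have "\<bar>\<eta> - of_int m\<bar> < min \<eta> (1 - \<eta>)"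
      using st by (simp add: semiconj_plus_int algebra_simps)
    then have "of_int m < (1::real)" "(0::real) < of_int m" by linarith+
    then show False by simp
  qed
  then show ?thesis using that c by blast
qed

end

section \<open>Rotations of the circle\<close>

lemma periodic_int:
  fixes g :: "real \<Rightarrow> 'a"
  assumes "\<And>u. g (u + 1) = g u"
  shows "g (u + of_int m) = g u"
proof -
  have nat: "g (u + real k) = g u" for u k
  proof (induction k)
    case (Suc k)
    have "u + real (Suc k) = (u + real k) + 1" by simp
    then show ?case using assms[of "u + real k"] Suc by (simp only:)
  qed simp
  show ?thesis
  proof (cases "0 \<le> m")
    case True
    then show ?thesis using nat[of u "nat m"] by simp
  next
    case False
    then show ?thesis using nat[of "u + of_int m" "nat (- m)"] by simp
  qed
qed

lemma emeasure_lborel_translate: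
  fixes A :: "real set"
  assumes [measurable]: "A \<in> sets borel"
  shows "emeasure lborel {u. u + c \<in> A} = emeasure lborel A"
proof -
  have "emeasure lborel A = emeasure (distr lborel borel ((+) c)) A"
    by (simp add: lborel_distr_plus)
  also have "\<dots> = emeasure lborel ((+) c -` A \<inter> space lborel)"
    by (rule emeasure_distr) auto
  also have "(+) c -` A \<inter> space lborel = {u. u + c \<in> A}" by (auto simp: add.commute)
  finally show ?thesis by simp
qed

lemma emeasure_period:
  fixes E :: "real set"
  assumes [measurable]: "E \<in> sets borel" and per: "\<And>u. u + 1 \<in> E \<longleftrightarrow> u \<in> E"
  shows "emeasure lborel (E \<inter> {a<..a + 1}) = emeasure lborel (E \<inter> {0<..1})"
proof -
  define k where "k = \<lfloor>a\<rfloor>"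
  define r where "r = a - of_int k"
  have r: "0 \<le> r" "r < 1" unfolding r_def k_def by linarith+
  have pint: "u + of_int m \<in> E \<longleftrightarrow> u \<in> E" for u and m :: int
    using periodic_int[of "\<lambda>u. u \<in> E", OF per] by simp
  have s1: "{u. u + of_int k \<in> E \<inter> {a<..of_int k + 1}} = E \<inter> {r<..1}"
    using pint by (auto simp: r_def)
  have s2: "{u. u + of_int (k + 1) \<in> E \<inter> {of_int k + 1<..a + 1}} = E \<inter> {0<..r}"
    unfolding Int_iff pint using pint by (auto simp: r_def algebra_simps)
  have "E \<inter> {a<..a + 1} = (E \<inter> {a<..of_int k + 1}) \<union> (E \<inter> {of_int k + 1<..a + 1})"
    using r by (auto simp: r_def)
  then have "emeasure lborel (E \<inter> {a<..a + 1}) = emeasure lborel (E \<inter> {a<..of_int k + 1}) + emeasure lborel (E \<inter> {of_int k + 1<..a + 1})"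
    by (simp only:) (rule plus_emeasure[symmetric], auto)
  also have "emeasure lborel (E \<inter> {a<..of_int k + 1}) = emeasure lborel (E \<inter> {r<..1})"
    using emeasure_lborel_translate[of "E \<inter> {a<..of_int k + 1}" "of_int k"] unfolding s1 by simp
  also have "emeasure lborel (E \<inter> {of_int k + 1<..a + 1}) = emeasure lborel (E \<inter> {0<..r})"
    using emeasure_lborel_translate[of "E \<inter> {of_int k + 1<..a + 1}" "of_int (k + 1)"] unfolding s2 by simp
  also have "emeasure lborel (E \<inter> {r<..1}) + emeasure lborel (E \<inter> {0<..r}) = emeasure lborel ((E \<inter> {r<..1}) \<union> (E \<inter> {0<..r}))"
    by (rule plus_emeasure) auto
  also have "(E \<inter> {r<..1}) \<union> (E \<inter> {0<..r}) = E \<inter> {0<..1}" using r by auto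
  finally show ?thesis .
qed

text \<open>
  The circle with its Lebesgue measure. The half-open window \<open>(0, 1]\<close> is the one that \<open>section_pt\<close> maps
  into itself.
\<close>

definition unit_window :: "real measure" where
  "unit_window = restrict_space lborel {0<..1}"

lemma space_unit_window [simp]: "space unit_window = {0<..1}"
  by (simp add: unit_window_def space_restrict_space)

lemma sets_unit_window: "A \<in> sets unit_window \<longleftrightarrow> A \<in> sets borel \<and> A \<subseteq> {0<..1}"
  by (auto simp: unit_window_def sets_restrict_space_iff)

lemma emeasure_unit_window: "A \<subseteq> {0<..1} \<Longrightarrow> emeasure unit_window A = emeasure lborel A"
  by (simp add: unit_window_def emeasure_restrict_space)

lemma prob_space_unit_window: "prob_space unit_window"
  by (rule prob_spaceI) (simp add: emeasure_unit_window)

lemma measurable_unit_window: "g \<in> measurable borel M \<Longrightarrow> g \<in> measurable unit_window M"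
  unfolding unit_window_def by (rule measurable_restrict_space1) simp

text \<open>
  The representative of \<open>u + a\<close> modulo \<open>1\<close> in the window \<open>(0, 1]\<close>; that this window is closed on the right
  is the reason for the ceiling.
\<close>

definition circle_rotation :: "real \<Rightarrow> real \<Rightarrow> real" where
  "circle_rotation a u = u + a - of_int (\<lceil>u + a\<rceil> - 1)"

lemma circle_rotation_window: "0 < circle_rotation a u" "circle_rotation a u \<le> 1"
  unfolding circle_rotation_def by linarith+

lemma measurable_circle_rotation [measurable]: "circle_rotation a \<in> borel_measurable borel"
  unfolding circle_rotation_def[abs_def] by measurable

lemma periodic_circle_rotation:
  assumes "\<And>u. g (u + 1) = g u" shows "g (circle_rotation a u) = g (u + a)"
  using periodic_int[of g "circle_rotation a u" "\<lceil>u + a\<rceil> - 1", OF assms] by (simp add: circle_rotation_def)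

lemma circle_rotation_add: "circle_rotation 0 (u + a) = circle_rotation a u"
  by (simp add: circle_rotation_def)

lemma circle_rotation_0: "u \<in> {0<..1} \<Longrightarrow> circle_rotation 0 u = u"
proof -
  assume "u \<in> {0<..1}"
  then have "\<lceil>u\<rceil> = 1" by (auto simp: ceiling_eq_iff)
  then show ?thesis by (simp add: circle_rotation_def)
qed

lemma circle_rotation_measure_preserving: "distr unit_window unit_window (circle_rotation a) = unit_window"
proof (rule measure_eqI)
  have meas: "circle_rotation a \<in> measurable unit_window unit_window"
    unfolding unit_window_def
    by (rule measurable_restrict_space3) (auto simp: circle_rotation_window)
  fix A assume "A \<in> sets (distr unit_window unit_window (circle_rotation a))"
  then have A: "A \<in> sets unit_window" by simp
  then have [measurable]: "A \<in> sets borel" and sub: "A \<subseteq> {0<..1}" by (auto simp: sets_unit_window)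
  define E where "E = {u. circle_rotation 0 u \<in> A}"
  have [measurable]: "E \<in> sets borel" unfolding E_def by measurable
  have per: "u + 1 \<in> E \<longleftrightarrow> u \<in> E" for u
  proof -
    have "\<lceil>u + 1\<rceil> = \<lceil>u\<rceil> + 1" by (rule ceiling_add_one)
    then have "circle_rotation 0 (u + 1) = circle_rotation 0 u" by (simp add: circle_rotation_def)
    then show ?thesis by (simp add: E_def)
  qed
  have "emeasure (distr unit_window unit_window (circle_rotation a)) A
    = emeasure unit_window (circle_rotation a -` A \<inter> {0<..1})"
    using emeasure_distr[OF meas A] by simp
  also have "circle_rotation a -` A \<inter> {0<..1} = {u. u + a \<in> E \<inter> {a<..a + 1}}"
    by (auto simp: E_def circle_rotation_add)
  also have "emeasure unit_window \<dots> = emeasure lborel \<dots>"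
    by (rule emeasure_unit_window) auto
  also have "\<dots> = emeasure lborel (E \<inter> {a<..a + 1})"
    by (rule emeasure_lborel_translate) auto
  also have "\<dots> = emeasure lborel (E \<inter> {0<..1})"
    by (rule emeasure_period[OF _ per]) auto
  also have "E \<inter> {0<..1} = A"
    using sub circle_rotation_0 by (auto simp: E_def)
  finally show "emeasure (distr unit_window unit_window (circle_rotation a)) A = emeasure unit_window A"
    using emeasure_unit_window[OF sub] by simp
qed simp

lemma
  fixes g :: "real \<Rightarrow> real"
  assumes [measurable]: "g \<in> borel_measurable borel" and per: "\<And>u. g (u + 1) = g u"
  shows integrable_unit_window_shift: "integrable unit_window (\<lambda>u. g (u + a)) \<longleftrightarrow> integrable unit_window g" (is ?A)
    and integral_unit_window_shift: "(\<integral>u. g (u + a) \<partial>unit_window) = (\<integral>u. g u \<partial>unit_window)" (is ?B)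
proof -
  have meas: "circle_rotation a \<in> measurable unit_window unit_window"
    unfolding unit_window_def
    by (rule measurable_restrict_space3) (auto simp: circle_rotation_window)
  have gm: "g \<in> borel_measurable unit_window" by (rule measurable_unit_window) simp
  show ?A
    using integrable_distr_eq[OF meas gm] by (simp add: circle_rotation_measure_preserving periodic_circle_rotation[of g, OF per])
  show ?B
    using integral_distr[OF meas gm] by (simp add: circle_rotation_measure_preserving periodic_circle_rotation[of g, OF per])
qed

definition interval_mass :: "real set \<Rightarrow> real \<Rightarrow> real \<Rightarrow> real" where
  "interval_mass E a b = measure lborel (E \<inter> {a<..b})"

lemma fmeasurable_interval: "E \<in> sets borel \<Longrightarrow> E \<inter> {a<..b} \<in> fmeasurable lborel" for E :: "real set"
  by (rule fmeasurableI2[of "{a..b}"]) (auto simp: fmeasurable_def emeasure_lborel_Icc_eq)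

lemma interval_mass_bounds:
  assumes "E \<in> sets borel" "a \<le> b"
  shows "0 \<le> interval_mass E a b" "interval_mass E a b \<le> b - a"
proof -
  have "interval_mass E a b \<le> measure lborel {a<..b}"
    unfolding interval_mass_def using assms
    by (intro measure_mono_fmeasurable) (auto simp: fmeasurable_def)
  then show "interval_mass E a b \<le> b - a" using assms by simp
qed (simp add: interval_mass_def)

lemma interval_mass_add:
  assumes "E \<in> sets borel" "a \<le> b" "b \<le> c"
  shows "interval_mass E a c = interval_mass E a b + interval_mass E b c"
proof -
  have eq: "E \<inter> {a<..c} = (E \<inter> {a<..b}) \<union> (E \<inter> {b<..c})" using assms by auto
  have fm: "emeasure lborel (E \<inter> {s<..t}) \<noteq> \<infinity>" "E \<inter> {s<..t} \<in> sets lborel" for s t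
    using fmeasurable_interval[OF assms(1), of s t] by (simp_all add: fmeasurable_def less_top)
  show ?thesis unfolding interval_mass_def eq
    by (rule measure_Union[OF fm(1) fm(1) fm(2) fm(2)]) auto
qed

lemma emeasure_interval_mass: 
  assumes "E \<in> sets borel"
  shows "emeasure lborel (E \<inter> {a<..b}) = ennreal (interval_mass E a b)"
  unfolding interval_mass_def
  by (rule emeasure_eq_measure2) (rule fmeasurable_interval[OF assms])

text \<open>
  Nonnegativity makes \<open>Q\<close> monotone; comparing \<open>n t\<close> with the integers next to it then pins \<open>Q t\<close> down up
  to an error \<open>Q 1 / n\<close>.
\<close>

lemma additive_nonneg_imp_linear:
  fixes Q :: "real \<Rightarrow> real"
  assumes add: "\<And>s t. 0 \<le> s \<Longrightarrow> 0 \<le> t \<Longrightarrow> Q (s + t) = Q s + Q t"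
    and nonneg: "\<And>t. 0 \<le> t \<Longrightarrow> 0 \<le> Q t" and t: "0 \<le> t"
  shows "Q t = t * Q 1"
proof -
  have mult: "Q (real n * t) = real n * Q t" if "0 \<le> t" for n t
  proof (induction n)
    case 0
    show ?case using add[of 0 0] by simp
  next
    case (Suc n)
    then show ?case using add[of "real n * t" t] that by (simp add: algebra_simps)
  qed
  have mono: "Q s \<le> Q t" if "0 \<le> s" "s \<le> t" for s t
    using add[of s "t - s"] nonneg[of "t - s"] that by simp
  have Q1: "0 \<le> Q 1" by (rule nonneg) simp
  have bound: "real n * \<bar>Q t - t * Q 1\<bar> \<le> Q 1" for n
  proof -
    define k where "k = nat \<lfloor>real n * t\<rfloor>"
    have "0 \<le> real n * t" using t by simp
    then have k: "real k \<le> real n * t" "real n * t \<le> real (Suc k)"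
      unfolding k_def by linarith+
    have "Q (real k * 1) \<le> Q (real n * t)" "Q (real n * t) \<le> Q (real (Suc k) * 1)"
      using k \<open>0 \<le> real n * t\<close> by (intro mono; simp)+
    then have "real k * Q 1 \<le> real n * Q t" "real n * Q t \<le> real (Suc k) * Q 1"
      unfolding mult[OF t] using mult[of 1 k] mult[of 1 "Suc k"] by simp_all
    moreover have "real k * Q 1 \<le> real n * t * Q 1" "real n * t * Q 1 \<le> real (Suc k) * Q 1"
      using k Q1 by (auto intro!: mult_right_mono)
    ultimately have "\<bar>real n * Q t - real n * t * Q 1\<bar> \<le> Q 1"
      by (simp add: algebra_simps abs_le_iff)
    moreover have "real n * Q t - real n * t * Q 1 = real n * (Q t - t * Q 1)" by (simp add: algebra_simps)
    ultimately show ?thesis by (simp only: abs_mult abs_of_nat)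
  qed
  show ?thesis
  proof (rule ccontr)
    assume "Q t \<noteq> t * Q 1"
    then have "0 < \<bar>Q t - t * Q 1\<bar>" by simp
    then obtain n where "Q 1 < real n * \<bar>Q t - t * Q 1\<bar>"
      using reals_Archimedean3 by blast
    then show False using bound[of n] by simp
  qed
qed

text \<open>
  The mass of \<open>E\<close> in an interval is unchanged when the interval is moved by an element of the dense group
  generated by \<open>1\<close> and \<open>\<alpha>\<close>, hence, by continuity, when it is moved by any real number. So the mass is
  proportional to the length of the interval: \<open>E\<close> has constant density \<open>c\<close>, and Lebesgue measure restricted
  to \<open>E\<close> is \<open>c\<close> times Lebesgue measure. If \<open>c > 0\<close>, the complement of \<open>E\<close> is null, because it carries no
  mass of \<open>E\<close>.
\<close>

lemma irrational_rotation_ergodic: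
  fixes E :: "real set"
  assumes [measurable]: "E \<in> sets borel" and per: "\<And>u. u + 1 \<in> E \<longleftrightarrow> u \<in> E"
    and inv: "\<And>u. u + \<alpha> \<in> E \<longleftrightarrow> u \<in> E" and irr: "\<alpha> \<notin> \<rat>"
  shows "emeasure lborel (E \<inter> {0<..1}) = 0 \<or> emeasure lborel ({0<..1} - E) = 0"
proof -
  let ?I = "interval_mass E"
  note add = interval_mass_add[OF assms(1)] and bounds = interval_mass_bounds[OF assms(1)]
  have orbit: "u + (real n * \<alpha> + of_int m) \<in> E \<longleftrightarrow> u \<in> E" for u n m
  proof -
    have "u + real n * \<alpha> \<in> E \<longleftrightarrow> u \<in> E"
    proof (induction n)
      case (Suc n)
      have "u + real (Suc n) * \<alpha> = (u + real n * \<alpha>) + \<alpha>" by (simp add: algebra_simps)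
      then show ?case using inv[of "u + real n * \<alpha>"] Suc by (simp only:)
    qed simp
    then show ?thesis
      using periodic_int[of "\<lambda>u. u \<in> E" "u + real n * \<alpha>" m] per by (simp add: add.assoc)
  qed
  have transl: "?I (a + s) (b + s) = ?I a b" if s: "s = real n * \<alpha> + of_int m" for s n m a b
  proof -
    have "{u. u + s \<in> E \<inter> {a + s<..b + s}} = E \<inter> {a<..b}"
      using orbit s by auto
    then show ?thesis
      using emeasure_lborel_translate[of "E \<inter> {a + s<..b + s}" s]
      by (simp add: interval_mass_def measure_def)
  qed
  have transl_all: "?I (a + s) (b + s) = ?I a b" if "a \<le> b" for s a b
  proof (rule ccontr)
    assume "?I (a + s) (b + s) \<noteq> ?I a b"
    then have e: "0 < \<bar>?I (a + s) (b + s) - ?I a b\<bar>" (is "0 < ?e") by simp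
    have "s < s + ?e / 2" using e by simp
    then obtain n m where nm: "s < real n * \<alpha> + of_int m" "real n * \<alpha> + of_int m < s + ?e / 2"
      using irrational_orbit_dense[OF irr] by metis
    define s' where "s' = real n * \<alpha> + of_int m"
    have s': "s < s'" "s' < s + ?e / 2" using nm by (simp_all add: s'_def)
    have "?I (a + s) (a + s') + ?I (a + s') (b + s') = ?I (a + s) (b + s) + ?I (b + s) (b + s')"
      using add[of "a + s" "a + s'" "b + s'"] add[of "a + s" "b + s" "b + s'"] s' that by simp
    moreover have "?I (a + s') (b + s') = ?I a b" by (rule transl[OF s'_def])
    ultimately have "?e \<le> s' - s"
      using bounds[of "a + s" "a + s'"] bounds[of "b + s" "b + s'"] s'(1)
      unfolding abs_le_iff by linarith
    moreover have "x \<le> y \<Longrightarrow> y < x / 2 \<Longrightarrow> \<not> 0 < x" for x y :: real by linarith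
    moreover have "s' - s < ?e / 2" using s'(2) by (simp only: diff_less_eq add.commute)
    ultimately show False using e by blast
  qed
  define c where "c = ?I 0 1"
  have lin: "?I a b = (b - a) * c" if "a \<le> b" for a b
  proof -
    have "?I 0 (b - a) = (b - a) * ?I 0 1"
    proof (rule additive_nonneg_imp_linear)
      fix s t :: real assume "0 \<le> s" "0 \<le> t"
      then show "?I 0 (s + t) = ?I 0 s + ?I 0 t"
        using add[of 0 s "s + t"] transl_all[of 0 t s] by (simp add: add.commute)
    qed (use bounds that in auto)
    then show ?thesis using transl_all[of 0 "b - a" a] that by (simp add: c_def)
  qed
  show ?thesis
  proof (cases "c = 0")
    case True
    then show ?thesis using emeasure_interval_mass[of E 0 1] by (simp add: c_def)
  next
    case False
    then have c: "0 < c" using bounds[of 0 1] by (simp add: c_def)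
    \<comment> \<open>Lebesgue measure on \<open>E\<close>, rescaled so that intervals get their length.\<close>
    define N where "N = density lborel (\<lambda>x. ennreal (1 / c) * indicator E x)"
    have N: "emeasure N A = ennreal (1 / c) * emeasure lborel (E \<inter> A)" if "A \<in> sets borel" for A
    proof -
      have [measurable]: "A \<in> sets borel" by fact
      have "emeasure N A = (\<integral>\<^sup>+ x. ennreal (1 / c) * indicator E x * indicator A x \<partial>lborel)"
        unfolding N_def by (subst emeasure_density) auto
      also have "\<dots> = (\<integral>\<^sup>+ x. ennreal (1 / c) * indicator (E \<inter> A) x \<partial>lborel)"
        by (intro nn_integral_cong) (auto simp: indicator_def)
      also have "\<dots> = ennreal (1 / c) * emeasure lborel (E \<inter> A)"
        by (subst nn_integral_cmult) auto
      finally show ?thesis .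
    qed
    have "lborel = N"
    proof (rule lborel_eqI)
      fix l u :: real assume "\<And>b. b \<in> Basis \<Longrightarrow> l \<bullet> b \<le> u \<bullet> b"
      then have lu: "l \<le> u" by simp
      have "emeasure lborel (E \<inter> {l<..<u}) = emeasure lborel (E \<inter> {l<..u})"
      proof (rule emeasure_eq_AE)
        show "AE x in lborel. x \<in> E \<inter> {l<..<u} \<longleftrightarrow> x \<in> E \<inter> {l<..u}"
          using AE_lborel_singleton[of u] by eventually_elim auto
      qed auto
      also have "\<dots> = ennreal ((u - l) * c)"
        using emeasure_interval_mass[of E l u] lin[OF lu] by simp
      finally show "emeasure N (box l u) = (\<Prod>b\<in>Basis. (u - l) \<bullet> b)"
        using c lu by (simp add: N box_real ennreal_mult[symmetric])
    qed (simp add: N_def)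
    then have "emeasure lborel ({0<..1} - E) = ennreal (1 / c) * emeasure lborel (E \<inter> ({0<..1} - E))"
      using N[of "{0<..1} - E"] by simp
    also have "E \<inter> ({0<..1} - E) = {}" by auto
    finally show ?thesis by simp
  qed
qed

text \<open>
  The mass of \<open>E\<close> in \<open>(0, v]\<close> depends continuously on \<open>v\<close>.
\<close>

lemma exists_half_mass:
  fixes E :: "real set"
  assumes "E \<in> sets borel" and pos: "0 < emeasure lborel (E \<inter> {0<..1})"
  obtains v where "0 < v" "v < 1"
    "0 < emeasure lborel (E \<inter> {0<..v})" "emeasure lborel (E \<inter> {0<..v}) < emeasure lborel (E \<inter> {0<..1})"
proof -
  let ?q = "interval_mass E 0"
  have q1: "0 < ?q 1" using pos emeasure_interval_mass[OF assms(1), of 0 1] by simp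
  have lip: "\<bar>?q s - ?q t\<bar> \<le> \<bar>s - t\<bar>" if "0 \<le> s" "0 \<le> t" for s t
    using that interval_mass_add[OF assms(1), of 0 "min s t" "max s t"] interval_mass_bounds[OF assms(1), of "min s t" "max s t"]
    by (cases "s \<le> t") (auto simp: min_def max_def)
  have "continuous_on {0..1} ?q"
    unfolding continuous_on_iff dist_real_def
  proof (intro ballI allI impI)
    fix s e :: real assume s: "s \<in> {0..1}" and "0 < e"
    moreover have "\<bar>?q t - ?q s\<bar> < e" if "t \<in> {0..1}" "\<bar>t - s\<bar> < e" for t
      using lip[of t s] s that by simp
    ultimately show "\<exists>d>0. \<forall>t\<in>{0..1}. \<bar>t - s\<bar> < d \<longrightarrow> \<bar>?q t - ?q s\<bar> < e"
      by (intro exI[of _ e]) simp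
  qed
  moreover have "?q 0 = 0" by (simp add: interval_mass_def)
  ultimately obtain v where v: "0 \<le> v" "v \<le> 1" "?q v = ?q 1 / 2"
    using IVT'[of ?q 0 "?q 1 / 2" 1] q1 by auto
  have "v \<noteq> 0" "v \<noteq> 1" using v(3) q1 \<open>?q 0 = 0\<close> by auto
  show ?thesis
  proof (rule that)
    show "0 < v" "v < 1" using v \<open>v \<noteq> 0\<close> \<open>v \<noteq> 1\<close> by simp_all
    show "0 < emeasure lborel (E \<inter> {0<..v})"
      unfolding emeasure_interval_mass[OF assms(1)] v(3) using q1 by simp
    show "emeasure lborel (E \<inter> {0<..v}) < emeasure lborel (E \<inter> {0<..1})"
      unfolding emeasure_interval_mass[OF assms(1)] v(3) using q1 by (subst ennreal_less_iff) auto
  qed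
qed

section \<open>The Blaschke product on the line covering the circle\<close>

text \<open>
  Since \<open>1 - 3 z = - z * cnj (3 - z)\<close> on the unit circle, the factor \<open>(z - 3) / (1 - 3 z)\<close> is
  \<open>(3 - z) / (z * cnj (3 - z))\<close>; its argument involves twice the argument of \<open>3 - z\<close>, which is an arctangent.
\<close>

definition blaschke_lift :: "real \<Rightarrow> real \<Rightarrow> real" where
  "blaschke_lift \<omega> t = \<omega> + t - arctan (sin (2 * pi * t) / (3 - cos (2 * pi * t))) / pi"

text \<open>
  The derivative of \<open>blaschke_lift\<close>, which is also the spherical derivative on the circle.
\<close>

definition blaschke_slope :: "real \<Rightarrow> real" where
  "blaschke_slope t = 6 * (sin (pi * t))\<^sup>2 / (1 + 3 * (sin (pi * t))\<^sup>2)"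

lemma three_minus_cos_pos: "0 < 3 - cos (x::real)"
  using cos_le_one[of x] by linarith

lemma blaschke_circle_point: "blaschke \<omega> (circle_point t) = circle_point (blaschke_lift \<omega> t)"
proof -
  define x where "x = 2 * pi * t"
  define a where "a = arctan (sin x / (3 - cos x))"
  define \<rho> where "\<rho> = (3 - cos x) * sqrt (1 + (sin x / (3 - cos x))\<^sup>2)"
  define z where "z = cis x"
  have pos: "0 < 3 - cos x" by (rule three_minus_cos_pos)
  have sq: "sqrt (1 + (sin x / (3 - cos x))\<^sup>2) \<noteq> 0"
    by (smt (verit) real_sqrt_eq_zero_cancel_iff zero_le_power2)
  have \<rho>0: "\<rho> \<noteq> 0" using pos sq by (simp add: \<rho>_def)
  have w: "3 - cnj z = complex_of_real \<rho> * cis a"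
    using pos sq by (simp add: complex_eq_iff z_def a_def \<rho>_def cos_arctan sin_arctan)
  have zz: "z * cnj z = 1" by (simp add: z_def cis_mult cis_cnj)
  have w': "3 - z = complex_of_real \<rho> * cis (- a)"
    using arg_cong[OF w, of cnj] by (simp add: cis_cnj)
  have z0: "z \<noteq> 0" using zz by auto
  have den: "1 - 3 * z = - z * (3 - cnj z)"
    using zz by (simp add: algebra_simps)
  have den0: "1 - 3 * z \<noteq> 0"
    unfolding den w using z0 \<rho>0 by simp
  have "(z - 3) / (1 - 3 * z) = (- (complex_of_real \<rho> * cis (- a))) / (- z * (complex_of_real \<rho> * cis a))"
    unfolding den w w'[symmetric] by simp
  also have "\<dots> = cis (- a) / (z * cis a)"
    using \<rho>0 z0 by (simp add: field_simps)
  also have "\<dots> = cis (- 2 * a) / z"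
    using cis_divide[of "-a" a] z0 by (simp add: field_simps)
  finally have q: "(z - 3) / (1 - 3 * z) = cis (- 2 * a) / z" .
  have "exp (2 * of_real pi * \<i> * of_real \<omega>) = cis (2 * pi * \<omega>)"
    by (simp add: cis_conv_exp algebra_simps)
  then have "exp (2 * of_real pi * \<i> * of_real \<omega>) * z\<^sup>2 * ((z - 3) / (1 - 3 * z)) = cis (2 * pi * \<omega>) * z * cis (- 2 * a)"
    unfolding q using z0 by (simp add: power2_eq_square)
  also have "\<dots> = cis (2 * pi * \<omega> + x - 2 * a)"
    by (simp add: z_def cis_mult)
  also have "2 * pi * \<omega> + x - 2 * a = 2 * pi * blaschke_lift \<omega> t"
    by (simp add: blaschke_lift_def x_def a_def algebra_simps)
  finally show ?thesis using den0
    by (simp add: circle_point_def x_def[symmetric] z_def[symmetric])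
qed

lemma blaschke_lift_plus_one: "blaschke_lift \<omega> (t + 1) = blaschke_lift \<omega> t + 1"
proof -
  have "2 * pi * (t + 1) = 2 * pi * t + 2 * pi" by (simp add: algebra_simps)
  then show ?thesis by (simp add: blaschke_lift_def)
qed

lemma blaschke_lift_plus_int: "blaschke_lift \<omega> (t + of_int m) = blaschke_lift \<omega> t + of_int m"
  using funpow_degree_one[of "blaschke_lift \<omega>" 1 t m] by (simp add: blaschke_lift_plus_one)

lemma cos_double_pi: "cos (2 * pi * t) = 1 - 2 * (sin (pi * t))\<^sup>2"
  using cos_double_sin[of "pi * t"] by (simp add: mult.assoc)

lemma slope_denominator_pos: "0 < 1 + 3 * (s::real)\<^sup>2"
  using zero_le_power2[of s] by linarith

lemma blaschke_lift_deriv: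
  "(blaschke_lift \<omega> has_field_derivative blaschke_slope t) (at t)"
proof -
  let ?x = "2 * pi * t"
  let ?s = "sin ?x" and ?c = "cos ?x"
  have pos: "0 < 3 - ?c" by (rule three_minus_cos_pos)
  have s2: "?s\<^sup>2 = 1 - ?c\<^sup>2" using sin_cos_squared_add[of ?x] by linarith
  have p10: "0 < 10 - 6 * ?c" using cos_le_one[of ?x] by linarith
  have e0: "(3 - ?c)\<^sup>2 + ?s\<^sup>2 = 10 - 6 * ?c"
    unfolding s2 by (simp add: power2_eq_square algebra_simps)
  have e1: "1 + (?s / (3 - ?c))\<^sup>2 = (10 - 6 * ?c) / (3 - ?c)\<^sup>2"
    unfolding e0[symmetric] using pos by (simp add: power_divide add_divide_distrib)
  have e2: "?c * (3 - ?c) - ?s * ?s = 3 * ?c - 1"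
    using s2 by (simp add: power2_eq_square algebra_simps)
  have "((\<lambda>t. arctan (sin (2 * pi * t) / (3 - cos (2 * pi * t)))) has_field_derivative
      inverse (1 + (?s / (3 - ?c))\<^sup>2) * ((2 * pi * ?c * (3 - ?c) - ?s * (2 * pi * ?s)) / ((3 - ?c) * (3 - ?c)))) (at t)"
    using pos by (auto intro!: derivative_eq_intros simp: mult_ac)
  moreover have "2 * pi * ?c * (3 - ?c) - ?s * (2 * pi * ?s) = 2 * pi * (3 * ?c - 1)"
  proof -
    have "2 * pi * ?c * (3 - ?c) - ?s * (2 * pi * ?s) = 2 * pi * (?c * (3 - ?c) - ?s * ?s)"
      by (simp only: right_diff_distrib mult.assoc mult.commute mult.left_commute)
    then show ?thesis by (simp only: e2)
  qed
  moreover have "inverse ((10 - 6 * ?c) / (3 - ?c)\<^sup>2) * ((2 * pi * (3 * ?c - 1)) / ((3 - ?c) * (3 - ?c)))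
     = 2 * pi * (3 * ?c - 1) / (10 - 6 * ?c)"
    using pos by (simp add: power2_eq_square)
  ultimately have a: "((\<lambda>t. arctan (sin (2 * pi * t) / (3 - cos (2 * pi * t)))) has_field_derivative
      2 * pi * (3 * ?c - 1) / (10 - 6 * ?c)) (at t)"
    unfolding e1 by simp
  have "((\<lambda>t. \<omega> + t - arctan (sin (2 * pi * t) / (3 - cos (2 * pi * t))) / pi) has_field_derivative
      (0 + 1 - 2 * pi * (3 * ?c - 1) / (10 - 6 * ?c) / pi)) (at t)"
    by (intro derivative_intros DERIV_cdivide a)
  moreover have "0 + 1 - 2 * pi * (3 * ?c - 1) / (10 - 6 * ?c) / pi = blaschke_slope t"
  proof -
    define S where "S = (sin (pi * t))\<^sup>2"
    have S: "0 < 1 + 3 * S" unfolding S_def by (rule slope_denominator_pos)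
    have "2 * pi * (3 * ?c - 1) / (10 - 6 * ?c) / pi = 2 * (3 * ?c - 1) / (10 - 6 * ?c)" by simp
    also have "\<dots> = (4 - 12 * S) / (4 * (1 + 3 * S))" 
    proof -
      have "2 * (3 * ?c - 1) = 4 - 12 * S" "10 - 6 * ?c = 4 * (1 + 3 * S)"
        unfolding cos_double_pi S_def by simp_all
      then show ?thesis by (simp only:)
    qed
    also have "0 + 1 - \<dots> = 6 * S / (1 + 3 * S)" using S by (simp add: field_simps)
    finally show ?thesis by (simp add: blaschke_slope_def S_def)
  qed
  ultimately show ?thesis
    unfolding blaschke_lift_def[abs_def] by metis
qed

lemma blaschke_slope_nonneg: "0 \<le> blaschke_slope t"
  using slope_denominator_pos[of "sin (pi * t)"] by (simp add: blaschke_slope_def)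

lemma blaschke_slope_le: "blaschke_slope t \<le> 3 / 2"
proof -
  have "(sin (pi * t))\<^sup>2 \<le> 1" by (simp add: abs_square_le_1)
  then show ?thesis
    using slope_denominator_pos[of "sin (pi * t)"] by (simp add: blaschke_slope_def divide_simps)
qed

lemma blaschke_slope_plus_int: "blaschke_slope (t + of_int m) = blaschke_slope t"
proof -
  have "(sin (pi * (t + of_int m)))\<^sup>2 = (sin (pi * t))\<^sup>2"
    using sin_zero_iff_int2[of "pi * of_int m"] cos_squared_eq[of "pi * of_int m"]
    by (auto simp: distrib_left sin_add power_mult_distrib)
  then show ?thesis by (simp add: blaschke_slope_def)
qed

lemma blaschke_slope_pos:
  assumes "t \<notin> \<int>" shows "0 < blaschke_slope t"
proof -
  have "sin (pi * t) \<noteq> 0"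
    using assms by (auto simp: sin_zero_iff_int2)
  then show ?thesis
    using slope_denominator_pos[of "sin (pi * t)"] by (simp add: blaschke_slope_def)
qed

lemma continuous_blaschke_slope: "continuous_on A blaschke_slope"
  unfolding blaschke_slope_def[abs_def]
  using slope_denominator_pos by (intro continuous_intros) (auto simp: less_le)

lemma continuous_blaschke_lift: "continuous_on A (blaschke_lift \<omega>)"
  using blaschke_lift_deriv DERIV_isCont continuous_at_imp_continuous_on by blast

lemma strict_mono_blaschke_lift: "strict_mono (blaschke_lift \<omega>)"
proof (rule strict_monoI)
  fix x y :: real assume "x < y"
  define y' where "y' = min y (of_int (\<lfloor>x\<rfloor> + 1))"
  have xy': "x < y'" "y' \<le> y" using \<open>x < y\<close> by (auto simp: y'_def)
  have nint: "t \<notin> \<int>" if "x < t" "t < y'" for t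
  proof
    assume "t \<in> \<int>"
    then obtain z :: int where "t = of_int z" by (elim Ints_cases)
    then have "of_int z < (of_int (\<lfloor>x\<rfloor> + 1) :: real)" "x < of_int z" using that by (auto simp: y'_def)
    then have "z < \<lfloor>x\<rfloor> + 1" "\<lfloor>x\<rfloor> < z" by (simp_all only: of_int_less_iff floor_less_iff)
    then show False by simp
  qed
  have "blaschke_lift \<omega> x < blaschke_lift \<omega> y'"
  proof (rule DERIV_pos_imp_increasing_open[OF xy'(1)])
    show "\<exists>d. (blaschke_lift \<omega> has_real_derivative d) (at t) \<and> 0 < d" if "x < t" "t < y'" for t
      using blaschke_lift_deriv blaschke_slope_pos[OF nint[OF that]] by blast
  qed (rule continuous_blaschke_lift)
  also have "\<dots> \<le> blaschke_lift \<omega> y"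
    using xy'(2) blaschke_lift_deriv blaschke_slope_nonneg by (meson DERIV_nonneg_imp_nondecreasing)
  finally show "blaschke_lift \<omega> x < blaschke_lift \<omega> y" .
qed

section \<open>The distortion inequality\<close>

lemma concave_on_sin: "concave_on {0..pi} sin"
proof -
  have "convex_on {0..pi} (\<lambda>x. - sin x)"
  proof (rule f''_ge0_imp_convex)
    show "((\<lambda>x. - sin x) has_real_derivative - cos x) (at x)" for x :: real
      by (auto intro!: derivative_eq_intros)
    show "((\<lambda>x. - cos x) has_real_derivative sin x) (at x)" for x :: real
      by (auto intro!: derivative_eq_intros)
  qed (auto simp: sin_ge_zero)
  then show ?thesis by (simp add: concave_on_def)
qed

lemma sin_pi_ge: 
  assumes "0 \<le> t" "t \<le> 1 / 2" shows "2 * t \<le> sin (pi * t)"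
proof -
  have "(1 - 2 * t) * sin 0 + (2 * t) * sin (pi/2) \<le> sin ((1 - 2 * t) *\<^sub>R 0 + (2 * t) *\<^sub>R (pi / 2))"
    using assms by (intro concave_onD[OF concave_on_sin]) (auto simp: pi_ge_zero)
  then show ?thesis by (simp add: mult.commute)
qed

text \<open>
  Up to the factor \<open>sqrt 6\<close> this is \<open>1 / sqrt F'\<close>.
\<close>

definition inv_sqrt_slope :: "real \<Rightarrow> real" where
  "inv_sqrt_slope t = sqrt (3 + (inverse (sin (pi * t)))\<^sup>2)"

lemma inv_sqrt_slope_pos: "0 < inv_sqrt_slope t"
  by (smt (verit) inv_sqrt_slope_def real_sqrt_gt_zero zero_le_power2)

lemma blaschke_slope_conv_h:
  assumes "0 < t" "t < 1" shows "blaschke_slope t = 6 / (inv_sqrt_slope t)\<^sup>2"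
proof -
  have "sin (pi * t) > 0"
    using assms by (intro sin_gt_zero) auto
  moreover have "0 \<le> 3 + (inverse (sin (pi * t)))\<^sup>2" by (smt (verit) zero_le_power2)
  ultimately show ?thesis
    using slope_denominator_pos[of "sin (pi * t)"]
    by (simp add: blaschke_slope_def inv_sqrt_slope_def field_simps)
qed

text \<open>
  The cosecant is convex as the reciprocal of a positive concave function, and \<open>sqrt (3 + v\<^sup>2)\<close> is the
  norm of a vector with coordinates \<open>sqrt 3\<close> and \<open>v\<close>, to which the triangle inequality applies.
\<close>

lemma convex_on_inv_sqrt_slope: "convex_on {0<..<1} inv_sqrt_slope"
proof (rule convex_onI)
  fix l x y :: real
  assume l: "0 < l" "l < 1" and xy: "x \<in> {0<..<1}" "y \<in> {0<..<1}"
  let ?S = "\<lambda>t. sin (pi * t)"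
  define u where "u = (1 - l) * x + l * y"
  have S: "?S x > 0" "?S y > 0" using xy by (auto intro!: sin_gt_zero)
  have "(1 - l) * ?S x + l * ?S y \<le> sin ((1 - l) *\<^sub>R (pi * x) + l *\<^sub>R (pi * y))"
    using l xy by (intro concave_onD[OF concave_on_sin]) auto
  also have "(1 - l) *\<^sub>R (pi * x) + l *\<^sub>R (pi * y) = pi * u"
    by (simp add: u_def algebra_simps)
  finally have c: "(1 - l) * ?S x + l * ?S y \<le> ?S u" .
  have nc: "cmod (Complex (sqrt 3) (inverse (?S t))) = inv_sqrt_slope t" for t
    by (simp add: inv_sqrt_slope_def cmod_def)
  have p: "0 < (1 - l) * ?S x + l * ?S y" using S l by (simp add: add_pos_pos)
  have "inverse (?S u) \<le> inverse ((1 - l) * ?S x + l * ?S y)"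
    using c p by (intro le_imp_inverse_le)
  also have "\<dots> = inverse ((1 - l) *\<^sub>R ?S x + l *\<^sub>R ?S y)" by simp
  also have "\<dots> \<le> (1 - l) * inverse (?S x) + l * inverse (?S y)"
    using l S convex_onD[OF convex_on_inverse[of "{0<..}"], of l "?S x" "?S y"] by simp
  finally have i: "inverse (?S u) \<le> (1 - l) * inverse (?S x) + l * inverse (?S y)" .
  have "inv_sqrt_slope u \<le> cmod (Complex (sqrt 3) ((1 - l) * inverse (?S x) + l * inverse (?S y)))"
    using i c p by (simp add: inv_sqrt_slope_def cmod_def power_mono del: power_inverse)
  also have "Complex (sqrt 3) ((1 - l) * inverse (?S x) + l * inverse (?S y))
    = (1 - l) *\<^sub>R Complex (sqrt 3) (inverse (?S x)) + l *\<^sub>R Complex (sqrt 3) (inverse (?S y))"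
    by (simp add: complex_eq_iff algebra_simps)
  also have "cmod \<dots> \<le> (1 - l) * inv_sqrt_slope x + l * inv_sqrt_slope y"
    using l by (intro order.trans[OF norm_triangle_ineq]) (simp add: nc)
  finally show "inv_sqrt_slope ((1 - l) *\<^sub>R x + l *\<^sub>R y) \<le> (1 - l) * inv_sqrt_slope x + l * inv_sqrt_slope y"
    by (simp add: u_def)
qed auto

text \<open>
  By convexity \<open>1 / sqrt F'\<close> lies below its chord \<open>l\<close>, so \<open>F'\<close> is at least the reciprocal of the square of
  the chord. That reciprocal is the derivative of a Moebius map, for which the inequality is an equality.
\<close>

lemma slope_product_le_interior:
  assumes "0 < x" "x < y" "y < 1"
  shows "blaschke_slope x * blaschke_slope y * (y - x)\<^sup>2 \<le> (blaschke_lift \<omega> y - blaschke_lift \<omega> x)\<^sup>2"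
proof -
  define l where "l t = ((y - t) * inv_sqrt_slope x + (t - x) * inv_sqrt_slope y) / (y - x)" for t
  have lpos: "0 < l t" if "x \<le> t" "t \<le> y" for t
  proof (cases "t = x")
    case True then show ?thesis using assms inv_sqrt_slope_pos[of x] by (simp add: l_def)
  next
    case False
    then show ?thesis using assms that inv_sqrt_slope_pos[of x] inv_sqrt_slope_pos[of y]
      by (auto simp: l_def intro!: divide_pos_pos add_nonneg_pos)
  qed
  have hl: "inv_sqrt_slope t \<le> l t" if "x \<le> t" "t \<le> y" for t
  proof -
    define c where "c = (t - x) / (y - x)"
    have c: "0 \<le> c" "c \<le> 1" using assms that by (auto simp: c_def)
    have c1: "1 - c = (y - t) / (y - x)" using assms by (simp add: c_def field_simps)
    have "(1 - c) *\<^sub>R x + c *\<^sub>R y = x + c * (y - x)" by (simp add: algebra_simps)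
    also have "\<dots> = t" using assms by (simp add: c_def)
    finally have "inv_sqrt_slope t \<le> (1 - c) * inv_sqrt_slope x + c * inv_sqrt_slope y"
      using convex_onD[OF convex_on_inv_sqrt_slope c, of x y] assms by simp
    also have "\<dots> = l t" unfolding c1 by (simp add: l_def c_def add_divide_distrib)
    finally show ?thesis .
  qed
  \<comment> \<open>A Moebius map with derivative \<open>6 / (l t)\<^sup>2\<close>.\<close>
  define A where "A t = 6 * (t - x) / (inv_sqrt_slope x * l t)" for t
  have dA: "(A has_field_derivative 6 / (l t)\<^sup>2) (at t)" if "x \<le> t" "t \<le> y" for t
  proof -
    have d: "(l has_field_derivative (inv_sqrt_slope y - inv_sqrt_slope x) / (y - x)) (at t)"
      unfolding l_def[abs_def] using assms by (auto intro!: derivative_eq_intros)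
    have e: "l t - (t - x) * ((inv_sqrt_slope y - inv_sqrt_slope x) / (y - x)) = inv_sqrt_slope x"
    proof -
      have "(y - t) * inv_sqrt_slope x + (t - x) * inv_sqrt_slope y - (t - x) * (inv_sqrt_slope y - inv_sqrt_slope x) = (y - x) * inv_sqrt_slope x"
        by (simp add: algebra_simps)
      then show ?thesis
        using assms by (simp add: l_def diff_divide_distrib[symmetric])
    qed
    have "(A has_field_derivative (6 * (inv_sqrt_slope x * l t) - (6 * (t - x)) * (inv_sqrt_slope x * ((inv_sqrt_slope y - inv_sqrt_slope x) / (y - x)))) / ((inv_sqrt_slope x * l t) * (inv_sqrt_slope x * l t))) (at t)"
      unfolding A_def[abs_def] using lpos[OF that] inv_sqrt_slope_pos[of x]
      by (auto intro!: derivative_eq_intros d)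
    also have "6 * (inv_sqrt_slope x * l t) - (6 * (t - x)) * (inv_sqrt_slope x * ((inv_sqrt_slope y - inv_sqrt_slope x) / (y - x)))
      = 6 * inv_sqrt_slope x * (l t - (t - x) * ((inv_sqrt_slope y - inv_sqrt_slope x) / (y - x)))"
      by (simp add: algebra_simps)
    finally show ?thesis unfolding e using lpos[OF that] inv_sqrt_slope_pos[of x]
      by (simp add: field_simps power2_eq_square)
  qed
  have "blaschke_lift \<omega> x - A x \<le> blaschke_lift \<omega> y - A y"
  proof (rule DERIV_nonneg_imp_nondecreasing[where f = "\<lambda>t. blaschke_lift \<omega> t - A t"])
    fix t assume t: "x \<le> t" "t \<le> y"
    have "((\<lambda>t. blaschke_lift \<omega> t - A t) has_field_derivative blaschke_slope t - 6 / (l t)\<^sup>2) (at t)"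
      using t by (intro derivative_intros blaschke_lift_deriv dA)
    moreover have "6 / (l t)\<^sup>2 \<le> blaschke_slope t"
      using t assms hl[OF t] inv_sqrt_slope_pos[of t]
      by (subst blaschke_slope_conv_h) (auto intro!: divide_left_mono power_mono mult_pos_pos lpos zero_less_power)
    ultimately show "\<exists>d. ((\<lambda>t. blaschke_lift \<omega> t - A t) has_real_derivative d) (at t) \<and> 0 \<le> d"
      by (intro exI conjI) auto
  qed (use assms in simp)
  then have "6 * (y - x) / (inv_sqrt_slope x * inv_sqrt_slope y) \<le> blaschke_lift \<omega> y - blaschke_lift \<omega> x"
    using assms by (simp add: A_def l_def)
  then have "(6 * (y - x) / (inv_sqrt_slope x * inv_sqrt_slope y))\<^sup>2 \<le> (blaschke_lift \<omega> y - blaschke_lift \<omega> x)\<^sup>2"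
    using assms inv_sqrt_slope_pos[of x] inv_sqrt_slope_pos[of y] by (intro power_mono) auto
  moreover have "(6 * (y - x) / (inv_sqrt_slope x * inv_sqrt_slope y))\<^sup>2 = blaschke_slope x * blaschke_slope y * (y - x)\<^sup>2"
    using assms by (simp add: blaschke_slope_conv_h power_mult_distrib power_divide del: right_diff_distrib_numeral)
  ultimately show ?thesis by simp
qed

lemma blaschke_slope_le_square: "blaschke_slope t \<le> 60 * t\<^sup>2"
proof -
  let ?s = "(sin (pi * t))\<^sup>2"
  have "?s \<le> (pi * t)\<^sup>2"
    using power_mono[OF abs_sin_x_le_abs_x[of "pi * t"], of 2] by simp
  moreover have "pi\<^sup>2 \<le> (3.15::real)\<^sup>2"
    using pi_approx by (intro power_mono) auto
  then have "pi\<^sup>2 * t\<^sup>2 \<le> 10 * t\<^sup>2" by (intro mult_right_mono) (auto simp: power2_eq_square)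
  ultimately have "?s \<le> 10 * t\<^sup>2" by (simp add: power_mult_distrib)
  moreover have "blaschke_slope t \<le> 6 * ?s"
    unfolding blaschke_slope_def using divide_left_mono[of 1 "1 + 3 * ?s" "6 * ?s"] slope_denominator_pos[of "sin (pi * t)"] by simp
  ultimately show ?thesis by linarith
qed

lemma blaschke_lift_cubic_growth:
  assumes "0 \<le> y" "y \<le> 1"
  shows "y ^ 3 / 4 \<le> blaschke_lift \<omega> y - blaschke_lift \<omega> 0"
proof -
  have half: "2 * y ^ 3 \<le> blaschke_lift \<omega> y - blaschke_lift \<omega> 0" if "0 \<le> y" "y \<le> 1 / 2" for y
  proof -
    have "blaschke_lift \<omega> 0 - 2 * 0 ^ 3 \<le> blaschke_lift \<omega> y - 2 * y ^ 3"
    proof (rule DERIV_nonneg_imp_nondecreasing[OF that(1), where f = "\<lambda>t. blaschke_lift \<omega> t - 2 * t ^ 3"])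
      fix t assume t: "0 \<le> t" "t \<le> y"
      have "(2 * t)\<^sup>2 \<le> (sin (pi * t))\<^sup>2"
        using t that sin_pi_ge[of t] by (intro power_mono) auto
      moreover have "(sin (pi * t))\<^sup>2 \<le> 1" by (simp add: abs_square_le_1)
      then have "6 * (sin (pi * t))\<^sup>2 / 4 \<le> blaschke_slope t"
        unfolding blaschke_slope_def using slope_denominator_pos[of "sin (pi * t)"]
        by (intro divide_left_mono) auto
      ultimately have "6 * t\<^sup>2 \<le> blaschke_slope t" by (simp add: power_mult_distrib)
      moreover have "((\<lambda>t. blaschke_lift \<omega> t - 2 * t ^ 3) has_field_derivative blaschke_slope t - 6 * t\<^sup>2) (at t)"
        by (rule derivative_eq_intros blaschke_lift_deriv refl | simp)+
      ultimately show "\<exists>d. ((\<lambda>t. blaschke_lift \<omega> t - 2 * t ^ 3) has_real_derivative d) (at t) \<and> 0 \<le> d"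
        by (intro exI conjI) auto
    qed
    then show ?thesis by simp
  qed
  have "0 \<le> y ^ 3" using assms by simp
  show ?thesis
  proof (cases "y \<le> 1 / 2")
    case True
    then show ?thesis using half[of y] assms \<open>0 \<le> y ^ 3\<close> by linarith
  next
    case False
    then have "blaschke_lift \<omega> (1 / 2) \<le> blaschke_lift \<omega> y"
      using strict_mono_blaschke_lift[of \<omega>] by (simp add: strict_mono_less_eq)
    moreover have "blaschke_lift \<omega> (1 / 2) - blaschke_lift \<omega> 0 = 1 / 2"
      by (simp add: blaschke_lift_def)
    moreover have "y ^ 3 \<le> 1" using assms by (simp add: power_le_one)
    ultimately show ?thesis by linarith
  qed
qed

lemma blaschke_lift_odd: "blaschke_lift \<omega> (- y) - blaschke_lift \<omega> 0 = - (blaschke_lift \<omega> y - blaschke_lift \<omega> 0)"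
  by (simp add: blaschke_lift_def arctan_minus)

text \<open>
  The estimate in \<open>slope_product_le_critical\<close> produces the constant \<open>60\<^sup>2 * 2\<^sup>2 * 4\<^sup>2 = 230400\<close>, rounded up
  here.
\<close>

definition critical_loss :: real where "critical_loss = 300000"

text \<open>
  With \<open>M\<close> the larger of the distances from the critical point, both slopes are at most \<open>60 M\<^sup>2\<close>, whereas
  the image of the interval has length at least \<open>M\<^sup>3 / 4\<close>.
\<close>

lemma slope_product_le_critical:
  assumes "x < 0" "0 < y" "y \<le> x + 1"
  shows "blaschke_slope x * blaschke_slope y * (y - x)\<^sup>2 \<le> critical_loss * (blaschke_lift \<omega> y - blaschke_lift \<omega> x)\<^sup>2"
proof -
  define M where "M = max (- x) y"
  have M: "0 < M" "- x \<le> M" "y \<le> M" "M \<le> 1" using assms by (auto simp: M_def)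
  have F0: "0 \<le> blaschke_lift \<omega> y - blaschke_lift \<omega> 0" "0 \<le> blaschke_lift \<omega> 0 - blaschke_lift \<omega> x"
    using assms strict_mono_blaschke_lift[of \<omega>] by (simp_all add: strict_mono_less_eq)
  have g: "M ^ 3 / 4 \<le> blaschke_lift \<omega> y - blaschke_lift \<omega> x"
  proof (cases "- x \<le> y")
    case True
    then show ?thesis using blaschke_lift_cubic_growth[of y \<omega>] F0 assms by (simp add: M_def)
  next
    case False
    then show ?thesis using blaschke_lift_cubic_growth[of "- x" \<omega>] blaschke_lift_odd[of \<omega> x] F0 assms
      by (simp add: M_def max_def)
  qed
  have sl: "blaschke_slope t \<le> 60 * M\<^sup>2" if "\<bar>t\<bar> \<le> M" for t
  proof -
    have "t\<^sup>2 \<le> M\<^sup>2" using that power_mono[of "\<bar>t\<bar>" M 2] by simp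
    then show ?thesis using blaschke_slope_le_square[of t] by linarith
  qed
  have "blaschke_slope x * blaschke_slope y * (y - x)\<^sup>2 \<le> (60 * M\<^sup>2) * (60 * M\<^sup>2) * (2 * M)\<^sup>2"
    using assms M by (intro mult_mono power_mono sl) (auto simp: blaschke_slope_nonneg)
  also have "\<dots> = 230400 * (M ^ 3 / 4)\<^sup>2" by (simp add: power2_eq_square power3_eq_cube)
  also have "\<dots> \<le> critical_loss * (blaschke_lift \<omega> y - blaschke_lift \<omega> x)\<^sup>2"
    unfolding critical_loss_def using g M by (intro mult_mono power_mono) auto
  finally show ?thesis .
qed

text \<open>
  Integer translations move the critical point in the interval, or the integer part of \<open>x\<close>, to \<open>0\<close>.
  An interval that has a critical point as an endpoint is harmless, because the left hand side vanishes.
\<close>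

lemma slope_product_le:
  assumes "x < y" "y \<le> x + 1"
  shows "blaschke_slope x * blaschke_slope y * (y - x)\<^sup>2
    \<le> (if \<exists>m :: int. x < of_int m \<and> of_int m < y then critical_loss else 1)
        * (blaschke_lift \<omega> y - blaschke_lift \<omega> x)\<^sup>2"
proof -
  note F = blaschke_lift_plus_int
  show ?thesis
  proof (cases "\<exists>m :: int. x < of_int m \<and> of_int m < y")
    case True
    then obtain m :: int where m: "x < of_int m" "of_int m < y" by blast
    have "blaschke_slope (x + of_int (- m)) * blaschke_slope (y + of_int (- m)) * ((y + of_int (- m)) - (x + of_int (- m)))\<^sup>2
      \<le> critical_loss * (blaschke_lift \<omega> (y + of_int (- m)) - blaschke_lift \<omega> (x + of_int (- m)))\<^sup>2"
      by (rule slope_product_le_critical) (use m assms in auto)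
    then show ?thesis using True unfolding F blaschke_slope_plus_int by simp
  next
    case False
    define k where "k = \<lfloor>x\<rfloor>"
    have k: "of_int k \<le> x" "x < of_int (k + 1)" unfolding k_def by linarith+
    have ky: "y \<le> of_int (k + 1)" using False k by (meson not_le)
    have zero: "blaschke_slope (of_int m) = 0" for m
      using blaschke_slope_plus_int[of 0 m] by (simp add: blaschke_slope_def)
    show ?thesis
    proof (cases "x = of_int k \<or> y = of_int (k + 1)")
      case True
      then have "blaschke_slope x * blaschke_slope y = 0" using zero[of k] zero[of "k + 1"] by auto
      then show ?thesis unfolding if_not_P[OF False] by (simp only: mult_zero_left) simp
    next
      case nend: False
      have "blaschke_slope (x + of_int (- k)) * blaschke_slope (y + of_int (- k)) * ((y + of_int (- k)) - (x + of_int (- k)))\<^sup>2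
        \<le> (blaschke_lift \<omega> (y + of_int (- k)) - blaschke_lift \<omega> (x + of_int (- k)))\<^sup>2"
        by (rule slope_product_le_interior) (use k ky nend assms in auto)
      then show ?thesis unfolding F blaschke_slope_plus_int if_not_P[OF False] by simp
    qed
  qed
qed

section \<open>The Riemann sphere and the unit circle\<close>

fun finite_part :: "riemann_sphere \<Rightarrow> complex" where
  "finite_part (Fin z) = z"
| "finite_part Infty = 0"

lemma finite_part_stereographic:
  "finite_part x = fst (to_unit_sphere x) / of_real (1 - snd (to_unit_sphere x))"
proof (cases x)
  case (Fin z)
  have p: "0 < 1 + (cmod z)\<^sup>2" by (smt (verit) zero_le_power2)
  define n where "n = 1 + (cmod z)\<^sup>2"
  have "n \<noteq> 0" using p by (simp add: n_def)
  have s: "snd (to_unit_sphere x) = (n - 2) / n" "fst (to_unit_sphere x) = 2 * z / of_real n"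
    using Fin by (simp_all add: n_def add.commute)
  have e: "1 - (n - 2) / n = 2 / n" using \<open>n \<noteq> 0\<close> by (simp add: field_simps)
  show ?thesis unfolding s e using Fin \<open>n \<noteq> 0\<close> by simp
qed simp

lemma Fin_finite_part: "x \<noteq> Infty \<Longrightarrow> Fin (finite_part x) = x"
  by (cases x) auto

lemma continuous_to_unit_sphere: "continuous_on A to_unit_sphere"
  unfolding continuous_on_iff by (metis dist_riemann_sphere_def)

lemma continuous_Fin: "continuous_on A Fin"
proof -
  have nz: "1 + (cmod z)\<^sup>2 \<noteq> 0" "(cmod z)\<^sup>2 + 1 \<noteq> 0" for z
    by (smt (verit) zero_le_power2)+
  have nz': "complex_of_real (1 + (cmod z)\<^sup>2) \<noteq> 0" for z
    using nz of_real_eq_0_iff by blast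
  have "continuous_on A (\<lambda>z. to_unit_sphere (Fin z))"
    unfolding to_unit_sphere.simps by (intro continuous_intros) (use nz nz' in auto)
  then show ?thesis unfolding continuous_on_iff dist_riemann_sphere_def .
qed

lemma isCont_finite_part: "isCont finite_part (Fin z)"
proof -
  have "snd (to_unit_sphere (Fin z)) \<noteq> 1"
    by (simp add: divide_eq_eq)
  then have "complex_of_real (1 - snd (to_unit_sphere (Fin z))) \<noteq> 0"
    by (metis eq_iff_diff_eq_0 of_real_eq_0_iff)
  moreover have "isCont to_unit_sphere (Fin z)"
    using continuous_to_unit_sphere[of UNIV] by (simp add: continuous_on_eq_continuous_at)
  ultimately show ?thesis
    unfolding finite_part_stereographic[abs_def] by (intro continuous_intros)
qed

lemma measurable_Fin [measurable]: "Fin \<in> borel_measurable borel"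
  by (rule borel_measurable_continuous_onI[OF continuous_Fin])

lemma measurable_finite_part [measurable]: "finite_part \<in> borel_measurable borel"
proof -
  have [measurable]: "to_unit_sphere \<in> borel_measurable borel"
    by (rule borel_measurable_continuous_onI[OF continuous_to_unit_sphere])
  have "(\<lambda>x. fst (to_unit_sphere x)) \<in> borel_measurable borel" "(\<lambda>x. snd (to_unit_sphere x)) \<in> borel_measurable borel"
    by (intro borel_measurable_continuous_onI continuous_intros continuous_to_unit_sphere)+
  then show ?thesis
    unfolding finite_part_stereographic[abs_def] by measurable
qed

text \<open>
  The Blaschke product as a function of a complex variable. Division by zero gives it the value \<open>0\<close> at the
  pole, which is also the value of \<open>finite_part\<close> at infinity, and \<open>0\<close> is fixed. Hence \<open>finite_part\<close>
  intertwines the iterates on the sphere with the iterates of this function, without exceptions.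
\<close>

definition blaschke_fun :: "real \<Rightarrow> complex \<Rightarrow> complex" where
  "blaschke_fun \<omega> z = exp (2 * of_real pi * \<i> * of_real \<omega>) * z\<^sup>2 * ((z - 3) / (1 - 3 * z))"

lemma finite_part_blaschke: "finite_part (blaschke \<omega> x) = blaschke_fun \<omega> (finite_part x)"
  by (cases x) (auto simp: blaschke_fun_def)

lemma finite_part_blaschke_funpow: "finite_part ((blaschke \<omega> ^^ n) x) = (blaschke_fun \<omega> ^^ n) (finite_part x)"
  by (induction n) (simp_all add: finite_part_blaschke)

lemma blaschke_eq_Fin: "x \<noteq> Infty \<Longrightarrow> 1 - 3 * finite_part x \<noteq> 0 \<Longrightarrow> blaschke \<omega> x = Fin (blaschke_fun \<omega> (finite_part x))"
  by (cases x) (auto simp: blaschke_fun_def)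

lemma measurable_blaschke [measurable]: "blaschke \<omega> \<in> borel_measurable borel"
proof -
  have [measurable]: "blaschke_fun \<omega> \<in> borel_measurable borel"
    unfolding blaschke_fun_def[abs_def] by measurable
  have eq: "blaschke \<omega> = (\<lambda>x. if x = Infty then Infty else if 1 - 3 * finite_part x = 0 then Infty
      else Fin (blaschke_fun \<omega> (finite_part x)))"
  proof
    show "blaschke \<omega> x = (if x = Infty then Infty else if 1 - 3 * finite_part x = 0 then Infty
      else Fin (blaschke_fun \<omega> (finite_part x)))" for x
      by (cases x) (auto simp: blaschke_fun_def)
  qed
  have [measurable]: "Measurable.pred borel (\<lambda>x. x = Infty)" "Measurable.pred borel (\<lambda>x. 1 - 3 * finite_part x = 0)"
    by measurable
  show ?thesis unfolding eq by measurable
qed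

lemma pole_off_circle: "cmod z = 1 \<Longrightarrow> 1 - 3 * z \<noteq> 0"
proof
  assume "cmod z = 1" "1 - 3 * z = 0"
  then have "3 * z = 1" by simp
  then have "cmod (3 * z) = 1" by simp
  then show False using \<open>cmod z = 1\<close> by (simp add: norm_mult)
qed

lemma isCont_blaschke_circle:
  assumes "cmod z = 1" shows "isCont (blaschke \<omega>) (Fin z)"
proof -
  have nz: "1 - 3 * z \<noteq> 0" by (rule pole_off_circle[OF assms])
  have c: "isCont (\<lambda>x. 1 - 3 * finite_part x) (Fin z)"
    by (intro continuous_intros isCont_finite_part)
  have cF: "isCont Fin w" for w
    using continuous_Fin[of UNIV] by (simp add: continuous_on_eq_continuous_at)
  have "isCont (blaschke_fun \<omega>) z"
    unfolding blaschke_fun_def[abs_def] using nz by (intro continuous_intros) auto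
  then have cont: "isCont (\<lambda>x. Fin (blaschke_fun \<omega> (finite_part x))) (Fin z)"
    by (intro isCont_o2[OF _ cF] isCont_o2[OF isCont_finite_part]) simp
  have "\<forall>\<^sub>F x in nhds (Fin z). 1 - 3 * finite_part x \<noteq> 0"
  proof (rule tendsto_imp_eventually_ne[OF _ nz])
    show "((\<lambda>x. 1 - 3 * finite_part x) \<longlongrightarrow> 1 - 3 * z) (nhds (Fin z))"
      using c tendsto_at_iff_tendsto_nhds[of "\<lambda>x. 1 - 3 * finite_part x" "Fin z"]
      unfolding isCont_def by simp
  qed
  moreover have "\<forall>\<^sub>F x in nhds (Fin z). x \<noteq> Infty"
    by (rule t1_space_nhds) simp
  ultimately have "\<forall>\<^sub>F x in nhds (Fin z). blaschke \<omega> x = Fin (blaschke_fun \<omega> (finite_part x))"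
    by eventually_elim (simp add: blaschke_eq_Fin)
  from isCont_cong[OF this] cont show ?thesis by simp
qed

lemma circle_point_eq_iff: "circle_point s = circle_point t \<longleftrightarrow> (\<exists>m :: int. s = t + of_int m)"
proof -
  have "circle_point s = circle_point t \<longleftrightarrow> sin (2 * pi * s) = sin (2 * pi * t) \<and> cos (2 * pi * s) = cos (2 * pi * t)"
    by (auto simp: circle_point_def complex_eq_iff)
  also have "\<dots> \<longleftrightarrow> (\<exists>m::int. 2 * pi * s = 2 * pi * t + 2 * pi * of_int m)"
    by (rule sin_cos_eq_iff)
  also have "\<dots> \<longleftrightarrow> (\<exists>m::int. s = t + of_int m)"
    by (simp add: distrib_left[symmetric] mult.assoc)
  finally show ?thesis .
qed

lemma blaschke_funpow_circle_point:
  "(blaschke \<omega> ^^ n) (circle_point t) = circle_point ((blaschke_lift \<omega> ^^ n) t)"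
  by (induction n) (simp_all add: blaschke_circle_point)

lemma blaschke_fun_funpow_circle:
  "(blaschke_fun \<omega> ^^ n) (cis (2 * pi * t)) = cis (2 * pi * (blaschke_lift \<omega> ^^ n) t)"
  using finite_part_blaschke_funpow[of n \<omega> "circle_point t"]
  unfolding blaschke_funpow_circle_point by (simp add: circle_point_def)

text \<open>
  The derivative of the \<open>n\<close>-th iterate of the lift, as given by the chain rule.
\<close>

definition lift_deriv :: "real \<Rightarrow> nat \<Rightarrow> real \<Rightarrow> real" where
  "lift_deriv \<omega> n t = (\<Prod>i<n. blaschke_slope ((blaschke_lift \<omega> ^^ i) t))"

lemma lift_deriv_nonneg: "0 \<le> lift_deriv \<omega> n t"
  unfolding lift_deriv_def by (intro prod_nonneg ballI blaschke_slope_nonneg)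

lemma lift_deriv_Suc: "lift_deriv \<omega> (Suc n) t = lift_deriv \<omega> n t * blaschke_slope ((blaschke_lift \<omega> ^^ n) t)"
  by (simp add: lift_deriv_def)

lemma lift_deriv_add: "lift_deriv \<omega> (n + m) t = lift_deriv \<omega> n ((blaschke_lift \<omega> ^^ m) t) * lift_deriv \<omega> m t"
proof (induction n)
  case (Suc n)
  then show ?case by (simp add: lift_deriv_Suc funpow_add mult_ac)
qed (simp add: lift_deriv_def)

lemma blaschke_lift_funpow_deriv:
  "((blaschke_lift \<omega> ^^ n) has_field_derivative lift_deriv \<omega> n t) (at t)"
proof (induction n)
  case 0
  show ?case by (simp add: lift_deriv_def id_def)
next
  case (Suc n)
  have "((\<lambda>t. blaschke_lift \<omega> ((blaschke_lift \<omega> ^^ n) t)) has_field_derivative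
      blaschke_slope ((blaschke_lift \<omega> ^^ n) t) * lift_deriv \<omega> n t) (at t)"
    by (rule DERIV_chain2[OF blaschke_lift_deriv Suc])
  then show ?case by (simp add: lift_deriv_Suc o_def mult.commute)
qed

lemma blaschke_fun_differentiable:
  "1 - 3 * z \<noteq> 0 \<Longrightarrow> blaschke_fun \<omega> field_differentiable (at z)"
  unfolding blaschke_fun_def[abs_def] by (intro derivative_intros) auto

lemma blaschke_fun_funpow_differentiable:
  assumes "\<And>i. i < n \<Longrightarrow> 1 - 3 * (blaschke_fun \<omega> ^^ i) z \<noteq> 0"
  shows "(blaschke_fun \<omega> ^^ n) field_differentiable (at z)"
  using assms
proof (induction n)
  case (Suc n)
  then have "(blaschke_fun \<omega> \<circ> (blaschke_fun \<omega> ^^ n)) field_differentiable (at z)"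
    by (intro field_differentiable_compose blaschke_fun_differentiable) auto
  then show ?case by (simp add: o_def)
qed (simp add: id_def)

lemma cis_lift_vector_derivative:
  assumes "(S has_field_derivative d) (at t)"
  shows "((\<lambda>s. cis (2 * pi * S s)) has_vector_derivative (of_real (2 * pi * d) * \<i> * cis (2 * pi * S t))) (at t)"
proof -
  have "((\<lambda>s. of_real (2 * pi * S s)) has_vector_derivative complex_of_real (2 * pi * d)) (at t)"
    using assms by (intro has_vector_derivative_of_real)
      (auto intro!: derivative_eq_intros simp flip: has_real_derivative_iff_has_vector_derivative)
  then have "((\<lambda>s. \<i> * of_real (2 * pi * S s)) has_vector_derivative \<i> * of_real (2 * pi * d)) (at t)"
    by (rule has_vector_derivative_mult_right)
  from field_vector_diff_chain_at[OF this DERIV_exp]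
  show ?thesis by (simp add: cis_conv_exp o_def mult_ac)
qed

text \<open>
  Differentiate the equation \<open>Q (cis (2 \<pi> s)) = cis (2 \<pi> S s)\<close> with respect to the real variable \<open>s\<close>.
\<close>

lemma norm_deriv_circle:
  assumes Q: "Q field_differentiable (at (cis (2 * pi * t)))"
    and conj: "\<And>s. Q (cis (2 * pi * s)) = cis (2 * pi * S s)"
    and S: "(S has_field_derivative d) (at t)"
  shows "cmod (deriv Q (cis (2 * pi * t))) = \<bar>d\<bar>"
proof -
  have id: "((\<lambda>s. s) has_field_derivative 1) (at (t :: real))" by simp
  have "((Q \<circ> (\<lambda>s. cis (2 * pi * s))) has_vector_derivative
      (of_real (2 * pi * 1) * \<i> * cis (2 * pi * t)) * deriv Q (cis (2 * pi * t))) (at t)"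
    by (rule field_vector_diff_chain_at[OF cis_lift_vector_derivative[OF id]])
       (use Q in \<open>simp add: field_differentiable_derivI\<close>)
  moreover have "Q \<circ> (\<lambda>s. cis (2 * pi * s)) = (\<lambda>s. cis (2 * pi * S s))" using conj by auto
  ultimately have "(of_real (2 * pi * 1) * \<i> * cis (2 * pi * t)) * deriv Q (cis (2 * pi * t))
      = of_real (2 * pi * d) * \<i> * cis (2 * pi * S t)"
    using vector_derivative_unique_at cis_lift_vector_derivative[OF S] by metis
  from arg_cong[OF this, of cmod] show ?thesis by (simp add: norm_mult abs_mult)
qed

lemma funpow_circle_differentiable: "(blaschke_fun \<omega> ^^ n) field_differentiable (at (cis (2 * pi * t)))"
  by (intro blaschke_fun_funpow_differentiable pole_off_circle) (simp add: blaschke_fun_funpow_circle)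

lemma spherical_deriv_funpow_circle_point:
  "spherical_deriv (blaschke \<omega> ^^ n) (circle_point t) = lift_deriv \<omega> n t"
proof -
  let ?f = "blaschke \<omega> ^^ n"
  have f: "?f (circle_point t) = Fin (cis (2 * pi * (blaschke_lift \<omega> ^^ n) t))"
    unfolding blaschke_funpow_circle_point by (simp add: circle_point_def)
  have "chart (Fin w) y = finite_part y" for w y by (cases y) auto
  then have "(\<lambda>u. chart (?f (circle_point t)) (?f (chart_inv (circle_point t) u))) = (blaschke_fun \<omega> ^^ n)"
    unfolding f by (auto simp: circle_point_def finite_part_blaschke_funpow)
  moreover have "cmod (deriv (blaschke_fun \<omega> ^^ n) (cis (2 * pi * t))) = \<bar>lift_deriv \<omega> n t\<bar>"
    by (rule norm_deriv_circle[OF funpow_circle_differentiable blaschke_fun_funpow_circle blaschke_lift_funpow_deriv])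
  ultimately show ?thesis
    unfolding spherical_deriv_def using lift_deriv_nonneg[of \<omega> n t]
    by (simp add: f spherical_density_def) (simp add: circle_point_def)
qed

lemma spherical_deriv_circle_point: "spherical_deriv (blaschke \<omega>) (circle_point t) = blaschke_slope t"
  using spherical_deriv_funpow_circle_point[of 1 \<omega> t] by (simp add: lift_deriv_def)

text \<open>
  Away from infinity and from the pole, the derivative of the Blaschke product is given by a formula. Changing a
  Borel function at these two points leaves it Borel.
\<close>

lemma measurable_ln_spherical_deriv:
  "(\<lambda>x. ln (spherical_deriv (blaschke \<omega>) x)) \<in> borel_measurable borel"
proof -
  define c where "c = exp (2 * of_real pi * \<i> * complex_of_real \<omega>)"
  define D where "D z = c * (2 * z * ((z - 3) / (1 - 3 * z)) + z\<^sup>2 * (((1 - 3 * z) + 3 * (z - 3)) / (1 - 3 * z)\<^sup>2))" for z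
  have D: "(blaschke_fun \<omega> has_field_derivative D z) (at z)" if "1 - 3 * z \<noteq> 0" for z
  proof -
    have q: "((\<lambda>z. (z - 3) / (1 - 3 * z)) has_field_derivative (1 * (1 - 3 * z) - (z - 3) * (- 3)) / ((1 - 3 * z) * (1 - 3 * z))) (at z)"
      using that by (auto intro!: derivative_eq_intros)
    have p: "((\<lambda>z. z\<^sup>2) has_field_derivative 2 * z) (at z)"
      by (auto intro!: derivative_eq_intros)
    have "((\<lambda>z. c * (z\<^sup>2 * ((z - 3) / (1 - 3 * z)))) has_field_derivative
        c * (2 * z * ((z - 3) / (1 - 3 * z)) + (1 * (1 - 3 * z) - (z - 3) * (- 3)) / ((1 - 3 * z) * (1 - 3 * z)) * z\<^sup>2)) (at z)"
      by (rule DERIV_cmult[OF DERIV_mult[OF p q]])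
    then show ?thesis
      unfolding blaschke_fun_def[abs_def] D_def c_def[symmetric]
      by (simp add: mult_ac power2_eq_square)
  qed
  have [measurable]: "D \<in> borel_measurable borel" "blaschke_fun \<omega> \<in> borel_measurable borel"
    unfolding D_def[abs_def] blaschke_fun_def[abs_def] by measurable
  have [measurable]: "spherical_density \<in> borel_measurable borel"
    unfolding spherical_density_def[abs_def] by measurable
  let ?g = "\<lambda>z. ln (cmod (D z) * spherical_density (blaschke_fun \<omega> z) / spherical_density z)"
  have "(\<lambda>x. ?g (finite_part x)) \<in> borel_measurable borel" by measurable
  then show ?thesis
  proof (rule measurable_discrete_difference[where X = "{Infty, Fin (1 / 3)}"])
    fix x assume x: "x \<notin> {Infty, Fin (1 / 3)}"
    then obtain z where z: "x = Fin z" "z \<noteq> 1 / 3" by (cases x) auto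
    then have nz: "1 - 3 * z \<noteq> 0" by (auto simp: field_simps)
    have f: "blaschke \<omega> (Fin z) = Fin (blaschke_fun \<omega> z)" using nz by (simp add: blaschke_fun_def)
    have c: "chart (Fin w) y = finite_part y" for w y by (cases y) auto
    have ch: "(\<lambda>u. chart (blaschke \<omega> (Fin z)) (blaschke \<omega> (chart_inv (Fin z) u))) = blaschke_fun \<omega>"
      unfolding f c by (simp add: finite_part_blaschke del: blaschke.simps)
    show "?g (finite_part x) = ln (spherical_deriv (blaschke \<omega>) x)"
      unfolding z(1) spherical_deriv_def ch unfolding f by (simp add: DERIV_imp_deriv[OF D[OF nz]])
  qed auto
qed

lemma continuous_circle_point: "continuous_on A circle_point"
  unfolding circle_point_def[abs_def]
  by (intro continuous_on_compose2[OF continuous_Fin[of UNIV]] continuous_intros) auto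

lemma circle_point_plus_int: "circle_point (t + of_int m) = circle_point t"
  using circle_point_eq_iff by blast

lemma critical_preimage_deriv_zero:
  assumes "(blaschke_lift \<omega> ^^ i) t = of_int m" "i < n"
  shows "deriv (blaschke_fun \<omega> ^^ n) (cis (2 * pi * t)) = 0"
proof -
  have "blaschke_slope ((blaschke_lift \<omega> ^^ i) t) = 0"
    unfolding assms(1) using blaschke_slope_plus_int[of 0 m] by (simp add: blaschke_slope_def)
  then have "lift_deriv \<omega> n t = 0"
    unfolding lift_deriv_def using assms(2) by (intro prod_zero) auto
  moreover have "cmod (deriv (blaschke_fun \<omega> ^^ n) (cis (2 * pi * t))) = \<bar>lift_deriv \<omega> n t\<bar>"
    by (rule norm_deriv_circle[OF funpow_circle_differentiable blaschke_fun_funpow_circle blaschke_lift_funpow_deriv])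
  ultimately show ?thesis by simp
qed

section \<open>The rotation number\<close>

lemma circle_lift_blaschke_lift: "circle_lift (blaschke \<omega>) (blaschke_lift \<omega>)"
  by (simp add: circle_lift_def continuous_blaschke_lift blaschke_circle_point)

lemma circle_lift_unique:
  assumes "circle_lift (blaschke \<omega>) F"
  obtains k :: int where "\<And>t. F t = blaschke_lift \<omega> t + of_int k"
proof -
  let ?D = "\<lambda>t. F t - blaschke_lift \<omega> t"
  have int: "?D t \<in> \<int>" for t
  proof -
    have "circle_point (F t) = circle_point (blaschke_lift \<omega> t)"
      using assms unfolding circle_lift_def by (metis blaschke_circle_point)
    then show ?thesis unfolding circle_point_eq_iff by auto
  qed
  have "?D constant_on UNIV"
  proof (rule continuous_discrete_range_constant)
    show "continuous_on UNIV ?D"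
      using assms unfolding circle_lift_def by (intro continuous_intros continuous_blaschke_lift) auto
    fix x
    show "\<exists>e>0. \<forall>y. y \<in> UNIV \<and> ?D y \<noteq> ?D x \<longrightarrow> e \<le> norm (?D y - ?D x)"
    proof (intro exI[of _ 1] conjI allI impI)
      fix y assume "y \<in> UNIV \<and> ?D y \<noteq> ?D x"
      then show "1 \<le> norm (?D y - ?D x)"
        using Ints_nonzero_abs_ge1[of "?D y - ?D x"] int by (simp add: Ints_diff)
    qed simp
  qed simp
  then obtain c where c: "\<And>t. ?D t = c" unfolding constant_on_def by blast
  then obtain k :: int where "c = of_int k" using int[of 0] by (metis Ints_cases)
  then show ?thesis using that[of k] c by (metis add.commute diff_add_cancel)
qed

text \<open>
  Two lifts differ by a constant integer, which changes the translation number by that integer and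
  leaves its fractional part alone.
\<close>

lemma rotation_number_conv:
  assumes dev: "\<And>n t. \<bar>(blaschke_lift \<omega> ^^ n) t - t - real n * \<alpha>\<bar> \<le> 2"
  shows "rotation_number (blaschke \<omega>) = frac \<alpha>"
proof -
  have lim: "(\<lambda>n. ((F ^^ n) t - t) / real n) \<longlonglongrightarrow> \<alpha> + of_int k"
    if F: "\<And>t. F t = blaschke_lift \<omega> t + of_int k" for F k t
  proof -
    have Fn: "(F ^^ n) t = (blaschke_lift \<omega> ^^ n) t + real n * of_int k" for n
    proof (induction n)
      case (Suc n)
      have "(F ^^ Suc n) t = blaschke_lift \<omega> ((blaschke_lift \<omega> ^^ n) t + of_int (int n * k)) + of_int k"
        by (simp add: Suc F)
      also have "\<dots> = (blaschke_lift \<omega> ^^ Suc n) t + real (Suc n) * of_int k"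
        unfolding blaschke_lift_plus_int by (simp add: algebra_simps)
      finally show ?case .
    qed simp
    have "(\<lambda>n. ((F ^^ n) t - t) / real n - (\<alpha> + of_int k)) \<longlonglongrightarrow> 0"
    proof (rule Lim_null_comparison)
      show "(\<lambda>n. 2 * (1 / real n)) \<longlonglongrightarrow> 0"
        by (rule tendsto_mult_right_zero) (rule lim_1_over_n)
      show "\<forall>\<^sub>F n in sequentially. norm (((F ^^ n) t - t) / real n - (\<alpha> + of_int k)) \<le> 2 * (1 / real n)"
        using eventually_gt_at_top[of 0]
      proof eventually_elim
        case (elim n)
        have "((F ^^ n) t - t) / real n - (\<alpha> + of_int k) = ((blaschke_lift \<omega> ^^ n) t - t - real n * \<alpha>) / real n"
          using elim by (simp add: Fn field_simps)
        then show ?case using dev[of n t] elim by (simp add: divide_right_mono)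
      qed
    qed
    then show ?thesis by (simp add: LIM_zero_iff)
  qed
  show ?thesis
    unfolding rotation_number_def
  proof (rule the_equality)
    show "\<exists>F L. circle_lift (blaschke \<omega>) F \<and> (\<forall>t. (\<lambda>n. ((F ^^ n) t - t) / real n) \<longlonglongrightarrow> L) \<and> frac \<alpha> = frac L"
      using circle_lift_blaschke_lift lim[of "blaschke_lift \<omega>" 0] by (intro exI[of _ "blaschke_lift \<omega>"] exI[of _ \<alpha>]) auto
  next
    fix \<rho> assume "\<exists>F L. circle_lift (blaschke \<omega>) F \<and> (\<forall>t. (\<lambda>n. ((F ^^ n) t - t) / real n) \<longlonglongrightarrow> L) \<and> \<rho> = frac L"
    then obtain F L where F: "circle_lift (blaschke \<omega>) F" "\<And>t. (\<lambda>n. ((F ^^ n) t - t) / real n) \<longlonglongrightarrow> L" "\<rho> = frac L"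
      by blast
    obtain k where "\<And>t. F t = blaschke_lift \<omega> t + of_int k" using circle_lift_unique[OF F(1)] by metis
    from lim[OF this, of 0] F(2)[of 0] have "L = \<alpha> + of_int k" by (rule LIMSEQ_unique[symmetric])
    then show "\<rho> = frac \<alpha>" using F(3) by (simp add: frac_def)
  qed
qed

section \<open>The invariant measure\<close>

locale irrational_blaschke =
  fixes \<omega> \<alpha> :: real
  assumes deviation: "\<And>n t. \<bar>(blaschke_lift \<omega> ^^ n) t - t - real n * \<alpha>\<bar> \<le> 2"
    and irrational_\<alpha>: "\<alpha> \<notin> \<rat>"

sublocale irrational_blaschke \<subseteq> irrational_circle_map "blaschke_lift \<omega>" \<alpha>
  by unfold_locales
    (simp_all add: strict_mono_blaschke_lift continuous_blaschke_lift blaschke_lift_plus_one deviation irrational_\<alpha>)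

context irrational_blaschke
begin

definition circle_section :: "real \<Rightarrow> riemann_sphere" where
  "circle_section u = circle_point (section_pt u)"

text \<open>
  Lebesgue measure of the circle, transported by the section of the semiconjugacy. The section
  intertwines the rotation by \<open>\<alpha>\<close> with the Blaschke product (\<open>circle_section_rotate\<close>).
\<close>

definition rotation_measure :: "riemann_sphere measure" where
  "rotation_measure = distr unit_window borel circle_section"

lemma measurable_section_pt [measurable]: "section_pt \<in> borel_measurable borel"
  by (rule borel_measurable_mono[OF mono_section_pt])

lemma measurable_circle_section [measurable]: "circle_section \<in> borel_measurable borel"
proof -
  have [measurable]: "circle_point \<in> borel_measurable borel"
    by (rule borel_measurable_continuous_onI[OF continuous_circle_point])
  show ?thesis unfolding circle_section_def[abs_def] by measurable
qed

lemma circle_section_window: "circle_section \<in> measurable unit_window borel"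
  by (rule measurable_unit_window) measurable

lemma circle_section_plus_one: "circle_section (u + 1) = circle_section u"
  using section_pt_plus_int[of u 1] circle_point_plus_int[of "section_pt u" 1] by (simp add: circle_section_def)

lemma circle_section_rotate: "circle_section (u + \<alpha>) = blaschke \<omega> (circle_section u)"
  by (simp add: circle_section_def section_pt_rotate blaschke_circle_point)

lemma space_rotation_measure [simp]: "space rotation_measure = UNIV"
  and sets_rotation_measure [simp]: "sets rotation_measure = sets borel"
  by (simp_all add: rotation_measure_def)

lemma emeasure_rotation_measure:
  assumes [measurable]: "A \<in> sets borel"
  shows "emeasure rotation_measure A = emeasure lborel ({u. circle_section u \<in> A} \<inter> {0<..1})"
proof -
  have "emeasure rotation_measure A = emeasure unit_window (circle_section -` A \<inter> space unit_window)"
    unfolding rotation_measure_def by (rule emeasure_distr[OF circle_section_window assms])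
  also have "\<dots> = emeasure lborel (circle_section -` A \<inter> space unit_window)"
    by (rule emeasure_unit_window) auto
  finally show ?thesis by (simp add: vimage_def)
qed

lemma borel_probability_rotation_measure: "borel_probability rotation_measure"
  unfolding borel_probability_def
  using prob_space.prob_space_distr[OF prob_space_unit_window circle_section_window]
  by (simp add: rotation_measure_def)

lemma invariant_rotation_measure: "invariant_measure (blaschke \<omega>) rotation_measure"
  unfolding invariant_measure_def
proof
  show "blaschke \<omega> \<in> measurable rotation_measure rotation_measure"
    unfolding measurable_cong_sets[OF sets_rotation_measure sets_rotation_measure] by measurable
  have meas: "circle_rotation \<alpha> \<in> measurable unit_window unit_window"
    unfolding unit_window_def
    by (rule measurable_restrict_space3) (auto simp: circle_rotation_window)
  have "distr rotation_measure rotation_measure (blaschke \<omega>) = distr rotation_measure borel (blaschke \<omega>)"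
    by (rule distr_cong) auto
  also have "\<dots> = distr unit_window borel (blaschke \<omega> \<circ> circle_section)"
    unfolding rotation_measure_def by (rule distr_distr) (auto intro: circle_section_window)
  also have "blaschke \<omega> \<circ> circle_section = circle_section \<circ> circle_rotation \<alpha>"
    by (auto simp: circle_section_rotate[symmetric] periodic_circle_rotation[of circle_section, OF circle_section_plus_one])
  also have "distr unit_window borel \<dots> = distr (distr unit_window unit_window (circle_rotation \<alpha>)) borel circle_section"
    by (rule distr_distr[OF circle_section_window meas, symmetric])
  also have "\<dots> = rotation_measure"
    by (simp add: circle_rotation_measure_preserving rotation_measure_def)
  finally show "distr rotation_measure rotation_measure (blaschke \<omega>) = rotation_measure" .
qed

lemma ergodic_rotation_measure: "ergodic_measure (blaschke \<omega>) rotation_measure"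
  unfolding ergodic_measure_def
proof (intro ballI impI)
  fix A assume "A \<in> sets rotation_measure" and inv: "blaschke \<omega> -` A \<inter> space rotation_measure = A"
  then have [measurable]: "A \<in> sets borel" by simp
  define E where "E = {u. circle_section u \<in> A}"
  have [measurable]: "E \<in> sets borel" unfolding E_def by measurable
  have iff: "blaschke \<omega> x \<in> A \<longleftrightarrow> x \<in> A" for x using inv by auto
  have "emeasure lborel (E \<inter> {0<..1}) = 0 \<or> emeasure lborel ({0<..1} - E) = 0"
    by (rule irrational_rotation_ergodic[OF _ _ _ irrational_\<alpha>])
       (simp_all add: E_def circle_section_plus_one circle_section_rotate iff)
  moreover have "emeasure rotation_measure A = emeasure lborel (E \<inter> {0<..1})"
    unfolding E_def by (rule emeasure_rotation_measure) simp
  moreover have "emeasure rotation_measure (- A) = emeasure lborel ({0<..1} - E)"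
    using emeasure_rotation_measure[of "- A"] by (auto simp: E_def intro!: arg_cong[where f = "emeasure lborel"])
  ultimately show "emeasure rotation_measure A = 0 \<or> emeasure rotation_measure (space rotation_measure - A) = 0"
    by (simp add: Compl_eq_Diff_UNIV)
qed

text \<open>
  The arc from \<open>0\<close> to \<open>section_pt v\<close> pulls back to \<open>(0, v]\<close>, up to the point \<open>1\<close>, so a suitable arc cuts a
  piece of intermediate measure out of \<open>A\<close>.
\<close>

lemma non_atomic_rotation_measure: "non_atomic rotation_measure"
  unfolding non_atomic_def
proof (intro ballI impI)
  fix A assume "A \<in> sets rotation_measure" and pos: "0 < emeasure rotation_measure A"
  then have [measurable]: "A \<in> sets borel" by simp
  define E where "E = {u. circle_section u \<in> A}"
  have [measurable]: "E \<in> sets borel" unfolding E_def by measurable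
  have A: "emeasure rotation_measure A = emeasure lborel (E \<inter> {0<..1})"
    unfolding E_def by (rule emeasure_rotation_measure) simp
  obtain v where v: "0 < v" "v < 1" "0 < emeasure lborel (E \<inter> {0<..v})"
      "emeasure lborel (E \<inter> {0<..v}) < emeasure lborel (E \<inter> {0<..1})"
    using exists_half_mass[of E] pos A by auto
  define C where "C = circle_point ` {0..section_pt v}"
  have "compact C" unfolding C_def by (intro compact_continuous_image continuous_circle_point) auto
  then have [measurable]: "C \<in> sets borel" by (intro borel_closed compact_imp_closed)
  have C: "circle_section u \<in> C \<longleftrightarrow> u \<le> v" if u: "0 < u" "u < 1" for u
  proof
    assume "circle_section u \<in> C"
    then obtain s m where s: "0 \<le> s" "s \<le> section_pt v" "section_pt u = s + of_int m"
      by (auto simp: C_def circle_section_def circle_point_eq_iff)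
    have pu: "0 < section_pt u" "section_pt u < 1"
      using section_pt_pos[OF u(1)] section_pt_less_iff[of u 1] section_pt_le_one[of 1] u by auto
    have "section_pt v \<le> 1" using v by (intro section_pt_le_one) auto
    then have "m < 1" "-1 < m" using s pu by linarith+
    then have "m = 0" by simp
    then show "u \<le> v" using s section_pt_less_iff[of v u] by simp
  next
    assume "u \<le> v"
    then have "section_pt u \<le> section_pt v" using mono_section_pt by (simp add: monoD)
    then show "circle_section u \<in> C"
      using section_pt_pos[OF u(1)] by (auto simp: C_def circle_section_def)
  qed
  have "emeasure rotation_measure (A \<inter> C) = emeasure lborel ({u. circle_section u \<in> A \<inter> C} \<inter> {0<..1})"
    by (rule emeasure_rotation_measure) simp
  also have "\<dots> = emeasure lborel (E \<inter> {0<..v})"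
  proof (rule emeasure_eq_AE)
    show "AE u in lborel. u \<in> {u. circle_section u \<in> A \<inter> C} \<inter> {0<..1} \<longleftrightarrow> u \<in> E \<inter> {0<..v}"
      using AE_lborel_singleton[of 1]
    proof eventually_elim
      case (elim u)
      then show ?case using C[of u] v by (auto simp: E_def)
    qed
  qed measurable
  finally show "\<exists>B\<in>sets rotation_measure. B \<subseteq> A \<and> 0 < emeasure rotation_measure B
      \<and> emeasure rotation_measure B < emeasure rotation_measure A"
    using v A by (intro bexI[of _ "A \<inter> C"]) auto
qed

end

section \<open>The Lyapunov exponent\<close>

lemma blaschke_lift_expansion_le:
  assumes "x \<le> y" shows "blaschke_lift \<omega> y - blaschke_lift \<omega> x \<le> 3 / 2 * (y - x)"
proof -
  have "3 / 2 * x - blaschke_lift \<omega> x \<le> 3 / 2 * y - blaschke_lift \<omega> y"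
  proof (rule DERIV_nonneg_imp_nondecreasing[OF assms, where f = "\<lambda>t. 3 / 2 * t - blaschke_lift \<omega> t"])
    fix t
    have "((\<lambda>t. 3 / 2 * t - blaschke_lift \<omega> t) has_field_derivative 3 / 2 - blaschke_slope t) (at t)"
      by (rule derivative_eq_intros blaschke_lift_deriv refl | simp)+
    then show "\<exists>d. ((\<lambda>t. 3 / 2 * t - blaschke_lift \<omega> t) has_real_derivative d) (at t) \<and> 0 \<le> d"
      using blaschke_slope_le[of t] by (intro exI conjI) auto
  qed
  then show ?thesis by (simp add: algebra_simps)
qed

context irrational_blaschke
begin

definition log_slope :: "real \<Rightarrow> real" where
  "log_slope u = ln (blaschke_slope (section_pt u))"

definition section_increment :: "real \<Rightarrow> real \<Rightarrow> real" where
  "section_increment d u = section_pt u - section_pt (u - d)"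

lemma measurable_log_slope [measurable]: "log_slope \<in> borel_measurable borel"
proof -
  have [measurable]: "blaschke_slope \<in> borel_measurable borel"
    by (rule borel_measurable_continuous_onI[OF continuous_blaschke_slope])
  show ?thesis unfolding log_slope_def[abs_def] by measurable
qed

lemma measurable_section_increment [measurable]: "section_increment d \<in> borel_measurable borel"
  unfolding section_increment_def[abs_def] by measurable

lemma log_slope_plus_one: "log_slope (u + 1) = log_slope u"
  using section_pt_plus_int[of u 1] blaschke_slope_plus_int[of "section_pt u" 1] by (simp add: log_slope_def)

lemma section_increment_plus_one: "section_increment d (u + 1) = section_increment d u"
  using section_pt_plus_int[of u 1] section_pt_plus_int[of "u - d" 1]
  by (simp add: section_increment_def algebra_simps)

lemma section_increment_rotate:
  "section_increment d (u + \<alpha>) = blaschke_lift \<omega> (section_pt u) - blaschke_lift \<omega> (section_pt (u - d))"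
  using section_pt_rotate[of u] section_pt_rotate[of "u - d"] by (simp add: section_increment_def algebra_simps)

lemma section_increment_pos: "0 < d \<Longrightarrow> 0 < section_increment d u"
  by (simp add: section_increment_def section_pt_less_iff)

lemma section_increment_le_one: 
  assumes "d \<le> 1" shows "section_increment d u \<le> 1"
proof -
  have "section_pt (u + of_int (-1)) \<le> section_pt (u - d)"
    using assms by (intro monoD[OF mono_section_pt]) simp
  then show ?thesis unfolding section_pt_plus_int by (simp add: section_increment_def)
qed

text \<open>
  The lift maps the interval from \<open>section_pt (u - d)\<close> to \<open>section_pt u\<close> onto the interval with the
  parameter \<open>u + \<alpha>\<close>; this is the logarithm of the factor by which it stretches the length.
\<close>

definition log_ratio :: "real \<Rightarrow> real \<Rightarrow> real" where
  "log_ratio d u = ln (section_increment d (u + \<alpha>)) - ln (section_increment d u)"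

lemma measurable_log_ratio [measurable]: "log_ratio d \<in> borel_measurable borel"
  unfolding log_ratio_def[abs_def] by measurable

lemma
  assumes "0 < d" "d \<le> 1"
  shows integrable_log_ratio: "integrable unit_window (log_ratio d)"
    and integral_log_ratio: "(\<integral>u. log_ratio d u \<partial>unit_window) = 0"
proof -
  interpret prob_space unit_window by (rule prob_space_unit_window)
  obtain c where c: "0 < c" "\<And>u. c \<le> section_increment d u"
    using section_pt_gap[OF assms(1)] unfolding section_increment_def by metis
  let ?L = "\<lambda>u. ln (section_increment d u)"
  have [measurable]: "?L \<in> borel_measurable borel" by measurable
  have per: "?L (u + 1) = ?L u" for u by (simp add: section_increment_plus_one)
  have "\<bar>?L u\<bar> \<le> \<bar>ln c\<bar>" for u
  proof -
    have "ln c \<le> ?L u" using c by (simp add: ln_le_cancel_iff section_increment_pos[OF assms(1)])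
    moreover have "?L u \<le> 0"
      using section_increment_le_one[OF assms(2)] section_increment_pos[OF assms(1)] by simp
    ultimately show ?thesis by linarith
  qed
  then have L: "integrable unit_window ?L"
    by (intro integrable_const_bound[where B = "\<bar>ln c\<bar>"] measurable_unit_window) auto
  have L': "integrable unit_window (\<lambda>u. ?L (u + \<alpha>))"
    using integrable_unit_window_shift[of ?L \<alpha>, OF _ per] L by simp
  show "integrable unit_window (log_ratio d)"
    unfolding log_ratio_def[abs_def] by (rule Bochner_Integration.integrable_diff[OF L' L])
  show "(\<integral>u. log_ratio d u \<partial>unit_window) = 0"
    unfolding log_ratio_def using Bochner_Integration.integral_diff[OF L' L]
      integral_unit_window_shift[of ?L \<alpha>, OF _ per] by simp
qed

lemma log_ratio_conv: 
  assumes "0 < d" 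
  shows "log_ratio d u = ln ((blaschke_lift \<omega> (section_pt u) - blaschke_lift \<omega> (section_pt (u - d))) / (section_pt u - section_pt (u - d)))"
  using section_increment_pos[OF assms, of u] section_increment_pos[OF assms, of "u + \<alpha>"]
  unfolding log_ratio_def section_increment_rotate by (simp add: section_increment_def ln_div)

lemma log_ratio_le: 
  assumes "0 < d" shows "log_ratio d u \<le> ln (3 / 2)"
proof -
  have "section_pt (u - d) < section_pt u" using assms by (simp add: section_pt_less_iff)
  moreover from this have "blaschke_lift \<omega> (section_pt (u - d)) < blaschke_lift \<omega> (section_pt u)"
    by (simp add: F_less_iff)
  ultimately show ?thesis
    unfolding log_ratio_conv[OF assms] using blaschke_lift_expansion_le[of "section_pt (u - d)" "section_pt u" \<omega>]
    by (subst ln_le_cancel_iff) (auto simp: divide_simps)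
qed

lemma section_pt_not_Ints: "u \<notin> \<int> \<Longrightarrow> section_pt u \<notin> \<int>"
  using section_pt_int_iff by (metis Ints_cases Ints_of_int)

lemma log_ratio_tendsto:
  assumes "u \<notin> \<int>" and d: "d \<longlonglongrightarrow> 0" "\<And>n. 0 < d n"
  shows "(\<lambda>n. log_ratio (d n) u) \<longlonglongrightarrow> log_slope u"
proof -
  let ?x = "section_pt u"
  have "((\<lambda>y. (blaschke_lift \<omega> y - blaschke_lift \<omega> ?x) / (y - ?x)) \<longlongrightarrow> blaschke_slope ?x) (at ?x)"
    using blaschke_lift_deriv[of \<omega> ?x] unfolding has_field_derivative_iff .
  moreover have "filterlim (\<lambda>n. section_pt (u - d n)) (at ?x) sequentially"
    unfolding filterlim_at using section_pt_left_continuous[OF d] d(2) section_pt_less_iff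
    by (auto intro!: always_eventually) (metis diff_less_eq less_add_same_cancel1 less_irrefl)
  ultimately have "(\<lambda>n. (blaschke_lift \<omega> (section_pt (u - d n)) - blaschke_lift \<omega> ?x) / (section_pt (u - d n) - ?x)) \<longlonglongrightarrow> blaschke_slope ?x"
    by (rule filterlim_compose)
  moreover have "(a - b) / (c - e) = (b - a) / (e - c)" for a b c e :: real
    by (metis minus_diff_eq minus_divide_divide)
  ultimately have "(\<lambda>n. (blaschke_lift \<omega> ?x - blaschke_lift \<omega> (section_pt (u - d n))) / (?x - section_pt (u - d n))) \<longlonglongrightarrow> blaschke_slope ?x"
    by (simp add: minus_divide_divide)
  then show ?thesis
    unfolding log_ratio_conv[OF d(2)] log_slope_def
    by (rule tendsto_ln) (use blaschke_slope_pos[OF section_pt_not_Ints[OF assms(1)]] in simp)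
qed

lemma log_slope_le: "log_slope u \<le> ln (3 / 2)"
proof (cases "blaschke_slope (section_pt u) = 0")
  case False
  then have "0 < blaschke_slope (section_pt u)" using blaschke_slope_nonneg by (simp add: less_le)
  then show ?thesis using blaschke_slope_le[of "section_pt u"] by (simp add: log_slope_def)
qed (simp add: log_slope_def)

lemma AE_window_not_Ints: "AE u in unit_window. u \<notin> \<int>"
proof -
  have "AE u in lborel. u \<noteq> (1::real)" by (rule AE_lborel_singleton)
  then have "AE u in lborel. u \<in> {0<..1} \<longrightarrow> u \<notin> (\<int> :: real set)"
  proof eventually_elim
    case (elim u)
    show ?case
    proof (intro impI notI)
      assume "u \<in> {0<..1}" "u \<in> \<int>"
      then obtain m :: int where "u = of_int m" "0 < m" "m \<le> 1" by (auto elim!: Ints_cases)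
      then show False using elim by auto
    qed
  qed
  then show ?thesis unfolding unit_window_def by (subst AE_restrict_space_iff) auto
qed

text \<open>
  The stretching factors of the intervals tend to the slope as \<open>d\<close> tends to \<open>0\<close>, their logarithms are
  bounded above by \<open>ln (3 / 2)\<close> and have integral zero. Fatou's lemma applies to the differences.
\<close>

lemma integrable_log_slope_and_integral_nonneg:
  "integrable unit_window log_slope \<and> 0 \<le> (\<integral>u. log_slope u \<partial>unit_window)"
proof -
  interpret prob_space unit_window by (rule prob_space_unit_window)
  define d where "d n = 1 / real (Suc n)" for n
  have d: "d \<longlonglongrightarrow> 0" "\<And>n. 0 < d n" "\<And>n. d n \<le> 1"
    using lim_inverse_n'[THEN LIMSEQ_Suc] by (simp_all add: d_def[abs_def])
  let ?g = "\<lambda>u. ln (3 / 2) - log_slope u"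
  let ?h = "\<lambda>n u. ln (3 / 2) - log_ratio (d n) u"
  have wm [measurable]: "log_slope \<in> borel_measurable unit_window" "log_ratio t \<in> borel_measurable unit_window" for t
    by (rule measurable_unit_window, measurable)+
  have "(\<integral>\<^sup>+ u. ennreal (?g u) \<partial>unit_window) = (\<integral>\<^sup>+ u. liminf (\<lambda>n. ennreal (?h n u)) \<partial>unit_window)"
  proof (rule nn_integral_cong_AE)
    show "AE u in unit_window. ennreal (?g u) = liminf (\<lambda>n. ennreal (?h n u))"
      using AE_window_not_Ints
    proof eventually_elim
      case (elim u)
      have "(\<lambda>n. ennreal (?h n u)) \<longlonglongrightarrow> ennreal (?g u)"
        by (intro tendsto_ennrealI tendsto_diff tendsto_const log_ratio_tendsto[OF elim d(1,2)])
      then show ?case by (simp add: lim_imp_Liminf)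
    qed
  qed
  also have "\<dots> \<le> liminf (\<lambda>n. \<integral>\<^sup>+ u. ennreal (?h n u) \<partial>unit_window)"
    by (rule nn_integral_liminf) measurable
  also have "(\<lambda>n. \<integral>\<^sup>+ u. ennreal (?h n u) \<partial>unit_window) = (\<lambda>n. ennreal (ln (3 / 2)))"
  proof
    fix n
    have "(\<integral>\<^sup>+ u. ennreal (?h n u) \<partial>unit_window) = ennreal (\<integral>u. ?h n u \<partial>unit_window)"
      using log_ratio_le[OF d(2)] integrable_log_ratio[OF d(2,3)] by (intro nn_integral_eq_integral) auto
    also have "(\<integral>u. ?h n u \<partial>unit_window) = ln (3 / 2)"
      using integrable_log_ratio[OF d(2,3), of n] integral_log_ratio[OF d(2,3), of n] by (simp add: prob_space[simplified])
    finally show "(\<integral>\<^sup>+ u. ennreal (?h n u) \<partial>unit_window) = ennreal (ln (3 / 2))" .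
  qed
  also have "liminf (\<lambda>n. ennreal (ln (3 / 2))) = ennreal (ln (3 / 2))"
    by (rule Liminf_const) simp
  finally have le: "(\<integral>\<^sup>+ u. ennreal (?g u) \<partial>unit_window) \<le> ennreal (ln (3 / 2))" .
  have g: "integrable unit_window ?g"
    using le log_slope_le by (intro integrableI_nonneg) (auto intro: le_less_trans)
  have "integrable unit_window (\<lambda>u. ln (3 / 2) - ?g u)"
    by (rule Bochner_Integration.integrable_diff[OF _ g]) simp
  moreover have "(\<lambda>u. ln (3 / 2) - ?g u) = log_slope" by (rule ext) simp
  ultimately have int: "integrable unit_window log_slope" by (simp only:)
  have "ennreal (\<integral>u. ?g u \<partial>unit_window) \<le> ennreal (ln (3 / 2))"
    using le g log_slope_le by (subst nn_integral_eq_integral[symmetric]) auto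
  then have "(\<integral>u. ?g u \<partial>unit_window) \<le> ln (3 / 2)"
    by (subst (asm) ennreal_le_iff) auto
  then show ?thesis using int by (simp add: prob_space[simplified])
qed

text \<open>
  This is the distortion inequality at the endpoints of the interval, in logarithmic form. A critical point
  \<open>m\<close> between them satisfies \<open>u - d \<le> semiconj m < u\<close>, where \<open>semiconj m = m\<close>; since \<open>0 < u \<le> 1\<close>, this
  forces \<open>m \<le> 0\<close> and \<open>u \<le> d\<close>.
\<close>

lemma log_slope_pair_le:
  assumes d: "0 < d" "d \<le> 1" and u: "0 < u" "u \<le> 1" "u \<notin> \<int>" "u - d \<notin> \<int>"
  shows "log_slope u + log_slope (u - d) \<le> 2 * log_ratio d u + ln critical_loss * indicator {0<..d} u"
proof -
  let ?x = "section_pt (u - d)" and ?y = "section_pt u"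
  have xy: "?x < ?y" "?y \<le> ?x + 1"
    using section_increment_pos[OF d(1), of u] section_increment_le_one[OF d(2), of u] by (simp_all add: section_increment_def)
  have pos: "0 < blaschke_slope ?x" "0 < blaschke_slope ?y"
    using u by (auto intro!: blaschke_slope_pos section_pt_not_Ints)
  have F: "0 < blaschke_lift \<omega> ?y - blaschke_lift \<omega> ?x" using xy by (simp add: F_less_iff)
  let ?K = "if \<exists>m :: int. ?x < of_int m \<and> of_int m < ?y then critical_loss else 1"
  have K: "0 < ?K" by (simp add: critical_loss_def)
  have "blaschke_slope ?x * blaschke_slope ?y \<le> ?K * ((blaschke_lift \<omega> ?y - blaschke_lift \<omega> ?x) / (?y - ?x))\<^sup>2"
    using slope_product_le[OF xy, of \<omega>] xy by (simp add: power_divide pos_le_divide_eq)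
  then have "ln (blaschke_slope ?x * blaschke_slope ?y) \<le> ln (?K * ((blaschke_lift \<omega> ?y - blaschke_lift \<omega> ?x) / (?y - ?x))\<^sup>2)"
    using pos K F xy by (subst ln_le_cancel_iff) (auto intro!: mult_pos_pos)
  also have "\<dots> = ln ?K + 2 * log_ratio d u"
    unfolding log_ratio_conv[OF d(1)] using K F xy by (subst ln_mult) (auto simp: ln_realpow)
  also have "ln (blaschke_slope ?x * blaschke_slope ?y) = log_slope u + log_slope (u - d)"
    using pos by (simp add: log_slope_def ln_mult)
  finally have "log_slope u + log_slope (u - d) \<le> ln ?K + 2 * log_ratio d u" .
  moreover have "u \<in> {0<..d}" if ex: "\<exists>m :: int. ?x < of_int m \<and> of_int m < ?y"
  proof -
    obtain m :: int where m: "?x < of_int m" "of_int m < ?y" using ex by blast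
    have "u - d \<le> of_int m" using section_pt_le_iff[of "u - d" "of_int m"] m by simp
    moreover have "of_int m < u" using m(2) by (simp add: less_section_pt_iff)
    then have "m \<le> 0" using u by linarith
    ultimately show ?thesis using u by auto
  qed
  then have "ln ?K \<le> ln critical_loss * indicator {0<..d} u"
    by (auto simp: indicator_def critical_loss_def)
  ultimately show ?thesis by linarith
qed

text \<open>
  Integrating \<open>log_slope_pair_le\<close> gives \<open>2 \<chi> \<le> d ln K\<close>, since both terms on its left have integral \<open>\<chi>\<close>.
\<close>

lemma integral_log_slope: "(\<integral>u. log_slope u \<partial>unit_window) = 0"
proof -
  interpret prob_space unit_window by (rule prob_space_unit_window)
  let ?I = "\<integral>u. log_slope u \<partial>unit_window"
  note int = integrable_log_slope_and_integral_nonneg[THEN conjunct1]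
  have small: "2 * ?I \<le> d * ln critical_loss" if d: "0 < d" "d < 1" for d
  proof -
    have int': "integrable unit_window (\<lambda>u. log_slope (u - d))" "(\<integral>u. log_slope (u - d) \<partial>unit_window) = ?I"
      using int integrable_unit_window_shift[of log_slope "- d"] integral_unit_window_shift[of log_slope "- d"]
      by (simp_all add: log_slope_plus_one)
    have d1: "d \<le> 1" using d by simp
    have ds: "{0<..d} \<in> sets unit_window" using d by (auto simp: sets_unit_window)
    have md: "measure unit_window {0<..d} = d"
      using d by (subst measure_def, subst emeasure_unit_window) auto
    have i3: "integrable unit_window (\<lambda>u. ln critical_loss * indicator {0<..d} u)"
      using ds by (intro integrable_mult_right integrable_real_indicator) (auto simp: less_top[symmetric])
    have "?I + ?I = (\<integral>u. log_slope u + log_slope (u - d) \<partial>unit_window)"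
      using int int' by simp
    also have "\<dots> \<le> (\<integral>u. 2 * log_ratio d u + ln critical_loss * indicator {0<..d} u \<partial>unit_window)"
    proof (rule integral_mono_AE)
      show "AE u in unit_window. log_slope u + log_slope (u - d) \<le> 2 * log_ratio d u + ln critical_loss * indicator {0<..d} u"
      proof -
        have "AE u in unit_window. u \<noteq> d"
          unfolding unit_window_def using AE_lborel_singleton[of d] by (subst AE_restrict_space_iff) auto
        moreover have "AE u in unit_window. 0 < u \<and> u \<le> 1" by (rule AE_I2) simp
        ultimately show ?thesis using AE_window_not_Ints
        proof eventually_elim
          case (elim u)
          have "u - d \<notin> \<int>"
          proof
            assume "u - d \<in> \<int>"
            then obtain m :: int where m: "u - d = of_int m" by (elim Ints_cases)
            then have "-1 < m" "m < 1" using elim d by linarith+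
            then have "m = 0" by simp
            then show False using m elim by simp
          qed
          then show ?case using elim d by (intro log_slope_pair_le) auto
        qed
      qed
    qed (use int int' i3 integrable_log_ratio[OF d(1) d1] in auto)
    also have "\<dots> = d * ln critical_loss"
      using i3 integrable_log_ratio[OF d(1) d1] integral_log_ratio[OF d(1) d1] ds md d1 by (simp add: mult.commute min_absorb1)
    finally show ?thesis by simp
  qed
  have K: "0 < ln critical_loss" by (simp add: critical_loss_def)
  have "?I \<le> 0"
  proof (rule ccontr)
    assume "\<not> ?I \<le> 0"
    then have I: "0 < ?I" by simp
    \<comment> \<open>Small enough that \<open>d * ln critical_loss\<close> falls short of twice the supposed positive integral.\<close>
    define d where "d = min (1 / 2) (?I / ln critical_loss)"
    have d: "0 < d" "d < 1" "d * ln critical_loss \<le> ?I"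
      using I K by (auto simp: d_def min_def field_simps)
    show False using small[OF d(1,2)] d(3) I by linarith
  qed
  then show ?thesis using integrable_log_slope_and_integral_nonneg by linarith
qed

lemma ln_spherical_deriv_section: "ln (spherical_deriv (blaschke \<omega>) (circle_section u)) = log_slope u"
  by (simp add: circle_section_def spherical_deriv_circle_point log_slope_def)

lemma integrable_ln_spherical_deriv: "integrable rotation_measure (\<lambda>x. ln (spherical_deriv (blaschke \<omega>) x))"
  unfolding rotation_measure_def
  using integrable_distr_eq[OF circle_section_window measurable_ln_spherical_deriv]
    integrable_log_slope_and_integral_nonneg by (simp add: ln_spherical_deriv_section)

lemma lyapunov_exponent_rotation_measure: "lyapunov_exponent (blaschke \<omega>) rotation_measure = 0"
  unfolding lyapunov_exponent_def rotation_measure_def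
  using integral_distr[OF circle_section_window measurable_ln_spherical_deriv]
    integral_log_slope by (simp add: ln_spherical_deriv_section)

end

section \<open>Failure of the Collet-Eckmann condition\<close>

context irrational_blaschke
begin

text \<open>
  At time \<open>i\<close> a critical point lies strictly between the orbits of \<open>x\<close> and \<open>s\<close>; only at these times does the
  distortion inequality lose a constant.
\<close>

definition critical_hit :: "real \<Rightarrow> real \<Rightarrow> nat \<Rightarrow> bool" where
  "critical_hit x s i \<longleftrightarrow> (\<exists>m :: int. (blaschke_lift \<omega> ^^ i) x < of_int m \<and> of_int m < (blaschke_lift \<omega> ^^ i) s)"

lemma lift_funpow_plus_int: "(blaschke_lift \<omega> ^^ n) (t + of_int m) = (blaschke_lift \<omega> ^^ n) t + of_int m"
  by (rule funpow_degree_one) (rule blaschke_lift_plus_one)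

lemma lift_funpow_less_iff: "(blaschke_lift \<omega> ^^ n) x < (blaschke_lift \<omega> ^^ n) y \<longleftrightarrow> x < y"
  by (induction n) (simp_all add: F_less_iff)

lemma lift_deriv_plus_int: "lift_deriv \<omega> n (t + of_int m) = lift_deriv \<omega> n t"
  by (simp add: lift_deriv_def lift_funpow_plus_int blaschke_slope_plus_int)

text \<open>
  Multiply the distortion inequality along the two orbits: the lengths of the intervals telescope.
\<close>

lemma orbit_pair_bound:
  assumes "x < s" "s < x + 1"
  shows "lift_deriv \<omega> n x * lift_deriv \<omega> n s * (s - x)\<^sup>2
    \<le> critical_loss ^ card {i. i < n \<and> critical_hit x s i} * ((blaschke_lift \<omega> ^^ n) s - (blaschke_lift \<omega> ^^ n) x)\<^sup>2"
proof (induction n)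
  case 0
  show ?case by (simp add: lift_deriv_def)
next
  case (Suc n)
  let ?x = "(blaschke_lift \<omega> ^^ n) x" and ?s = "(blaschke_lift \<omega> ^^ n) s"
  let ?K = "if critical_hit x s n then critical_loss else 1"
  let ?H = "\<lambda>n. {i. i < n \<and> critical_hit x s i}"
  have "?s < ?x + 1"
    using lift_funpow_less_iff[of n s "x + 1"] assms lift_funpow_plus_int[of n x 1] by simp
  then have step: "blaschke_slope ?x * blaschke_slope ?s * (?s - ?x)\<^sup>2
      \<le> ?K * (blaschke_lift \<omega> ?s - blaschke_lift \<omega> ?x)\<^sup>2"
    using assms unfolding critical_hit_def by (intro slope_product_le) (simp_all add: lift_funpow_less_iff)
  have "?H (Suc n) = (if critical_hit x s n then insert n (?H n) else ?H n)"
    by (auto simp: less_Suc_eq)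
  then have card: "critical_loss ^ card (?H (Suc n)) = critical_loss ^ card (?H n) * ?K"
    by simp
  have "lift_deriv \<omega> (Suc n) x * lift_deriv \<omega> (Suc n) s * (s - x)\<^sup>2
    = (blaschke_slope ?x * blaschke_slope ?s) * (lift_deriv \<omega> n x * lift_deriv \<omega> n s * (s - x)\<^sup>2)"
    by (simp add: lift_deriv_Suc)
  also have "\<dots> \<le> (blaschke_slope ?x * blaschke_slope ?s) * (critical_loss ^ card (?H n) * (?s - ?x)\<^sup>2)"
    by (intro mult_left_mono Suc mult_nonneg_nonneg blaschke_slope_nonneg)
  also have "\<dots> = critical_loss ^ card (?H n) * (blaschke_slope ?x * blaschke_slope ?s * (?s - ?x)\<^sup>2)"
    by simp
  also have "\<dots> \<le> critical_loss ^ card (?H n) * (?K * (blaschke_lift \<omega> ?s - blaschke_lift \<omega> ?x)\<^sup>2)"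
    by (intro mult_left_mono step) (simp add: critical_loss_def)
  also have "\<dots> = critical_loss ^ card (?H (Suc n)) * ((blaschke_lift \<omega> ^^ Suc n) s - (blaschke_lift \<omega> ^^ Suc n) x)\<^sup>2"
    unfolding card by simp
  finally show ?case .
qed

text \<open>
  Two hits at times \<open>i < j\<close> put \<open>(j - i) \<alpha>\<close> within \<open>d\<close> of an integer, so they are at least \<open>N\<close> steps apart.
\<close>

lemma card_critical_hits_le:
  assumes N: "0 < N" and far: "\<And>k m. 0 < k \<Longrightarrow> k < N \<Longrightarrow> d < \<bar>real k * \<alpha> - of_int m\<bar>"
    and s: "semiconj s = semiconj x + d"
  shows "card {i. i < n \<and> critical_hit x s i} \<le> n div N + 1"
proof -
  let ?H = "{i. i < n \<and> critical_hit x s i}"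
  have bracket: "\<exists>m :: int. semiconj x + real i * \<alpha> \<le> of_int m \<and> of_int m \<le> semiconj x + real i * \<alpha> + d" if hit: "critical_hit x s i" for i
  proof -
    obtain m :: int where m: "(blaschke_lift \<omega> ^^ i) x < of_int m" "of_int m < (blaschke_lift \<omega> ^^ i) s"
      using hit unfolding critical_hit_def by blast
    have "semiconj ((blaschke_lift \<omega> ^^ i) x) \<le> semiconj (of_int m)" "semiconj (of_int m) \<le> semiconj ((blaschke_lift \<omega> ^^ i) s)"
      using semiconj_mono[OF less_imp_le[OF m(1)]] semiconj_mono[OF less_imp_le[OF m(2)]] .
    then show ?thesis using s by (intro exI[of _ m]) (simp add: semiconj_funpow)
  qed
  have apart: "i = j" if ij: "i \<le> j" "critical_hit x s i" "critical_hit x s j" "i div N = j div N" for i j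
  proof (rule ccontr)
    assume "i \<noteq> j"
    have "j - i < N"
    proof -
      have "i = i div N * N + i mod N" "j = i div N * N + j mod N" using ij(4) by (metis div_mult_mod_eq)+
      moreover have "j mod N < N" using N by simp
      ultimately show ?thesis by linarith
    qed
    obtain m m' :: int where m: "semiconj x + real i * \<alpha> \<le> of_int m" "of_int m \<le> semiconj x + real i * \<alpha> + d"
        "semiconj x + real j * \<alpha> \<le> of_int m'" "of_int m' \<le> semiconj x + real j * \<alpha> + d"
      using bracket[OF ij(2)] bracket[OF ij(3)] by blast
    have "real (j - i) * \<alpha> = real j * \<alpha> - real i * \<alpha>" using ij(1) by (simp add: of_nat_diff left_diff_distrib)
    then have "\<bar>real (j - i) * \<alpha> - of_int (m' - m)\<bar> \<le> d" using m by (simp add: abs_le_iff)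
    moreover have "d < \<bar>real (j - i) * \<alpha> - of_int (m' - m)\<bar>"
      using far[of "j - i" "m' - m"] \<open>j - i < N\<close> \<open>i \<noteq> j\<close> ij(1) by simp
    ultimately show False by simp
  qed
  have "inj_on (\<lambda>i. i div N) ?H"
  proof (rule inj_onI)
    fix i j assume "i \<in> ?H" "j \<in> ?H" "i div N = j div N"
    then show "i = j" using apart[of i j] apart[of j i] by (cases "i \<le> j") auto
  qed
  moreover have "(\<lambda>i. i div N) ` ?H \<subseteq> {..n div N}" by (auto intro: div_le_mono)
  ultimately have "card ?H \<le> card {..n div N}" by (intro card_inj_on_le) auto
  then show ?thesis by simp
qed

text \<open>
  Let \<open>s\<close> be a return of the critical value \<open>x\<close>, shifted to lie just to the right of \<open>x\<close>. Its derivative along \<open>n\<close>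
  steps is that of \<open>x\<close> along \<open>n + q\<close> steps, up to a factor independent of \<open>n\<close>, so \<open>orbit_pair_bound\<close> turns
  exponential growth at \<open>x\<close> into \<open>(l\<^bsup>2N\<^esup>)\<^sup>k \<le> const * K\<^sup>k\<close>. This fails as soon as \<open>l\<^bsup>2N\<^esup> > K\<close>.
\<close>

lemma not_collet_eckmann: "\<not> collet_eckmann_at (blaschke \<omega>) (Fin 1)"
proof
  define x where "x = blaschke_lift \<omega> 0"
  have "Fin 1 = circle_point 0" by (simp add: circle_point_def)
  then have x: "blaschke \<omega> (Fin 1) = circle_point x" by (simp only: x_def blaschke_circle_point)
  assume "collet_eckmann_at (blaschke \<omega>) (Fin 1)"
  then obtain C l where C: "0 < C" and l: "1 < l" and growth: "\<And>n. C * l ^ n \<le> lift_deriv \<omega> n x"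
    unfolding collet_eckmann_at_def x spherical_deriv_funpow_circle_point by blast
  have Kpos: "0 < critical_loss" "1 \<le> critical_loss" by (simp_all add: critical_loss_def)
  obtain N0 where "critical_loss < l ^ N0" using real_arch_pow[OF l] by blast
  define N where "N = Suc N0"
  have "l ^ N0 \<le> l ^ (2 * N)" unfolding N_def using l by (intro power_increasing) auto
  then have N: "0 < N" "critical_loss < l ^ (2 * N)"
    using \<open>critical_loss < l ^ N0\<close> by (simp_all add: N_def)
  obtain \<eta> where \<eta>: "0 < \<eta>" "\<And>k m. 0 < k \<Longrightarrow> k < N \<Longrightarrow> \<eta> < \<bar>real k * \<alpha> - of_int m\<bar>"
    using multiples_away_from_int[OF irrational_\<alpha>, of N] by blast
  have "0 < min \<eta> 1" using \<eta> by simp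
  then obtain q p where q: "0 < real q * \<alpha> + of_int p" "real q * \<alpha> + of_int p < min \<eta> 1"
    using irrational_orbit_dense[OF irrational_\<alpha>] by metis
  define d where "d = real q * \<alpha> + of_int p"
  define s where "s = (blaschke_lift \<omega> ^^ q) x + of_int p"
  have s: "semiconj s = semiconj x + d"
    by (simp add: s_def d_def semiconj_plus_int semiconj_funpow)
  have "x < s" using s q semiconj_mono[of s x] by (force simp: d_def)
  have "semiconj s < semiconj (x + of_int 1)" unfolding semiconj_plus_int s using q by (simp add: d_def)
  then have "s < x + 1" using semiconj_mono[of "x + 1" s] by force
  define A where "A = lift_deriv \<omega> q x"
  have bound: "(C * (s - x))\<^sup>2 * (l ^ (2 * N)) ^ k \<le> critical_loss ^ Suc k * A" for k
  proof -
    define n where "n = N * k"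
    have far: "d < \<bar>real j * \<alpha> - of_int m\<bar>" if "0 < j" "j < N" for j m
      using \<eta>(2)[OF that, of m] q by (simp add: d_def)
    have "card {i. i < n \<and> critical_hit x s i} \<le> Suc k"
      using card_critical_hits_le[OF N(1) far s, of n] N by (simp add: n_def)
    then have K: "critical_loss ^ card {i. i < n \<and> critical_hit x s i} \<le> critical_loss ^ Suc k"
      by (rule power_increasing[OF _ Kpos(2)])
    have "0 < (blaschke_lift \<omega> ^^ n) s - (blaschke_lift \<omega> ^^ n) x"
      using lift_funpow_less_iff[of n x s] \<open>x < s\<close> by simp
    moreover have "(blaschke_lift \<omega> ^^ n) s - (blaschke_lift \<omega> ^^ n) x < 1"
      using lift_funpow_less_iff[of n s "x + 1"] \<open>s < x + 1\<close> lift_funpow_plus_int[of n x 1] by simp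
    ultimately have one: "((blaschke_lift \<omega> ^^ n) s - (blaschke_lift \<omega> ^^ n) x)\<^sup>2 \<le> 1"
      by (intro power_le_one) auto
    have shift: "lift_deriv \<omega> n s * A = lift_deriv \<omega> (n + q) x"
      by (simp add: s_def A_def lift_deriv_plus_int lift_deriv_add)
    have pow: "(l ^ (2 * N)) ^ k = l ^ n * l ^ n"
      unfolding power_mult[symmetric] power_add[symmetric] n_def
      by (rule arg_cong[where f = "\<lambda>e. l ^ e"]) simp
    have "(C * (s - x))\<^sup>2 * (l ^ (2 * N)) ^ k = (C * l ^ n) * (C * l ^ n) * (s - x)\<^sup>2"
      unfolding pow by (simp add: power2_eq_square)
    also have "\<dots> \<le> lift_deriv \<omega> n x * lift_deriv \<omega> (n + q) x * (s - x)\<^sup>2"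
    proof (intro mult_right_mono mult_mono)
      have "C * l ^ n \<le> C * l ^ (n + q)" using C l by (intro mult_left_mono power_increasing) auto
      then show "C * l ^ n \<le> lift_deriv \<omega> (n + q) x" using growth[of "n + q"] by linarith
    qed (use growth C l lift_deriv_nonneg in auto)
    also have "\<dots> = (lift_deriv \<omega> n x * lift_deriv \<omega> n s * (s - x)\<^sup>2) * A"
      unfolding shift[symmetric] by simp
    also have "\<dots> \<le> (critical_loss ^ Suc k * 1) * A"
    proof (rule mult_right_mono)
      show "lift_deriv \<omega> n x * lift_deriv \<omega> n s * (s - x)\<^sup>2 \<le> critical_loss ^ Suc k * 1"
        using K one Kpos by (intro order.trans[OF orbit_pair_bound[OF \<open>x < s\<close> \<open>s < x + 1\<close>]] mult_mono) auto
    qed (simp add: A_def lift_deriv_nonneg)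
    finally show ?thesis by simp
  qed
  define B where "B = critical_loss * A / (C * (s - x))\<^sup>2"
  have "1 < l ^ (2 * N) / critical_loss" using N Kpos by simp
  then obtain k where k: "B < (l ^ (2 * N) / critical_loss) ^ k"
    using real_arch_pow by blast
  have "0 < (C * (s - x))\<^sup>2" using C \<open>x < s\<close> by simp
  then have "(l ^ (2 * N)) ^ k / critical_loss ^ k \<le> B"
    using bound[of k] Kpos unfolding B_def by (simp add: field_simps)
  then show False using k by (simp add: power_divide)
qed

end

section \<open>The support lies in the Julia set\<close>

text \<open>
  The chord is \<open>2 * \<bar>sin (\<pi> s)\<bar>\<close>, and the sine is bounded below by Jordan's inequality.
\<close>

lemma circle_chord_ge:
  assumes c: "0 < c" and far: "\<And>m :: int. c \<le> \<bar>s - of_int m\<bar>"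
  shows "4 * c \<le> cmod (cis (2 * pi * s) - 1)"
proof -
  define x where "x = s - of_int (round s)"
  have x: "c \<le> \<bar>x\<bar>" "\<bar>x\<bar> \<le> 1 / 2"
    using far[of "round s"] of_int_round_abs_le[of s] by (simp_all add: x_def abs_minus_commute)
  have "cis (2 * pi * s) = cis (2 * pi * x)"
    using circle_point_plus_int[of x "round s"] by (simp add: circle_point_def x_def)
  moreover have "(cmod (cis (2 * pi * x) - 1))\<^sup>2 = (2 * \<bar>sin (pi * x)\<bar>)\<^sup>2"
  proof -
    have "(cmod (cis (2 * pi * x) - 1))\<^sup>2 = (cos (2 * pi * x) - 1)\<^sup>2 + (sin (2 * pi * x))\<^sup>2"
      by (simp add: cmod_power2)
    also have "\<dots> = 2 - 2 * cos (2 * pi * x)"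
      using sin_cos_squared_add[of "2 * pi * x"] by (simp add: power2_eq_square algebra_simps)
    also have "\<dots> = 4 * (sin (pi * x))\<^sup>2" unfolding cos_double_pi by simp
    finally show ?thesis by (simp add: power_mult_distrib)
  qed
  then have "cmod (cis (2 * pi * x) - 1) = 2 * \<bar>sin (pi * x)\<bar>"
    by (rule power2_eq_imp_eq) auto
  moreover have "2 * \<bar>x\<bar> \<le> \<bar>sin (pi * x)\<bar>"
  proof (cases "0 \<le> x")
    case True
    then show ?thesis using sin_pi_ge[of x] x by simp
  next
    case False
    then show ?thesis using sin_pi_ge[of "- x"] x by simp
  qed
  ultimately show ?thesis using x by simp
qed

text \<open>
  The unit circle is the equator of the sphere, and a height below \<open>3 / 5\<close> means a modulus below \<open>2\<close>.
\<close>

lemma near_circle_bounded: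
  assumes "dist y (circle_point s) < 3 / 5"
  shows "y \<noteq> Infty" "cmod (finite_part y) \<le> 2"
proof -
  have 0: "snd (to_unit_sphere (circle_point s)) = 0" by (simp add: circle_point_def)
  have "dist (snd (to_unit_sphere y)) 0 < 3 / 5"
    using dist_snd_le[of "to_unit_sphere y" "to_unit_sphere (circle_point s)"] assms
    unfolding 0 dist_riemann_sphere_def by linarith
  then have lt: "\<bar>snd (to_unit_sphere y)\<bar> < 3 / 5" by simp
  show "y \<noteq> Infty" using lt by auto
  then obtain w where y: "y = Fin w" by (cases y) auto
  have p: "0 < (cmod w)\<^sup>2 + 1" by (smt (verit) zero_le_power2)
  have "((cmod w)\<^sup>2 - 1) / ((cmod w)\<^sup>2 + 1) < 3 / 5"
  proof -
    have "snd (to_unit_sphere y) < 3 / 5" using lt by linarith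
    then show ?thesis unfolding y to_unit_sphere.simps snd_conv .
  qed
  then have "(cmod w)\<^sup>2 \<le> 2\<^sup>2" using p by (simp add: divide_less_eq)
  then show "cmod (finite_part y) \<le> 2" using y power2_le_imp_le[of "cmod w" 2] by simp
qed

lemma orbit_avoids_pole:
  assumes "(blaschke \<omega> ^^ n) (Fin z) \<noteq> Infty" "i < n"
  shows "1 - 3 * (blaschke_fun \<omega> ^^ i) z \<noteq> 0"
  using assms
proof (induction n)
  case (Suc n)
  have fin: "(blaschke \<omega> ^^ n) (Fin z) \<noteq> Infty" using Suc.prems(1) by auto
  then have "(blaschke \<omega> ^^ n) (Fin z) = Fin ((blaschke_fun \<omega> ^^ n) z)"
    using finite_part_blaschke_funpow[of n \<omega> "Fin z"] Fin_finite_part by (metis finite_part.simps(1))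
  then have "1 - 3 * (blaschke_fun \<omega> ^^ n) z \<noteq> 0"
    using Suc.prems(1) by auto
  then show ?case using Suc fin by (cases "i = n") auto
qed simp

lemma isCont_blaschke_funpow_circle: "isCont (\<lambda>z. (blaschke \<omega> ^^ n) (Fin z)) (cis (2 * pi * t))"
proof (induction n)
  case 0
  show ?case using continuous_Fin[of UNIV] by (simp add: continuous_on_eq_continuous_at)
next
  case (Suc n)
  have "(blaschke \<omega> ^^ n) (Fin (cis (2 * pi * t))) = Fin (cis (2 * pi * (blaschke_lift \<omega> ^^ n) t))"
    using blaschke_funpow_circle_point[of n \<omega> t] unfolding circle_point_def .
  then have "isCont (blaschke \<omega>) ((blaschke \<omega> ^^ n) (Fin (cis (2 * pi * t))))"
    using isCont_blaschke_circle by simp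
  from isCont_o2[OF Suc this] show ?case by simp
qed

text \<open>
  Normality makes a subsequence of the iterates equicontinuous at the given point. The orbit of this
  point stays on the circle, so on a fixed neighbourhood these iterates avoid infinity and are bounded.
\<close>

lemma fatou_iterates_bounded:
  assumes "circle_point t \<in> fatou_set (blaschke \<omega>)"
  obtains \<rho> and r :: "nat \<Rightarrow> nat" where "0 < \<rho>" "strict_mono r"
    "\<And>n z. z \<in> ball (cis (2 * pi * t)) \<rho> \<Longrightarrow> (blaschke \<omega> ^^ r n) (Fin z) \<noteq> Infty"
    "\<And>n z. z \<in> ball (cis (2 * pi * t)) \<rho> \<Longrightarrow> cmod ((blaschke_fun \<omega> ^^ r n) z) \<le> 2"
proof -
  let ?z = "cis (2 * pi * t)" and ?f = "\<lambda>n. blaschke \<omega> ^^ n"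
  obtain U where U: "open U" "circle_point t \<in> U" "normal_family_on (range ?f) U"
    using assms unfolding fatou_set_def by blast
  have "open (Fin -` U)" using continuous_Fin[of UNIV] U(1) by (simp add: continuous_on_open_vimage)
  moreover have "?z \<in> Fin -` U" using U(2) by (simp add: circle_point_def)
  ultimately obtain e where e: "0 < e" "cball ?z e \<subseteq> Fin -` U"
    unfolding open_contains_cball by blast
  define K where "K = Fin ` cball ?z e"
  have "compact K" unfolding K_def by (intro compact_continuous_image continuous_Fin) auto
  moreover have "K \<subseteq> U" using e by (auto simp: K_def)
  moreover
  have "\<exists>r g. strict_mono r \<and> (\<forall>K. compact K \<and> K \<subseteq> U \<longrightarrow> uniform_limit K (\<lambda>n. ?f (r n)) g sequentially)"
    by (rule U(3)[unfolded normal_family_on_def, rule_format]) (rule subset_refl)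
  then obtain r g where r: "strict_mono (r :: nat \<Rightarrow> nat)"
      and lim: "\<forall>K. compact K \<and> K \<subseteq> U \<longrightarrow> uniform_limit K (\<lambda>n. ?f (r n)) g sequentially"
    by (elim exE conjE)
  ultimately have "uniform_limit K (\<lambda>n. ?f (r n)) g sequentially" by blast
  then have "\<forall>\<^sub>F n in sequentially. \<forall>x\<in>K. dist (?f (r n) x) (g x) < 1 / 10"
    unfolding uniform_limit_iff by (rule allE[of _ "1 / 10"]) simp
  then obtain N where N: "\<And>n x. N \<le> n \<Longrightarrow> x \<in> K \<Longrightarrow> dist (?f (r n) x) (g x) < 1 / 10"
    unfolding eventually_sequentially by blast
  obtain d where d: "0 < d" "\<And>z. dist z ?z < d \<Longrightarrow> dist (?f (r N) (Fin z)) (?f (r N) (Fin ?z)) < 1 / 10"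
    using isCont_blaschke_funpow_circle[of t "r N" \<omega>] unfolding continuous_at_eps_delta
    by (metis zero_less_divide_1_iff zero_less_numeral)
  \<comment> \<open>Pass through the limit \<open>g\<close> to the fixed iterate number \<open>r N\<close>, which is continuous at the centre, and back:
    this takes five steps of length below \<open>1 / 10\<close>.\<close>
  have near: "dist (?f (r (n + N)) (Fin z)) (circle_point ((blaschke_lift \<omega> ^^ r (n + N)) t)) < 3 / 5"
    if z: "z \<in> ball ?z (min d e)" for n z
  proof -
    have zK: "Fin z \<in> K" "Fin ?z \<in> K" using z e by (auto simp: K_def)
    have a: "dist (?f (r (n + N)) (Fin z)) (g (Fin z)) < 1 / 10" "dist (?f (r N) (Fin z)) (g (Fin z)) < 1 / 10"
      "dist (?f (r (n + N)) (Fin ?z)) (g (Fin ?z)) < 1 / 10" "dist (?f (r N) (Fin ?z)) (g (Fin ?z)) < 1 / 10"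
      using N zK by simp_all
    have b: "dist (?f (r N) (Fin z)) (?f (r N) (Fin ?z)) < 1 / 10"
      using z by (intro d(2)) (simp add: dist_commute)
    have "dist (?f (r (n + N)) (Fin z)) (?f (r (n + N)) (Fin ?z)) < 3 / 5"
      using a b dist_triangle[of "?f (r (n + N)) (Fin z)" "?f (r (n + N)) (Fin ?z)" "g (Fin z)"]
        dist_triangle[of "g (Fin z)" "?f (r (n + N)) (Fin ?z)" "?f (r N) (Fin z)"]
        dist_triangle[of "?f (r N) (Fin z)" "?f (r (n + N)) (Fin ?z)" "?f (r N) (Fin ?z)"]
        dist_triangle[of "?f (r N) (Fin ?z)" "?f (r (n + N)) (Fin ?z)" "g (Fin ?z)"]
      by (simp add: dist_commute)
    then show ?thesis
      using blaschke_funpow_circle_point[of "r (n + N)" \<omega> t] by (simp add: circle_point_def)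
  qed
  show ?thesis
  proof (rule that[of "min d e" "\<lambda>n. r (n + N)"])
    show "0 < min d e" using d e by simp
    show "strict_mono (\<lambda>n. r (n + N))" using r by (auto simp: strict_mono_def)
    show "?f (r (n + N)) (Fin z) \<noteq> Infty" if "z \<in> ball ?z (min d e)" for n z
      using near_circle_bounded(1)[OF near[OF that]] .
    show "cmod ((blaschke_fun \<omega> ^^ r (n + N)) z) \<le> 2" if "z \<in> ball ?z (min d e)" for n z
      using near_circle_bounded(2)[OF near[OF that]] by (simp add: finite_part_blaschke_funpow)
  qed
qed

context irrational_blaschke
begin

text \<open>
  If \<open>semiconj\<close> were constant around \<open>t\<close>, the complement of an arc that avoids \<open>t\<close> would be a
  neighbourhood of measure zero: its preimage under \<open>circle_section\<close> lies in \<open>semiconj t + \<int>\<close>, which is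
  countable.
\<close>

lemma support_on_circle:
  assumes "x \<in> measure_support rotation_measure"
  obtains t where "x = circle_point t" "\<And>e. 0 < e \<Longrightarrow> semiconj (t - e) < semiconj (t + e)"
proof -
  have supp: "0 < emeasure rotation_measure U" if "open U" "x \<in> U" for U
    using assms that unfolding measure_support_def by blast
  have "range circle_point = circle_point ` {0..1}"
  proof -
    have "circle_point t \<in> circle_point ` {0..1}" for t
      using circle_point_plus_int[of "frac t" "\<lfloor>t\<rfloor>"] frac_lt_1[of t]
      by (intro image_eqI[of _ _ "frac t"]) (simp_all add: frac_def)
    then show ?thesis by auto
  qed
  then have "compact (range circle_point)"
    using compact_continuous_image[OF continuous_circle_point, of "{0..1}"] by simp
  then have "open (- range circle_point)" by (simp add: compact_imp_closed open_Compl)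
  moreover have "emeasure rotation_measure (- range circle_point) = 0"
    using \<open>open (- range circle_point)\<close> by (subst emeasure_rotation_measure) (auto simp: circle_section_def)
  ultimately have "x \<in> range circle_point" using supp by (metis ComplI less_irrefl)
  then obtain t where t: "x = circle_point t" by blast
  have small: "semiconj (t - e) < semiconj (t + e)" if e: "0 < e" "e < 1 / 2" for e
  proof (rule ccontr)
    assume "\<not> semiconj (t - e) < semiconj (t + e)"
    then have flat: "semiconj s = semiconj t" if "t - e \<le> s" "s \<le> t + e" for s
      using semiconj_mono[of "t - e" s] semiconj_mono[of s "t + e"] semiconj_mono[of "t - e" t] semiconj_mono[of t "t + e"] that e
      by simp
    define V where "V = circle_point ` {t + e..t + 1 - e}"
    have "compact V" unfolding V_def by (intro compact_continuous_image continuous_circle_point) auto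
    then have "open (- V)" by (simp add: compact_imp_closed open_Compl)
    have "x \<notin> V"
    proof
      assume "x \<in> V"
      then obtain s m where "t + e \<le> s" "s \<le> t + 1 - e" "t = s + of_int m"
        by (auto simp: V_def t circle_point_eq_iff)
      then have "-1 < m" "m < 0" using e by linarith+
      then show False by simp
    qed
    have "{u. circle_section u \<in> - V} \<subseteq> (\<lambda>m :: int. semiconj t + of_int m) ` UNIV"
    proof
      fix u assume u: "u \<in> {u. circle_section u \<in> - V}"
      define m where "m = \<lfloor>section_pt u - t\<rfloor>"
      define s where "s = section_pt u - of_int m"
      have s: "t \<le> s" "s < t + 1" unfolding s_def m_def by linarith+
      have su: "section_pt u = s + of_int m" by (simp add: s_def)
      have "circle_section u = circle_point s" by (simp add: circle_section_def su circle_point_plus_int)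
      then have "\<not> (t + e \<le> s \<and> s \<le> t + 1 - e)" using u by (auto simp: V_def)
      then consider "s \<le> t + e" | "t + 1 - e \<le> s" by linarith
      then have "semiconj s = semiconj t \<or> semiconj s = semiconj t + 1"
      proof cases
        case 1
        then show ?thesis using flat[of s] s e by simp
      next
        case 2
        then have "semiconj (s + of_int (-1)) = semiconj t" using flat[of "s - 1"] s e by simp
        then show ?thesis unfolding semiconj_plus_int by simp
      qed
      moreover have "u = semiconj s + of_int m"
        using semiconj_section_pt[of u] unfolding su semiconj_plus_int by simp
      ultimately have "u = semiconj t + of_int m \<or> u = semiconj t + of_int (m + 1)" by auto
      then show "u \<in> (\<lambda>m :: int. semiconj t + of_int m) ` UNIV" by blast
    qed
    then have "countable ({u. circle_section u \<in> - V} \<inter> {0<..1})"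
      by (meson countable_Int1 countable_image countable_subset countableI_type)
    then have "emeasure rotation_measure (- V) = 0"
      using \<open>open (- V)\<close> by (subst emeasure_rotation_measure) (auto intro: emeasure_lborel_countable)
    moreover have "0 < emeasure rotation_measure (- V)"
      using supp[OF \<open>open (- V)\<close>] \<open>x \<notin> V\<close> by simp
    ultimately show False by simp
  qed
  have "semiconj (t - e) < semiconj (t + e)" if e: "0 < e" for e
  proof -
    have m: "0 < min e (1 / 4)" "min e (1 / 4) < 1 / 2" using e by (simp_all add: min_less_iff_disj)
    show ?thesis
    using small[of "min e (1 / 4)", OF m] e semiconj_mono[of "t - e" "t - min e (1 / 4)"]
      semiconj_mono[of "t + min e (1 / 4)" "t + e"] by simp
  qed
  then show ?thesis using that t by blast
qed

text \<open>
  The preimages of the critical point are dense as seen through \<open>semiconj\<close>, where they form the backward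
  orbit of \<open>0\<close> under an irrational rotation.
\<close>

lemma infinite_critical_preimages:
  assumes "semiconj a < semiconj b"
  shows "infinite {t. a < t \<and> t < b \<and> (\<exists>i. \<exists>m :: int. (blaschke_lift \<omega> ^^ i) t = of_int m)}" (is "infinite ?T")
proof -
  define X where "X = {u. semiconj a < u \<and> u < semiconj b \<and> (\<exists>i. \<exists>m :: int. u = of_int m - real i * \<alpha>)}"
  have "- \<alpha> \<notin> \<rat>" using irrational_\<alpha> by simp
  then have dense: "\<exists>v\<in>X. u < v" if "semiconj a \<le> u" "u < semiconj b" for u
  proof (rule irrational_orbit_dense[OF _ that(2)])
    fix n :: nat and m :: int
    assume "u < real n * - \<alpha> + of_int m" "real n * - \<alpha> + of_int m < semiconj b"
    then show "\<exists>v\<in>X. u < v"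
      using that by (intro bexI[of _ "of_int m - real n * \<alpha>"]) (auto simp: X_def)
  qed
  have "infinite X"
  proof (rule infinite_growing)
    show "X \<noteq> {}" using dense[of "semiconj a"] assms by auto
    show "\<exists>v\<in>X. u < v" if "u \<in> X" for u using dense[of u] that by (auto simp: X_def)
  qed
  moreover have "X \<subseteq> semiconj ` ?T"
  proof
    fix u assume "u \<in> X"
    then obtain i m where u: "semiconj a < u" "u < semiconj b" "u = of_int m - real i * \<alpha>" by (auto simp: X_def)
    have "surj (blaschke_lift \<omega> ^^ i)" using surj_F by (intro surj_fn) (metis surjI)
    then obtain t where t: "(blaschke_lift \<omega> ^^ i) t = of_int m" by (metis surjD)
    have "semiconj t = u" using semiconj_funpow[of i t] u(3) unfolding t by simp
    moreover from this have "a < t" "t < b" using u semiconj_mono[of t a] semiconj_mono[of b t] by force+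
    ultimately show "u \<in> semiconj ` ?T" using t by blast
  qed
  ultimately show ?thesis using finite_surj by blast
qed

end

context irrational_blaschke
begin

text \<open>
  If the point were in the Fatou set, Montel's theorem would give a holomorphic limit \<open>G\<close> of iterates near
  it. Its derivative vanishes at every preimage of the critical point, hence identically, so \<open>G\<close> is
  constant; but two points of the circle separated by \<open>semiconj\<close> keep a definite distance forever.
\<close>

lemma circle_point_in_julia:
  assumes pos: "\<And>e. 0 < e \<Longrightarrow> semiconj (t - e) < semiconj (t + e)"
  shows "circle_point t \<in> julia_set (blaschke \<omega>)"
proof (rule ccontr)
  let ?z = "cis (2 * pi * t)" and ?P = "\<lambda>n. blaschke_fun \<omega> ^^ n"
  assume "circle_point t \<notin> julia_set (blaschke \<omega>)"
  then have "circle_point t \<in> fatou_set (blaschke \<omega>)" by (simp add: julia_set_def)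
  then obtain \<rho> r where \<rho>: "0 < \<rho>" and r: "strict_mono (r :: nat \<Rightarrow> nat)"
    and fin: "\<And>n z. z \<in> ball ?z \<rho> \<Longrightarrow> (blaschke \<omega> ^^ r n) (Fin z) \<noteq> Infty"
    and bd: "\<And>n z. z \<in> ball ?z \<rho> \<Longrightarrow> cmod (?P (r n) z) \<le> 2"
    by (rule fatou_iterates_bounded) blast
  let ?B = "ball ?z \<rho>"
  have diff: "?P (r n) field_differentiable (at z)" if "z \<in> ?B" for n z
    by (rule blaschke_fun_funpow_differentiable) (rule orbit_avoids_pole[OF fin[OF that]])
  have holo: "?P (r n) holomorphic_on ?B" for n
    using diff by (auto simp: holomorphic_on_def intro: field_differentiable_at_within)
  obtain G k where G: "G holomorphic_on ?B" and k: "strict_mono (k :: nat \<Rightarrow> nat)"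
    and ptw: "\<And>x. x \<in> ?B \<Longrightarrow> ((\<lambda>n. ?P (r (k n)) x) \<longlongrightarrow> G x) sequentially"
    and ulim: "\<And>K. compact K \<Longrightarrow> K \<subseteq> ?B \<Longrightarrow> uniform_limit K ((\<lambda>n. ?P (r n)) \<circ> k) G sequentially"
  proof (rule Montel[where S = ?B and \<H> = "range (\<lambda>n. ?P (r n))" and \<F> = "\<lambda>n. ?P (r n)"])
    show "\<exists>B. \<forall>h\<in>range (\<lambda>n. ?P (r n)). \<forall>z\<in>K. cmod (h z) \<le> B" if "K \<subseteq> ?B" for K
      using bd that by (intro exI[of _ 2]) blast
  qed (use holo in auto)
  have "\<exists>g'. \<forall>x\<in>?B. (G has_field_derivative g' x) (at x) \<and> (\<lambda>n. deriv (?P (r (k n))) x) \<longlonglongrightarrow> g' x"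
  proof (rule has_complex_derivative_uniform_sequence[where S = ?B and g = G
        and f = "\<lambda>n. ?P (r (k n))" and f' = "\<lambda>n x. deriv (?P (r (k n))) x"])
    show "(?P (r (k n)) has_field_derivative deriv (?P (r (k n))) x) (at x)" if "x \<in> ?B" for n x
      by (rule field_differentiable_derivI[OF diff[OF that]])
    show "\<exists>d>0. cball x d \<subseteq> ?B \<and> uniform_limit (cball x d) (\<lambda>n. ?P (r (k n))) G sequentially" if xB: "x \<in> ?B" for x
    proof -
      obtain d where d: "0 < d" "cball x d \<subseteq> ?B"
        using open_contains_cball[THEN iffD1, OF open_ball, THEN bspec, OF xB] by (elim exE conjE)
      have "uniform_limit (cball x d) (\<lambda>n. ?P (r (k n))) G sequentially"
        using ulim[OF compact_cball d(2)] by (simp only: o_def)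
      then show ?thesis using d by (intro exI[of _ d] conjI)
    qed
  qed (rule open_ball)
  then obtain g' where "\<forall>x\<in>?B. (G has_field_derivative g' x) (at x) \<and> (\<lambda>n. deriv (?P (r (k n))) x) \<longlonglongrightarrow> g' x"
    by (elim exE)
  then have g': "(G has_field_derivative g' x) (at x)" "(\<lambda>n. deriv (?P (r (k n))) x) \<longlonglongrightarrow> g' x"
    if "x \<in> ?B" for x using that by simp_all
  have "continuous_on UNIV (\<lambda>s. cis (2 * pi * s))" by (intro continuous_intros)
  then have "isCont (\<lambda>s. cis (2 * pi * s)) t" by (simp add: continuous_on_eq_continuous_at)
  then obtain d where d: "0 < d" "\<And>s. dist s t < d \<Longrightarrow> dist (cis (2 * pi * s)) ?z < \<rho> / 2"
    unfolding continuous_at_eps_delta using \<rho> by (metis half_gt_zero)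
  define e where "e = min (d / 2) (1 / 4)"
  have e: "0 < e" "e < d" "e \<le> 1 / 4" using d by (auto simp: e_def)
  have inB: "cis (2 * pi * s) \<in> cball ?z (\<rho> / 2)" if "t - e \<le> s" "s \<le> t + e" for s
  proof -
    have "dist s t < d" using that e by (simp add: dist_real_def)
    from d(2)[OF this] show ?thesis by (simp add: dist_commute)
  qed
  have sub: "cball ?z (\<rho> / 2) \<subseteq> ?B" using \<rho> by auto
  define T where "T = {s. t - e < s \<and> s < t + e \<and> (\<exists>i. \<exists>m :: int. (blaschke_lift \<omega> ^^ i) s = of_int m)}"
  define Z where "Z = (\<lambda>s. cis (2 * pi * s)) ` T"
  have "inj_on (\<lambda>s. cis (2 * pi * s)) T"
  proof (rule inj_onI)
    fix s s' assume s: "s \<in> T" "s' \<in> T" "cis (2 * pi * s) = cis (2 * pi * s')"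
    then obtain m :: int where m: "s = s' + of_int m"
      using circle_point_eq_iff[of s s'] by (auto simp: circle_point_def)
    have "-1 < m" "m < 1" using m s e by (auto simp: T_def)
    then show "s = s'" using m by simp
  qed
  then have "infinite Z"
    unfolding Z_def T_def using infinite_critical_preimages[OF pos[OF e(1)]] finite_imageD by blast
  moreover have "Z \<subseteq> cball ?z (\<rho> / 2)" using inB by (auto simp: Z_def T_def)
  ultimately obtain \<xi> where \<xi>: "\<xi> \<in> cball ?z (\<rho> / 2)" "\<xi> islimpt Z"
    using compact_cball[of ?z "\<rho> / 2"] unfolding compact_eq_Bolzano_Weierstrass by blast
  have zero: "g' z = 0" if zZ: "z \<in> Z" for z
  proof -
    obtain s i m where s: "z = cis (2 * pi * s)" "t - e < s" "s < t + e" "(blaschke_lift \<omega> ^^ i) s = of_int (m :: int)"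
      using zZ by (auto simp: Z_def T_def)
    have zB: "z \<in> ?B" using inB[of s] s sub by auto
    have "\<forall>\<^sub>F n in sequentially. deriv (?P (r (k n))) z = 0"
      unfolding eventually_sequentially
    proof (intro exI[of _ "Suc i"] allI impI)
      fix n assume "Suc i \<le> n"
      moreover have "n \<le> k n" "k n \<le> r (k n)" by (rule seq_suble[OF k], rule seq_suble[OF r])
      ultimately show "deriv (?P (r (k n))) z = 0"
        unfolding s(1) by (intro critical_preimage_deriv_zero[OF s(4)]) simp
    qed
    then have "(\<lambda>n. deriv (?P (r (k n))) z) \<longlonglongrightarrow> 0" by (rule tendsto_eventually)
    then show ?thesis using LIMSEQ_unique[OF g'(2)[OF zB]] by blast
  qed
  have "g' holomorphic_on ?B"
    using holomorphic_deriv[OF G open_ball] by (rule holomorphic_transform) (use g'(1) DERIV_imp_deriv in blast)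
  have g'0: "g' w = 0" if "w \<in> ?B" for w
  proof (rule analytic_continuation[OF \<open>g' holomorphic_on ?B\<close> open_ball connected_ball _ _ \<xi>(2) zero that])
    show "Z \<subseteq> ?B" using \<open>Z \<subseteq> cball ?z (\<rho> / 2)\<close> sub by (rule subset_trans)
    show "\<xi> \<in> ?B" using \<xi>(1) sub by (rule subsetD[rotated])
  qed
  have "\<exists>c. \<forall>x\<in>?B. G x = c"
  proof (rule has_field_derivative_zero_constant[OF convex_ball])
    fix x assume "x \<in> ?B"
    then show "(G has_field_derivative 0) (at x within ?B)"
      using g'(1)[of x] g'0[of x] by (simp add: has_field_derivative_at_within)
  qed
  then obtain c where "\<forall>x\<in>?B. G x = c" by (elim exE)
  then have c: "G x = c" if "x \<in> ?B" for x using that by (rule bspec)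
  define u1 where "u1 = semiconj (t - e)"
  define u2 where "u2 = min (semiconj (t + e)) (u1 + 1 / 2)"
  define t2 where "t2 = section_pt u2"
  have u: "u1 < u2" "u2 - u1 < 1" using pos[OF e(1)] by (auto simp: u1_def u2_def)
  have t2: "semiconj t2 = u2" "t2 \<le> t + e" by (simp_all add: t2_def section_pt_le_iff u2_def)
  have "t - e < t2" using u by (simp add: t2_def less_section_pt_iff u1_def)
  then have in2: "cis (2 * pi * (t - e)) \<in> ?B" "cis (2 * pi * t2) \<in> ?B"
    using inB[of "t - e"] inB[of t2] sub t2(2) e by auto
  obtain h where h: "0 < h" "\<And>s s' m. semiconj s - semiconj s' = u2 - u1 \<Longrightarrow> h \<le> \<bar>s - s' - of_int m\<bar>"
    using separation_mod_one[of "u2 - u1"] u by auto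
  have "(\<lambda>n. ?P (r (k n)) (cis (2 * pi * t2)) - ?P (r (k n)) (cis (2 * pi * (t - e)))) \<longlonglongrightarrow> G (cis (2 * pi * t2)) - G (cis (2 * pi * (t - e)))"
    by (intro tendsto_diff ptw in2)
  then have "(\<lambda>n. cmod (?P (r (k n)) (cis (2 * pi * t2)) - ?P (r (k n)) (cis (2 * pi * (t - e))))) \<longlonglongrightarrow> 0"
    using c[OF in2(1)] c[OF in2(2)] by (simp add: tendsto_norm_zero)
  moreover have "4 * h \<le> cmod (?P n (cis (2 * pi * t2)) - ?P n (cis (2 * pi * (t - e))))" for n
  proof -
    let ?a = "(blaschke_lift \<omega> ^^ n) t2" and ?b = "(blaschke_lift \<omega> ^^ n) (t - e)"
    have "4 * h \<le> cmod (cis (2 * pi * (?a - ?b)) - 1)"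
      by (rule circle_chord_ge[OF h(1)]) (rule h(2), simp add: semiconj_funpow t2 u1_def)
    also have "\<dots> = cmod (cis (2 * pi * ?b)) * cmod (cis (2 * pi * (?a - ?b)) - 1)" by simp
    also have "\<dots> = cmod (cis (2 * pi * ?b) * (cis (2 * pi * (?a - ?b)) - 1))" by (simp only: norm_mult)
    also have "cis (2 * pi * ?b) * (cis (2 * pi * (?a - ?b)) - 1) = cis (2 * pi * ?a) - cis (2 * pi * ?b)"
      by (simp add: right_diff_distrib cis_mult)
    finally show ?thesis unfolding blaschke_fun_funpow_circle .
  qed
  ultimately have "4 * h \<le> 0" by (intro LIMSEQ_le_const) auto
  then show False using h(1) by simp
qed

lemma support_rotation_measure: "measure_support rotation_measure \<subseteq> julia_set (blaschke \<omega>)"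
  using support_on_circle circle_point_in_julia by (metis subsetI)

end

theorem theorem3:
  fixes \<omega> :: real
  assumes "0 \<le> \<omega>" and "\<omega> < 1"
    and "rotation_number (blaschke \<omega>) \<notin> \<rat>"
  shows "(\<exists>\<mu> :: riemann_sphere measure.
            borel_probability \<mu>
            \<and> invariant_measure (blaschke \<omega>) \<mu>
            \<and> ergodic_measure (blaschke \<omega>) \<mu>
            \<and> non_atomic \<mu>
            \<and> measure_support \<mu> \<subseteq> julia_set (blaschke \<omega>)
            \<and> integrable \<mu> (\<lambda>x. ln (spherical_deriv (blaschke \<omega>) x))
            \<and> lyapunov_exponent (blaschke \<omega>) \<mu> = 0)
         \<and> \<not> collet_eckmann_at (blaschke \<omega>) (Fin 1)"
proof -
  obtain \<alpha> where \<alpha>: "\<And>n t. \<bar>(blaschke_lift \<omega> ^^ n) t - t - real n * \<alpha>\<bar> \<le> 2"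
    using translation_number_exists[OF strict_mono_mono[OF strict_mono_blaschke_lift], of \<omega>]
      blaschke_lift_plus_one by metis
  have "\<alpha> \<notin> \<rat>"
    using assms(3) unfolding rotation_number_conv[OF \<alpha>] frac_def by (auto intro: Rats_diff)
  then interpret irrational_blaschke \<omega> \<alpha>
    by unfold_locales (rule \<alpha>)
  show ?thesis
    using borel_probability_rotation_measure invariant_rotation_measure ergodic_rotation_measure
      non_atomic_rotation_measure support_rotation_measure integrable_ln_spherical_deriv
      lyapunov_exponent_rotation_measure not_collet_eckmann by blast
qed

end
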